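(* The Faà di Bruno bialgebra in two noncommuting variables $\mathcal F^{\langle 2\rangle}$ is isomorphic to the homotopy cardinality of the incidence bialgebra of the simplicial groupoid $\mathcal B^{\mathsf S^{\mathrm r}}\mathsf{Ass}_2$.
   Context: Monads and operads. $\mathsf{M}^{\mathrm r}$ is the monad on the category of groupoids sending $A$ to $\bigsqcup_{n\ge 1}A^n$ (nonempty tuples, morphisms componentwise), unit $a\mapsto (a)$, multiplication $\mu$ concatenation. $\mathsf{S}^{\mathrm r}$ sends $A$ to $\bigsqcup_{n\ge1}A^n/\!/\mathfrak S_n$ (same objects, with additional isomorphisms $(a_1,\dots,a_n)\to(a_{\sigma(1)},\dots,a_{\sigma(n)})$), same unit and multiplication; the inclusion $\mathsf M^{\mathrm r}\Rightarrow\mathsf S^{\mathrm r}$ is a monad map. An $\mathsf M^{\mathrm r}$-operad $Q$ consists of groupoids $Q_0$ (colours), $Q_1$ (operations), functors $s\colon Q_1\to\mathsf M^{\mathrm r}Q_0$, $t\colon Q_1\to Q_0$, composition $m\colon\mathsf M^{\mathrm r}Q_1\times_{\mathsf M^{\mathrm r}Q_0}Q_1\to Q_1$ (the $Q_1$ factor the root) and units, with the usual laws. $\mathsf{Ass}_2$ is the terminal $\mathsf M^{\mathrm r}$-operad on the discrete colour set $K=\{1,2\}$: $Q_0=K$, $Q_1=\mathsf M^{\mathrm r}K\times K$, $s,t$ projections, composition induced by $\mu$ (exactly one operation for each nonempty sequence of input colours and output colour). Bar construction. For an $\mathsf M^{\mathrm r}$-operad $Q$, $Q_n:=\mathsf M^{\mathrm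 r}Q_{n-1}\times_{\mathsf M^{\mathrm r}Q_0}Q_1$ ($n\ge2$). $\mathcal B^{\mathsf S^{\mathrm r}}Q$ has $n$-simplices $\mathsf S^{\mathrm r}Q_n$; $d_0$ discards the top (leafward) level keeping outputs, $d_n$ discards the root level and flattens using $\mathsf M^{\mathrm r}\Rightarrow\mathsf S^{\mathrm r}$ and the multiplication of $\mathsf S^{\mathrm r}$, inner faces compose adjacent levels via $m$, degeneracies insert units. Incidence bialgebra. $|G|=\sum_{[x]}1/|\mathrm{Aut}(x)|$. For $X=\mathcal B^{\mathsf S^{\mathrm r}}Q$, $\mathbb Q_{\pi_0X_1}$ has basis $\delta_a$; $\Delta(\delta_f)=\sum_{a,b}\frac{|\Phi_{f;a,b}|}{|\mathrm{Aut}(a)||\mathrm{Aut}(b)|}\delta_a\otimes\delta_b$ with $\Phi_{f;a,b}$ the homotopy fibre over $(a,b)$ of $(d_2,d_0)$ restricted to the homotopy fibre of $d_1$ over $f$; $\epsilon(\delta_f)=$ cardinality of the homotopy fibre of $s_0$ over $f$; product by juxtaposition (unit adjoined). The bialgebra. Write elements of the ring $\mathbb Q\langle\langle x,y\rangle\rangle_+$ of power series in noncommuting variables $x,y$ without constant term as $F=\sum_\omega f_\omega\,\omega$, $\omega$ ranging over nonempty words in $x,y$. Pairs of such series form a monoid under substitution $(G^1,G^2)\circ(F^1,F^2)=(G^1(F^1,F^2),G^2(F^1,F^2))$. $\mathcal F^{\langle2\rangle}$ is the polynomial algebra on the maps $a^i_\omega(F^1,F^2)=f^i_\omega$ ($i=1,2$),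 with comultiplication $\Delta(a^i_\omega)((F^1,F^2),(G^1,G^2))=a^i_\omega((G^1,G^2)\circ(F^1,F^2))$ and counit $\epsilon(a^i_\omega)=a^i_\omega(x,y)$. *)

theory Defs
  imports Complex_Main "HOL-Library.Poly_Mapping" "HOL-Library.Product_Plus" "HOL-Combinatorics.Permutations"
begin

section \<open>Groupoids\<close>

record ('o, 'm) gpd =
  Obj :: "'o set"
  Arr :: "'m set"
  Dom :: "'m \<Rightarrow> 'o"
  Cod :: "'m \<Rightarrow> 'o"
  Ide :: "'o \<Rightarrow> 'm"
  Cmp :: "'m \<Rightarrow> 'm \<Rightarrow> 'm"  \<comment> \<open>\<open>Cmp G g f\<close> is \<open>g\<close> after \<open>f\<close>\<close>

locale groupoid =
  fixes G :: "('o, 'm) gpd"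
  assumes Dom_Obj: "f \<in> Arr G \<Longrightarrow> Dom G f \<in> Obj G"
    and Cod_Obj: "f \<in> Arr G \<Longrightarrow> Cod G f \<in> Obj G"
    and Ide_Arr: "x \<in> Obj G \<Longrightarrow> Ide G x \<in> Arr G \<and> Dom G (Ide G x) = x \<and> Cod G (Ide G x) = x"
    and Cmp_Arr: "\<lbrakk>f \<in> Arr G; g \<in> Arr G; Cod G f = Dom G g\<rbrakk> \<Longrightarrow>
      Cmp G g f \<in> Arr G \<and> Dom G (Cmp G g f) = Dom G f \<and> Cod G (Cmp G g f) = Cod G g"
    and Cmp_Ide: "f \<in> Arr G \<Longrightarrow> Cmp G f (Ide G (Dom G f)) = f \<and> Cmp G (Ide G (Cod G f)) f = f"
    and Cmp_assoc: "\<lbrakk>f \<in> Arr G; g \<in> Arr G; h \<in> Arr G; Cod G f = Dom G g; Cod G g = Dom G h\<rbrakk> \<Longrightarrow>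
      Cmp G h (Cmp G g f) = Cmp G (Cmp G h g) f"
    and inverse: "f \<in> Arr G \<Longrightarrow> \<exists>g \<in> Arr G. Dom G g = Cod G f \<and> Cod G g = Dom G f \<and>
      Cmp G g f = Ide G (Dom G f) \<and> Cmp G f g = Ide G (Cod G f)"

record ('o, 'm, 'p, 'n) ftor =
  onO :: "'o \<Rightarrow> 'p"
  onA :: "'m \<Rightarrow> 'n"

definition is_functor :: "('o, 'm) gpd \<Rightarrow> ('p, 'n) gpd \<Rightarrow> ('o, 'm, 'p, 'n) ftor \<Rightarrow> bool" where
  "is_functor G H F \<longleftrightarrow>
     (\<forall>x \<in> Obj G. onO F x \<in> Obj H \<and> onA F (Ide G x) = Ide H (onO F x)) \<and>
     (\<forall>f \<in> Arr G. onA F f \<in> Arr H \<and> Dom H (onA F f) = onO F (Dom G f) \<and> Cod H (onA F f) = onO F (Cod G f)) \<and>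
     (\<forall>f \<in> Arr G. \<forall>g \<in> Arr G. Cod G f = Dom G g \<longrightarrow> onA F (Cmp G g f) = Cmp H (onA F g) (onA F f))"

definition ftor_comp :: "('p, 'n, 'q, 'l) ftor \<Rightarrow> ('o, 'm, 'p, 'n) ftor \<Rightarrow> ('o, 'm, 'q, 'l) ftor" where
  "ftor_comp F' F = \<lparr>onO = onO F' \<circ> onO F, onA = onA F' \<circ> onA F\<rparr>"

definition ftor_pair :: "('o, 'm, 'p, 'n) ftor \<Rightarrow> ('o, 'm, 'p', 'n') ftor \<Rightarrow> ('o, 'm, 'p \<times> 'p', 'n \<times> 'n') ftor" where
  "ftor_pair F F' = \<lparr>onO = (\<lambda>x. (onO F x, onO F' x)), onA = (\<lambda>f. (onA F f, onA F' f))\<rparr>"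

definition discrete :: "'o set \<Rightarrow> ('o, 'o) gpd" where
  "discrete K = \<lparr>Obj = K, Arr = K, Dom = id, Cod = id, Ide = id, Cmp = (\<lambda>g f. f)\<rparr>"

definition gprod :: "('o, 'm) gpd \<Rightarrow> ('p, 'n) gpd \<Rightarrow> ('o \<times> 'p, 'm \<times> 'n) gpd" where
  "gprod G H = \<lparr>Obj = Obj G \<times> Obj H, Arr = Arr G \<times> Arr H,
     Dom = map_prod (Dom G) (Dom H), Cod = map_prod (Cod G) (Cod H),
     Ide = map_prod (Ide G) (Ide H),
     Cmp = (\<lambda>(g, g') (f, f'). (Cmp G g f, Cmp H g' f'))\<rparr>"

text \<open>The strict pullback of \<open>F\<close> on \<open>G\<close> and \<open>F'\<close> on \<open>H\<close>, two functors with common codomain.\<close>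

definition pullback :: "('o, 'm) gpd \<Rightarrow> ('p, 'n) gpd \<Rightarrow> ('o, 'm, 'c, 'k) ftor \<Rightarrow> ('p, 'n, 'c, 'k) ftor
    \<Rightarrow> ('o \<times> 'p, 'm \<times> 'n) gpd" where
  "pullback G H F F' = (gprod G H)
     \<lparr>Obj := {(x, y). x \<in> Obj G \<and> y \<in> Obj H \<and> onO F x = onO F' y},
      Arr := {(f, g). f \<in> Arr G \<and> g \<in> Arr H \<and> onA F f = onA F' g}\<rparr>"

text \<open>Transport of a groupoid along injections on objects and on arrows.\<close>

definition relabel :: "('o \<Rightarrow> 'p) \<Rightarrow> ('m \<Rightarrow> 'n) \<Rightarrow> ('o, 'm) gpd \<Rightarrow> ('p, 'n) gpd" where
  "relabel i j G = \<lparr>Obj = i ` Obj G, Arr = j ` Arr G,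
     Dom = (\<lambda>f. i (Dom G (inv j f))), Cod = (\<lambda>f. i (Cod G (inv j f))),
     Ide = (\<lambda>x. j (Ide G (inv i x))),
     Cmp = (\<lambda>g f. j (Cmp G (inv j g) (inv j f)))\<rparr>"

text \<open>The homotopy fibre over \<open>b\<close> of \<open>F\<close> from \<open>G\<close> to \<open>H\<close>: objects are pairs \<open>(x, \<phi>)\<close>
  with \<open>\<phi>\<close> from \<open>F x\<close> to \<open>b\<close>, and an arrow carries its source and target.\<close>

definition hfib :: "('o, 'm) gpd \<Rightarrow> ('p, 'n) gpd \<Rightarrow> ('o, 'm, 'p, 'n) ftor \<Rightarrow> 'p
    \<Rightarrow> ('o \<times> 'n, ('o \<times> 'n) \<times> 'm \<times> ('o \<times> 'n)) gpd" where
  "hfib G H F b =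
    (let E = {(x, \<phi>). x \<in> Obj G \<and> \<phi> \<in> Arr H \<and> Dom H \<phi> = onO F x \<and> Cod H \<phi> = b} in
     \<lparr>Obj = E,
      Arr = {((x, \<phi>), f, (y, \<psi>)). (x, \<phi>) \<in> E \<and> (y, \<psi>) \<in> E \<and> f \<in> Arr G \<and>
               Dom G f = x \<and> Cod G f = y \<and> Cmp H \<psi> (onA F f) = \<phi>},
      Dom = (\<lambda>(p, f, q). p), Cod = (\<lambda>(p, f, q). q),
      Ide = (\<lambda>p. (p, Ide G (fst p), p)),
      Cmp = (\<lambda>(p', g, q') (p, f, q). (p, Cmp G g f, q'))\<rparr>)"

definition hfib_proj :: "('o \<times> 'n, ('o \<times> 'n) \<times> 'm \<times> ('o \<times> 'n), 'o, 'm) ftor" where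
  "hfib_proj = \<lparr>onO = fst, onA = (\<lambda>(p, f, q). f)\<rparr>"

definition iso_rel :: "('o, 'm) gpd \<Rightarrow> ('o \<times> 'o) set" where
  "iso_rel G = {(x, y). x \<in> Obj G \<and> y \<in> Obj G \<and> (\<exists>f \<in> Arr G. Dom G f = x \<and> Cod G f = y)}"

definition pi0 :: "('o, 'm) gpd \<Rightarrow> 'o set set" where
  "pi0 G = Obj G // iso_rel G"

definition cls :: "('o, 'm) gpd \<Rightarrow> 'o \<Rightarrow> 'o set" where
  "cls G x = iso_rel G `` {x}"

definition rep :: "'o set \<Rightarrow> 'o" where
  "rep c = (SOME x. x \<in> c)"

definition Aut :: "('o, 'm) gpd \<Rightarrow> 'o \<Rightarrow> 'm set" where
  "Aut G x = {f \<in> Arr G. Dom G f = x \<and> Cod G f = x}"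

definition finite_gpd :: "('o, 'm) gpd \<Rightarrow> bool" where
  "finite_gpd G \<longleftrightarrow> finite (pi0 G) \<and> (\<forall>x \<in> Obj G. finite (Aut G x))"

text \<open>Homotopy cardinality; only meaningful when \<^const>\<open>finite_gpd\<close> holds.\<close>

definition hcard :: "('o, 'm) gpd \<Rightarrow> rat" where
  "hcard G = (\<Sum>c \<in> pi0 G. 1 / of_nat (card (Aut G (rep c))))"


section \<open>The monads of nonempty tuples\<close>

definition Mr :: "('o, 'm) gpd \<Rightarrow> ('o list, 'm list) gpd" where
  "Mr G = \<lparr>Obj = {xs. xs \<noteq> [] \<and> set xs \<subseteq> Obj G}, Arr = {fs. fs \<noteq> [] \<and> set fs \<subseteq> Arr G},
     Dom = map (Dom G), Cod = map (Cod G), Ide = map (Ide G), Cmp = map2 (Cmp G)\<rparr>"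

definition Mr_map :: "('o, 'm, 'p, 'n) ftor \<Rightarrow> ('o list, 'm list, 'p list, 'n list) ftor" where
  "Mr_map F = \<lparr>onO = map (onO F), onA = map (onA F)\<rparr>"

text \<open>An arrow \<open>(\<sigma>, [f\<^sub>0, \<dots>, f\<^sub>n\<^sub>-\<^sub>1])\<close> from \<open>xs\<close> to \<open>ys\<close> consists of a permutation \<open>\<sigma>\<close> of the
  positions \<open>{..<n}\<close> and of arrows \<open>f\<^sub>i\<close> from \<open>xs ! \<sigma> i\<close> to \<open>ys ! i\<close>.  With identities for the \<open>f\<^sub>i\<close>
  it is the arrow from \<open>xs\<close> to \<open>permute_list \<sigma> xs\<close>.\<close>

type_synonym 'm sarr = "(nat \<Rightarrow> nat) \<times> 'm list"

definition Sr :: "('o, 'm) gpd \<Rightarrow> ('o list, 'm sarr) gpd" where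
  "Sr G = \<lparr>Obj = {xs. xs \<noteq> [] \<and> set xs \<subseteq> Obj G},
     Arr = {(\<sigma>, fs). fs \<noteq> [] \<and> set fs \<subseteq> Arr G \<and> \<sigma> permutes {..<length fs}},
     Dom = (\<lambda>(\<sigma>, fs). permute_list (inv \<sigma>) (map (Dom G) fs)),
     Cod = (\<lambda>(\<sigma>, fs). map (Cod G) fs),
     Ide = (\<lambda>xs. (id, map (Ide G) xs)),
     Cmp = (\<lambda>(\<tau>, gs) (\<sigma>, fs). (\<sigma> \<circ> \<tau>, map2 (Cmp G) gs (permute_list \<tau> fs)))\<rparr>"

definition Sr_map :: "('o, 'm, 'p, 'n) ftor \<Rightarrow> ('o list, 'm sarr, 'p list, 'n sarr) ftor" where
  "Sr_map F = \<lparr>onO = map (onO F), onA = (\<lambda>(\<sigma>, fs). (\<sigma>, map (onA F) fs))\<rparr>"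

definition Mr_Sr :: "('o list, 'm list, 'o list, 'm sarr) ftor" where
  "Mr_Sr = \<lparr>onO = id, onA = (\<lambda>fs. (id, fs))\<rparr>"

text \<open>The multiplication of \<open>Sr\<close> on an arrow \<open>(\<tau>, [(\<sigma>\<^sub>0, fs\<^sub>0), \<dots>])\<close>: position \<open>j\<close> of the \<open>i\<close>-th block of the
  target comes from position \<open>\<sigma>\<^sub>i j\<close> of the \<open>\<tau> i\<close>-th block of the source.  The \<open>l\<close>-th block of the
  source has the same length as \<open>fs\<^sub>k\<close> where \<open>\<tau> k = l\<close>.\<close>

definition block_perm :: "(nat \<Rightarrow> nat) \<Rightarrow> 'm sarr list \<Rightarrow> nat \<Rightarrow> nat" where
  "block_perm \<tau> bs =
    (let offset = (\<lambda>l. \<Sum>l' < l. length (snd (bs ! inv \<tau> l')));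
         L = concat (map (\<lambda>i. map (\<lambda>j. offset (\<tau> i) + fst (bs ! i) j) [0..<length (snd (bs ! i))]) [0..<length bs])
     in (\<lambda>p. if p < length L then L ! p else p))"

definition Sr_mult :: "('o list list, 'm sarr sarr, 'o list, 'm sarr) ftor" where
  "Sr_mult = \<lparr>onO = concat, onA = (\<lambda>(\<tau>, bs). (block_perm \<tau> bs, concat (map snd bs)))\<rparr>"


section \<open>Operads over the monad \<open>Mr\<close>\<close>

record ('c, 'd, 'q, 'r) operad =
  colours :: "('c, 'd) gpd"
  operations :: "('q, 'r) gpd"
  inputs :: "('q, 'r, 'c list, 'd list) ftor"
  root_colour :: "('q, 'r, 'c, 'd) ftor"
  compose :: "('q list \<times> 'q, 'r list \<times> 'r, 'q, 'r) ftor"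
  unit_op :: "('c, 'd, 'q, 'r) ftor"

text \<open>The equational laws, to be used once for objects and once for arrows.\<close>

definition operad_laws ::
  "'c set \<Rightarrow> 'q set \<Rightarrow> ('q \<Rightarrow> 'c list) \<Rightarrow> ('q \<Rightarrow> 'c) \<Rightarrow> ('q list \<times> 'q \<Rightarrow> 'q) \<Rightarrow> ('c \<Rightarrow> 'q) \<Rightarrow> bool" where
  "operad_laws C Q s t m u \<longleftrightarrow>
     (\<forall>ps q. ps \<noteq> [] \<and> set ps \<subseteq> Q \<and> q \<in> Q \<and> map t ps = s q \<longrightarrow>
        s (m (ps, q)) = concat (map s ps) \<and> t (m (ps, q)) = t q) \<and>
     (\<forall>c \<in> C. s (u c) = [c] \<and> t (u c) = c) \<and>
     (\<forall>q \<in> Q. m (map u (s q), q) = q \<and> m ([q], u (t q)) = q) \<and>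
     (\<forall>rss ps q. ps \<noteq> [] \<and> set ps \<subseteq> Q \<and> q \<in> Q \<and> map t ps = s q \<and>
        length rss = length ps \<and> (\<forall>rs \<in> set rss. rs \<noteq> [] \<and> set rs \<subseteq> Q) \<and> map (map t) rss = map s ps \<longrightarrow>
        m (concat rss, m (ps, q)) = m (map m (zip rss ps), q))"

definition is_operad :: "('c, 'd, 'q, 'r) operad \<Rightarrow> bool" where
  "is_operad P \<longleftrightarrow>
     groupoid (colours P) \<and> groupoid (operations P) \<and>
     is_functor (operations P) (Mr (colours P)) (inputs P) \<and>
     is_functor (operations P) (colours P) (root_colour P) \<and>
     is_functor (pullback (Mr (operations P)) (operations P) (Mr_map (root_colour P)) (inputs P))
       (operations P) (compose P) \<and>
     is_functor (colours P) (operations P) (unit_op P) \<and>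
     operad_laws (Obj (colours P)) (Obj (operations P))
       (onO (inputs P)) (onO (root_colour P)) (onO (compose P)) (onO (unit_op P)) \<and>
     operad_laws (Arr (colours P)) (Arr (operations P))
       (onA (inputs P)) (onA (root_colour P)) (onA (compose P)) (onA (unit_op P))"

datatype two = One | Two

definition Ass2 :: "(two, two, two list \<times> two, two list \<times> two) operad" where
  "Ass2 =
    (let K = discrete UNIV in
     \<lparr>colours = K, operations = gprod (Mr K) K,
      inputs = \<lparr>onO = fst, onA = fst\<rparr>, root_colour = \<lparr>onO = snd, onA = snd\<rparr>,
      compose = \<lparr>onO = (\<lambda>(ps, q). (concat (map fst ps), snd q)),
                 onA = (\<lambda>(ps, q). (concat (map fst ps), snd q))\<rparr>,
      unit_op = \<lparr>onO = (\<lambda>c. ([c], c)), onA = (\<lambda>c. ([c], c))\<rparr>\<rparr>)"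

lemma is_operad_Ass2: "is_operad Ass2"
proof -
  have M: "map2 (\<lambda>g f. f) fs fs = fs" for fs :: "two list"
    by (induction fs) auto
  have K: "groupoid (discrete (UNIV :: two set))"
    by unfold_locales (auto simp: discrete_def)
  have Q: "groupoid (gprod (Mr (discrete (UNIV :: two set))) (discrete UNIV))"
    by unfold_locales (auto simp: discrete_def gprod_def Mr_def M)
  have laws: "operad_laws UNIV ({xs :: two list. xs \<noteq> []} \<times> UNIV) fst snd
      (\<lambda>(ps, q). (concat (map fst ps), snd q)) (\<lambda>c. ([c], c))"
  proof -
    have "concat (map fst (concat rss)) = concat (map fst (map (\<lambda>(ps, q). (concat (map fst ps), snd q)) (zip rss ps)))"
      if "length rss = length ps" for rss and ps :: "(two list \<times> two) list"
      using that by (induction rss ps rule: list_induct2) auto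
    then show ?thesis
      by (auto simp: operad_laws_def comp_def)
  qed
  have ne: "\<exists>p \<in> set ps. fst p \<noteq> []"
    if "set ps \<subseteq> {xs. xs \<noteq> []} \<times> UNIV" "ps \<noteq> []" for ps :: "(two list \<times> two) list"
    using that by (cases ps) auto
  have cmp: "concat (map (fst \<circ> (\<lambda>((g, g'), f, y). (map2 (\<lambda>x y. y) g f, y))) (zip ps rs)) =
      map2 (\<lambda>x y. y) (concat (map fst ps)) (concat (map fst rs))"
    if "map (map_prod id id) rs = map (map_prod id id) ps" for ps rs :: "(two list \<times> two) list"
  proof -
    have "rs = ps"
      using that by (simp add: prod.map_id0)
    moreover have "concat (map (fst \<circ> (\<lambda>((g, g'), f, y). (map2 (\<lambda>x y. y) g f, y))) (zip ps ps)) =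
        concat (map fst ps)"
      by (induction ps) (auto simp: M)
    ultimately show ?thesis
      by (simp add: M)
  qed
  show ?thesis
    using K Q laws
    by (simp add: is_operad_def Ass2_def Let_def)
      (auto simp: is_functor_def pullback_def gprod_def Mr_def Mr_map_def discrete_def M ne cmp)
qed


section \<open>The bar construction\<close>

text \<open>One type containing the objects (likewise the arrows) of all \<open>Q\<^sub>n\<close>: elements of \<open>Q\<^sub>0\<close> are \<open>Col c\<close>,
  elements of \<open>Q\<^sub>1\<close> are \<open>Op q\<close>, and \<open>Tree ts q\<close> is a pair in \<open>Mr Q\<^sub>n\<^sub>-\<^sub>1 \<times> Q\<^sub>1\<close>, with root operation \<open>q\<close>.\<close>

datatype ('c, 'q) level = Col 'c | Op 'q | Tree "('c, 'q) level list" 'q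

fun out_col :: "('q \<Rightarrow> 'c) \<Rightarrow> ('c, 'q) level \<Rightarrow> 'c" where
  "out_col t (Col c) = c"
| "out_col t (Op q) = t q"
| "out_col t (Tree ts q) = t q"

fun root_op :: "('c, 'q) level \<Rightarrow> 'q" where
  "root_op (Op q) = q"
| "root_op (Tree ts q) = q"

text \<open>The forest above the root operation.\<close>

fun above :: "('q \<Rightarrow> 'c list) \<Rightarrow> ('c, 'q) level \<Rightarrow> ('c, 'q) level list" where
  "above s (Op q) = map Col (s q)"
| "above s (Tree ts q) = ts"

definition output_level :: "('c, 'd, 'q, 'r) operad \<Rightarrow>
    (('c, 'q) level, ('d, 'r) level, 'c, 'd) ftor" where
  "output_level P = \<lparr>onO = out_col (onO (root_colour P)), onA = out_col (onA (root_colour P))\<rparr>"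

fun Qn :: "('c, 'd, 'q, 'r) operad \<Rightarrow> nat \<Rightarrow> (('c, 'q) level, ('d, 'r) level) gpd" where
  "Qn P 0 = relabel Col Col (colours P)"
| "Qn P (Suc 0) = relabel Op Op (operations P)"
| "Qn P (Suc (Suc n)) = relabel (\<lambda>(ts, q). Tree ts q) (\<lambda>(ts, q). Tree ts q)
     (pullback (Mr (Qn P (Suc n))) (operations P) (Mr_map (output_level P)) (inputs P))"

text \<open>The maps \<open>d\<^sub>i\<close> from \<open>Q\<^sub>n\<close> to \<open>Q\<^sub>n\<^sub>-\<^sub>1\<close> for \<open>i < n\<close>.  Levels are counted from the leaves, so \<open>d\<^sub>0\<close> drops the
  level at the leaves and \<open>d\<^sub>n\<^sub>-\<^sub>1\<close> (for \<open>n \<ge> 2\<close>) composes the root with the level above it.\<close>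

fun level_face :: "('q \<Rightarrow> 'c list) \<Rightarrow> ('q \<Rightarrow> 'c) \<Rightarrow> ('q list \<times> 'q \<Rightarrow> 'q) \<Rightarrow> nat \<Rightarrow> nat \<Rightarrow> ('c, 'q) level \<Rightarrow> ('c, 'q) level" where
  "level_face s t m (Suc 0) i (Op q) = Col (t q)"
| "level_face s t m (Suc (Suc 0)) i (Tree ts q) =
     (if i = 0 then Op q else Op (m (map root_op ts, q)))"
| "level_face s t m (Suc (Suc (Suc n))) i (Tree ts q) =
     (if i \<le> Suc n then Tree (map (level_face s t m (Suc (Suc n)) i) ts) q
      else Tree (concat (map (above s) ts)) (m (map root_op ts, q)))"

text \<open>The maps \<open>s\<^sub>i\<close> from \<open>Q\<^sub>n\<close> to \<open>Q\<^sub>n\<^sub>+\<^sub>1\<close> for \<open>i \<le> n\<close>; the units for \<open>i = 0\<close> are placed above the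
  leaves, those for \<open>i = n\<close> below the root.\<close>

fun level_degen :: "('q \<Rightarrow> 'c list) \<Rightarrow> ('q \<Rightarrow> 'c) \<Rightarrow> ('c \<Rightarrow> 'q) \<Rightarrow> nat \<Rightarrow> nat \<Rightarrow>
    ('c, 'q) level \<Rightarrow> ('c, 'q) level" where
  "level_degen s t u 0 i (Col c) = Op (u c)"
| "level_degen s t u (Suc 0) i (Op q) =
     (if i = 0 then Tree (map (\<lambda>c. Op (u c)) (s q)) q else Tree [Op q] (u (t q)))"
| "level_degen s t u (Suc (Suc n)) i (Tree ts q) =
     (if i \<le> Suc n then Tree (map (level_degen s t u (Suc n) i) ts) q
      else Tree [Tree ts q] (u (t q)))"

record ('o, 'm) simplicial_gpd =
  simplices :: "nat \<Rightarrow> ('o, 'm) gpd"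
  face :: "nat \<Rightarrow> nat \<Rightarrow> ('o, 'm, 'o, 'm) ftor"  \<comment> \<open>\<open>face X n i\<close> goes from dimension \<open>n \<ge> 1\<close> to \<open>n - 1\<close>, for \<open>i \<le> n\<close>\<close>
  degen :: "nat \<Rightarrow> nat \<Rightarrow> ('o, 'm, 'o, 'm) ftor"  \<comment> \<open>\<open>degen X n i\<close> goes from dimension \<open>n\<close> to \<open>n + 1\<close>, for \<open>i \<le> n\<close>\<close>

definition bar_Sr :: "('c, 'd, 'q, 'r) operad \<Rightarrow>
    (('c, 'q) level list, ('d, 'r) level sarr) simplicial_gpd" where
  "bar_Sr P =
    \<lparr>simplices = (\<lambda>n. Sr (Qn P n)),
     face = (\<lambda>n i.
       if i = n then
         ftor_comp Sr_mult (ftor_comp (Sr_map Mr_Sr)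
           (Sr_map \<lparr>onO = above (onO (inputs P)), onA = above (onA (inputs P))\<rparr>))
       else
         Sr_map \<lparr>onO = level_face (onO (inputs P)) (onO (root_colour P)) (onO (compose P)) n i,
                 onA = level_face (onA (inputs P)) (onA (root_colour P)) (onA (compose P)) n i\<rparr>),
     degen = (\<lambda>n i.
       Sr_map \<lparr>onO = level_degen (onO (inputs P)) (onO (root_colour P)) (onO (unit_op P)) n i,
               onA = level_degen (onA (inputs P)) (onA (root_colour P)) (onA (unit_op P)) n i\<rparr>)\<rparr>"


section \<open>Bialgebras over the rationals\<close>

text \<open>The vector space with basis \<open>B\<close> is the set of \<open>p :: 'b \<Rightarrow>\<^sub>0 rat\<close> supported in \<open>B\<close>.  The tensor product of
  the spaces with bases \<open>B\<close> and \<open>C\<close> is the space with basis \<open>B \<times> C\<close>.\<close>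

definition vspace :: "'b set \<Rightarrow> ('b \<Rightarrow>\<^sub>0 rat) set" where
  "vspace B = {p. Poly_Mapping.keys p \<subseteq> B}"

definition delta :: "'b \<Rightarrow> ('b \<Rightarrow>\<^sub>0 rat)" where
  "delta b = Poly_Mapping.single b 1"

definition scale :: "rat \<Rightarrow> ('b \<Rightarrow>\<^sub>0 rat) \<Rightarrow> ('b \<Rightarrow>\<^sub>0 rat)" where
  "scale c p = Poly_Mapping.map ((*) c) p"

definition lin_ext :: "('b \<Rightarrow> ('c \<Rightarrow>\<^sub>0 rat)) \<Rightarrow> ('b \<Rightarrow>\<^sub>0 rat) \<Rightarrow> ('c \<Rightarrow>\<^sub>0 rat)" where
  "lin_ext f p = (\<Sum>b \<in> Poly_Mapping.keys p. scale (Poly_Mapping.lookup p b) (f b))"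

definition is_linear :: "'b set \<Rightarrow> 'c set \<Rightarrow> (('b \<Rightarrow>\<^sub>0 rat) \<Rightarrow> ('c \<Rightarrow>\<^sub>0 rat)) \<Rightarrow> bool" where
  "is_linear B C f \<longleftrightarrow>
     (\<forall>p \<in> vspace B. f p \<in> vspace C) \<and>
     (\<forall>p \<in> vspace B. \<forall>q \<in> vspace B. f (p + q) = f p + f q) \<and>
     (\<forall>c. \<forall>p \<in> vspace B. f (scale c p) = scale c (f p))"

definition is_functional :: "'b set \<Rightarrow> (('b \<Rightarrow>\<^sub>0 rat) \<Rightarrow> rat) \<Rightarrow> bool" where
  "is_functional B f \<longleftrightarrow>
     (\<forall>p \<in> vspace B. \<forall>q \<in> vspace B. f (p + q) = f p + f q) \<and>
     (\<forall>c. \<forall>p \<in> vspace B. f (scale c p) = c * f p)"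

definition tensor :: "('b \<Rightarrow>\<^sub>0 rat) \<Rightarrow> ('c \<Rightarrow>\<^sub>0 rat) \<Rightarrow> ('b \<times> 'c \<Rightarrow>\<^sub>0 rat)" where
  "tensor p q = lin_ext (\<lambda>b. lin_ext (\<lambda>c. delta (b, c)) q) p"

definition tensor_map :: "(('b \<Rightarrow>\<^sub>0 rat) \<Rightarrow> ('b' \<Rightarrow>\<^sub>0 rat)) \<Rightarrow> (('c \<Rightarrow>\<^sub>0 rat) \<Rightarrow> ('c' \<Rightarrow>\<^sub>0 rat)) \<Rightarrow>
    ('b \<times> 'c \<Rightarrow>\<^sub>0 rat) \<Rightarrow> ('b' \<times> 'c' \<Rightarrow>\<^sub>0 rat)" where
  "tensor_map f g = lin_ext (\<lambda>(b, c). tensor (f (delta b)) (g (delta c)))"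

definition reassoc :: "(('b \<times> 'c) \<times> 'd \<Rightarrow>\<^sub>0 rat) \<Rightarrow> ('b \<times> 'c \<times> 'd \<Rightarrow>\<^sub>0 rat)" where
  "reassoc = lin_ext (\<lambda>((b, c), d). delta (b, c, d))"

record 'b bialg =
  basis :: "'b set"
  mul :: "('b \<Rightarrow>\<^sub>0 rat) \<Rightarrow> ('b \<Rightarrow>\<^sub>0 rat) \<Rightarrow> ('b \<Rightarrow>\<^sub>0 rat)"
  unity :: "'b \<Rightarrow>\<^sub>0 rat"
  comult :: "('b \<Rightarrow>\<^sub>0 rat) \<Rightarrow> ('b \<times> 'b \<Rightarrow>\<^sub>0 rat)"
  counit :: "('b \<Rightarrow>\<^sub>0 rat) \<Rightarrow> rat"

text \<open>The product of the tensor square, \<open>(a \<otimes> b) (c \<otimes> d) = a c \<otimes> b d\<close>.\<close>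

definition tensor_times :: "('b, 'z) bialg_scheme \<Rightarrow> ('b \<times> 'b \<Rightarrow>\<^sub>0 rat) \<Rightarrow> ('b \<times> 'b \<Rightarrow>\<^sub>0 rat) \<Rightarrow> ('b \<times> 'b \<Rightarrow>\<^sub>0 rat)" where
  "tensor_times A p q = lin_ext (\<lambda>(a, b). lin_ext (\<lambda>(c, d).
     tensor (mul A (delta a) (delta c)) (mul A (delta b) (delta d))) q) p"

definition is_bialgebra :: "'b bialg \<Rightarrow> bool" where
  "is_bialgebra A \<longleftrightarrow>
    (let B = basis A; V = vspace B in
     (\<forall>p \<in> V. is_linear B B (mul A p) \<and> is_linear B B (\<lambda>q. mul A q p)) \<and>
     unity A \<in> V \<and>
     is_linear B (B \<times> B) (comult A) \<and>
     is_functional B (counit A) \<and>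
     (\<forall>p \<in> V. \<forall>q \<in> V. \<forall>r \<in> V. mul A (mul A p q) r = mul A p (mul A q r)) \<and>
     (\<forall>p \<in> V. mul A (unity A) p = p \<and> mul A p (unity A) = p) \<and>
     (\<forall>p \<in> V. reassoc (tensor_map (comult A) id (comult A p)) = tensor_map id (comult A) (comult A p)) \<and>
     (\<forall>p \<in> V. lin_ext (\<lambda>(a, b). scale (counit A (delta a)) (delta b)) (comult A p) = p \<and>
               lin_ext (\<lambda>(a, b). scale (counit A (delta b)) (delta a)) (comult A p) = p) \<and>
     (\<forall>p \<in> V. \<forall>q \<in> V. comult A (mul A p q) = tensor_times A (comult A p) (comult A q)) \<and>
     comult A (unity A) = tensor (unity A) (unity A) \<and>
     (\<forall>p \<in> V. \<forall>q \<in> V. counit A (mul A p q) = counit A p * counit A q) \<and>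
     counit A (unity A) = 1)"

definition is_bialgebra_iso :: "'b bialg \<Rightarrow> 'c bialg \<Rightarrow> (('b \<Rightarrow>\<^sub>0 rat) \<Rightarrow> ('c \<Rightarrow>\<^sub>0 rat)) \<Rightarrow> bool" where
  "is_bialgebra_iso A A' \<phi> \<longleftrightarrow>
     is_linear (basis A) (basis A') \<phi> \<and>
     bij_betw \<phi> (vspace (basis A)) (vspace (basis A')) \<and>
     (\<forall>p \<in> vspace (basis A). \<forall>q \<in> vspace (basis A). \<phi> (mul A p q) = mul A' (\<phi> p) (\<phi> q)) \<and>
     \<phi> (unity A) = unity A' \<and>
     (\<forall>p \<in> vspace (basis A). comult A' (\<phi> p) = tensor_map \<phi> \<phi> (comult A p)) \<and>
     (\<forall>p \<in> vspace (basis A). counit A' (\<phi> p) = counit A p)"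

definition isomorphic_bialgebras :: "'b bialg \<Rightarrow> 'c bialg \<Rightarrow> bool" where
  "isomorphic_bialgebras A A' \<longleftrightarrow> is_bialgebra A \<and> is_bialgebra A' \<and> (\<exists>\<phi>. is_bialgebra_iso A A' \<phi>)"


section \<open>The homotopy cardinality of the incidence bialgebra\<close>

definition Phi :: "('o, 'm) simplicial_gpd \<Rightarrow> 'o \<Rightarrow> 'o \<Rightarrow> 'o \<Rightarrow> _" where
  "Phi X f a b =
     hfib (hfib (simplices X 2) (simplices X 1) (face X 2 1) f)
       (gprod (simplices X 1) (simplices X 1))
       (ftor_comp (ftor_pair (face X 2 2) (face X 2 0)) hfib_proj) (a, b)"

definition comult_coeff :: "('o, 'm) simplicial_gpd \<Rightarrow> 'o \<Rightarrow> 'o \<Rightarrow> 'o \<Rightarrow> rat" where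
  "comult_coeff X f a b = hcard (Phi X f a b) /
     (of_nat (card (Aut (simplices X 1) a)) * of_nat (card (Aut (simplices X 1) b)))"

definition counit_fibre :: "('o, 'm) simplicial_gpd \<Rightarrow> 'o \<Rightarrow> _" where
  "counit_fibre X f = hfib (simplices X 0) (simplices X 1) (degen X 0 0) f"

text \<open>The finiteness conditions under which all cardinalities and sums below make sense.\<close>

definition has_incidence_cardinality :: "('o, 'm) simplicial_gpd \<Rightarrow> bool" where
  "has_incidence_cardinality X \<longleftrightarrow>
     (\<forall>f \<in> Obj (simplices X 1).
        finite (Aut (simplices X 1) f) \<and>
        finite_gpd (counit_fibre X f) \<and>
        (\<forall>a \<in> Obj (simplices X 1). \<forall>b \<in> Obj (simplices X 1). finite_gpd (Phi X f a b)) \<and>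
        finite {(a, b) \<in> pi0 (simplices X 1) \<times> pi0 (simplices X 1). Obj (Phi X f (rep a) (rep b)) \<noteq> {}})"

text \<open>The basis consists of \<open>Some c\<close> for \<open>c\<close> an isomorphism class of \<open>X\<^sub>1\<close>, and of the adjoined unit \<open>None\<close>,
  which is grouplike.  The product is induced by an operation \<open>j\<close> on the objects of \<open>X\<^sub>1\<close>.\<close>

fun incidence_comult :: "('o, 'm) simplicial_gpd \<Rightarrow> 'o set option \<Rightarrow> ('o set option \<times> 'o set option \<Rightarrow>\<^sub>0 rat)" where
  "incidence_comult X None = delta (None, None)"
| "incidence_comult X (Some f) = Abs_poly_mapping (\<lambda>(a, b).
     case (a, b) of
       (Some a', Some b') \<Rightarrow>
         if a' \<in> pi0 (simplices X 1) \<and> b' \<in> pi0 (simplices X 1)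
         then comult_coeff X (rep f) (rep a') (rep b') else 0
     | _ \<Rightarrow> 0)"

fun incidence_counit :: "('o, 'm) simplicial_gpd \<Rightarrow> 'o set option \<Rightarrow> rat" where
  "incidence_counit X None = 1"
| "incidence_counit X (Some f) = hcard (counit_fibre X (rep f))"

fun incidence_times :: "('o, 'm) simplicial_gpd \<Rightarrow> ('o \<Rightarrow> 'o \<Rightarrow> 'o) \<Rightarrow>
    'o set option \<Rightarrow> 'o set option \<Rightarrow> 'o set option" where
  "incidence_times X j None b = b"
| "incidence_times X j a None = a"
| "incidence_times X j (Some a) (Some b) = Some (cls (simplices X 1) (j (rep a) (rep b)))"

definition incidence_bialgebra :: "('o, 'm) simplicial_gpd \<Rightarrow> ('o \<Rightarrow> 'o \<Rightarrow> 'o) \<Rightarrow> 'o set option bialg" where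
  "incidence_bialgebra X j =
    \<lparr>basis = insert None (Some ` pi0 (simplices X 1)),
     mul = (\<lambda>p q. lin_ext (\<lambda>a. lin_ext (\<lambda>b. delta (incidence_times X j a b)) q) p),
     unity = delta None,
     comult = lin_ext (incidence_comult X),
     counit = (\<lambda>p. \<Sum>a \<in> Poly_Mapping.keys p. Poly_Mapping.lookup p a * incidence_counit X a)\<rparr>"


section \<open>The Faa di Bruno bialgebra in two noncommuting variables\<close>

datatype var = VX | VY

type_synonym series = "var list \<Rightarrow> rat"

definition series_pairs :: "(series \<times> series) set" where
  "series_pairs = {(F1, F2). F1 [] = 0 \<and> F2 [] = 0}"

definition var_series :: "var \<Rightarrow> series" where
  "var_series v = (\<lambda>w. if w = [v] then 1 else 0)"

definition series_one :: series where
  "series_one = (\<lambda>w. if w = [] then 1 else 0)"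

definition series_times :: "series \<Rightarrow> series \<Rightarrow> series" where
  "series_times F G = (\<lambda>w. \<Sum>(u, v) \<in> {(u, v). u @ v = w}. F u * G v)"

text \<open>The value of the word \<open>u\<close> at \<open>x = F1\<close>, \<open>y = F2\<close>.\<close>

definition word_subst :: "series \<times> series \<Rightarrow> var list \<Rightarrow> series" where
  "word_subst F u = foldr series_times (map (\<lambda>v. case v of VX \<Rightarrow> fst F | VY \<Rightarrow> snd F) u) series_one"

text \<open>\<open>G(F1, F2)\<close>: for \<open>F\<close> without constant term only words \<open>u\<close> with \<open>length u \<le> length w\<close> contribute to the
  coefficient of \<open>w\<close>, so that this sum has finite support.\<close>

definition series_subst :: "series \<Rightarrow> series \<times> series \<Rightarrow> series" where
  "series_subst G F = (\<lambda>w. Sum_any (\<lambda>u. G u * word_subst F u w))"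

definition pair_comp :: "series \<times> series \<Rightarrow> series \<times> series \<Rightarrow> series \<times> series" where
  "pair_comp G F = (series_subst (fst G) F, series_subst (snd G) F)"

fun coord :: "two \<times> var list \<Rightarrow> series \<times> series \<Rightarrow> rat" where
  "coord (One, w) (F1, F2) = F1 w"
| "coord (Two, w) (F1, F2) = F2 w"

text \<open>Polynomials in the \<open>a\<^sup>i\<^sub>w\<close>: a monomial is the finitely supported map of its exponents.\<close>

type_synonym monomial = "(two \<times> var list) \<Rightarrow>\<^sub>0 nat"

definition monomials :: "monomial set" where
  "monomials = {m. Poly_Mapping.keys m \<subseteq> {(i, w). w \<noteq> []}}"

definition mono_eval :: "monomial \<Rightarrow> series \<times> series \<Rightarrow> rat" where
  "mono_eval m F = (\<Prod>v \<in> Poly_Mapping.keys m. coord v F ^ Poly_Mapping.lookup m v)"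

definition tensor_eval :: "(monomial \<times> monomial \<Rightarrow>\<^sub>0 rat) \<Rightarrow> series \<times> series \<Rightarrow> series \<times> series \<Rightarrow> rat" where
  "tensor_eval q F G = (\<Sum>(m, n) \<in> Poly_Mapping.keys q. Poly_Mapping.lookup q (m, n) * mono_eval m F * mono_eval n G)"

text \<open>The first tensor factor is evaluated at \<open>F\<close>, the second one at \<open>G\<close>.\<close>

definition FdB_comult_gen :: "two \<times> var list \<Rightarrow> (monomial \<times> monomial \<Rightarrow>\<^sub>0 rat)" where
  "FdB_comult_gen v = (THE q. q \<in> vspace (monomials \<times> monomials) \<and>
     (\<forall>F \<in> series_pairs. \<forall>G \<in> series_pairs. tensor_eval q F G = coord v (pair_comp G F)))"

text \<open>Comultiplication and counit are extended from generators as algebra homomorphisms.  The product on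
  \<open>monomial \<times> monomial \<Rightarrow>\<^sub>0 rat\<close> is the one of the tensor square, as the monoid \<open>monomial \<times> monomial\<close>
  carries componentwise addition.\<close>

definition FdB2 :: "monomial bialg" where
  "FdB2 =
    \<lparr>basis = monomials,
     mul = (*),
     unity = 1,
     comult = lin_ext (\<lambda>m. \<Prod>v \<in> Poly_Mapping.keys m. FdB_comult_gen v ^ Poly_Mapping.lookup m v),
     counit = (\<lambda>p. \<Sum>m \<in> Poly_Mapping.keys p. Poly_Mapping.lookup p m * mono_eval m (var_series VX, var_series VY))\<rparr>"

end

(*
  A list of operations of Ass2 is an arrow of the strict monoidal category freely generated by these
  operations, from the concatenation of its input words to the word of its output colours.  Both
  bialgebras have the lists of operations up to reordering as a basis, and in both of them the
  comultiplication of f is the sum of h (x) g over all factorisations f = g h in this category, so they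
  agree; associativity and unitality of the composition give the bialgebra axioms.

  For Faa di Bruno this is the expansion of G(F1, F2), where a polynomial in the coordinates is
  determined by its values because the monomials are pairwise distinct characters, hence linearly
  independent.  For the bar construction, the groupoid of which the cardinality is taken has no
  non-trivial automorphisms, and an object can be moved in a unique way to one in which the
  isomorphism to f is the identity.  So its cardinality is the number of pairs (h, g) with classes
  a and b, times the number of automorphisms of a and of b.
*)
theory Submission
  imports Defs
begin

text \<open>The comparison avoids normal forms for unordered lists. The locale
  \<open>factorisation_bialgebra\<close> presents a bialgebra by a map from lists of operations onto
  its basis, and two instances are isomorphic as soon as their maps identify the same lists. The
  price is that the sum over factorisations must not change when \<open>f\<close> is reordered. A
  permutation of \<open>f\<close> permutes the leafward factor only in blocks, so this is awkward to
  show directly. Instead the invariance is read off from the polynomial side, where the sum for a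
  juxtaposition is a product in a commutative ring.

  On the groupoid side the obstacle is the last face, which flattens tuples of tuples: a permutation
  of trees acts on their top levels through a permutation of blocks. Isomorphism classes in the
  double homotopy fibre can be counted once these block permutations are known to compose
  functorially.

  Finiteness of all sums comes from the exclusion of operations without inputs: a forest with a
  given word of leaves then has bounded size.\<close>

section \<open>Linear maps between free vector spaces\<close>

lemma lookup_scale [simp]: "Poly_Mapping.lookup (scale c p) x = c * Poly_Mapping.lookup p x"
  by (simp add: scale_def Poly_Mapping.map.rep_eq when_def)

lemma scale_add_right: "scale c (p + q) = scale c p + scale c q"
  by (rule poly_mapping_eqI) (simp add: lookup_add algebra_simps)

lemma scale_add_left: "scale (c + d) p = scale c p + scale d p"
  by (rule poly_mapping_eqI) (simp add: lookup_add algebra_simps)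

lemma scale_scale [simp]: "scale c (scale d p) = scale (c * d) p"
  by (rule poly_mapping_eqI) simp

lemma scale_0_left [simp]: "scale 0 p = 0"
  by (rule poly_mapping_eqI) simp

lemma scale_0_right [simp]: "scale c 0 = 0"
  by (rule poly_mapping_eqI) simp

lemma scale_1 [simp]: "scale 1 p = p"
  by (rule poly_mapping_eqI) simp

lemma lookup_delta: "Poly_Mapping.lookup (delta a) b = (if a = b then 1 else 0)"
  by (simp add: delta_def lookup_single when_def)

lemma keys_delta [simp]: "Poly_Mapping.keys (delta a) = {a}"
  by (simp add: delta_def)

text \<open>Linearity on the whole type, not relative to a basis as in \<open>is_linear\<close>. The
  structure maps are extensions of the form \<open>lin_ext\<close>, so no support conditions have to
  be carried through compositions; only identities between maps are restricted to
  \<open>vspace B\<close>.\<close>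

definition lin :: "(('b \<Rightarrow>\<^sub>0 rat) \<Rightarrow> ('c \<Rightarrow>\<^sub>0 rat)) \<Rightarrow> bool" where
  "lin f \<longleftrightarrow> (\<forall>p q. f (p + q) = f p + f q) \<and> (\<forall>c p. f (scale c p) = scale c (f p))"

lemma linI:
  assumes "\<And>p q. f (p + q) = f p + f q" "\<And>c p. f (scale c p) = scale c (f p)"
  shows "lin f"
  using assms by (auto simp: lin_def)

lemma lin_add: "lin f \<Longrightarrow> f (p + q) = f p + f q"
  and lin_scale: "lin f \<Longrightarrow> f (scale c p) = scale c (f p)"
  by (auto simp: lin_def)

lemma lin_zero: "lin f \<Longrightarrow> f 0 = 0"
  using lin_scale[of f 0 0] by simp

lemma lin_sum: "lin f \<Longrightarrow> f (\<Sum>i\<in>I. p i) = (\<Sum>i\<in>I. f (p i))"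
  by (induction I rule: infinite_finite_induct) (auto simp: lin_zero lin_add)

lemma lin_id: "lin (\<lambda>p. p)"
  by (auto simp: lin_def)

lemma lin_comp: "lin f \<Longrightarrow> lin g \<Longrightarrow> lin (\<lambda>p. f (g p))"
  by (auto simp: lin_def)

lemma lin_scale_right: "lin (scale c)"
  by (auto intro!: linI simp: scale_add_right mult.commute)

lemma lin_ext_superset:
  assumes "finite B" "Poly_Mapping.keys p \<subseteq> B"
  shows "lin_ext f p = (\<Sum>b\<in>B. scale (Poly_Mapping.lookup p b) (f b))"
  unfolding lin_ext_def using assms
  by (intro sum.mono_neutral_left) (auto simp: in_keys_iff)

lemma lin_lin_ext: "lin (lin_ext f)"
proof (rule linI)
  fix p q :: "'a \<Rightarrow>\<^sub>0 rat"
  let ?B = "Poly_Mapping.keys p \<union> Poly_Mapping.keys q"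
  show "lin_ext f (p + q) = lin_ext f p + lin_ext f q"
    using Poly_Mapping.keys_add[of p q]
    by (subst (1 2 3) lin_ext_superset[of ?B])
      (auto simp: lookup_add scale_add_left sum.distrib)
next
  fix c and p :: "'a \<Rightarrow>\<^sub>0 rat"
  have "Poly_Mapping.keys (scale c p) \<subseteq> Poly_Mapping.keys p"
    by (auto simp: in_keys_iff)
  then show "lin_ext f (scale c p) = scale c (lin_ext f p)"
    by (subst lin_ext_superset[of "Poly_Mapping.keys p"])
      (auto simp: lin_ext_def lin_sum[OF lin_scale_right])
qed

lemma lin_ext_delta [simp]: "lin_ext f (delta b) = f b"
  by (simp add: lin_ext_def lookup_delta)

lemma poly_mapping_eq_sum_delta:
  "p = (\<Sum>b\<in>Poly_Mapping.keys p. scale (Poly_Mapping.lookup p b) (delta b))"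
  by (rule poly_mapping_eqI)
    (simp add: lookup_sum lookup_delta in_keys_iff if_distrib cong: if_cong)

text \<open>Reduces each bialgebra axiom that equates two linear maps to its instance at basis
  vectors.\<close>

lemma lin_eq_on_vspace:
  assumes "lin f" "lin g" "\<And>b. b \<in> B \<Longrightarrow> f (delta b) = g (delta b)" "p \<in> vspace B"
  shows "f p = g p"
proof -
  have "h p = (\<Sum>b\<in>Poly_Mapping.keys p. scale (Poly_Mapping.lookup p b) (h (delta b)))"
    if "lin h" for h :: "('a \<Rightarrow>\<^sub>0 rat) \<Rightarrow> ('b \<Rightarrow>\<^sub>0 rat)"
    by (subst poly_mapping_eq_sum_delta[of p]) (simp add: lin_sum[OF that] lin_scale[OF that])
  from this[OF assms(1)] this[OF assms(2)] show ?thesis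
    using assms(3,4) by (auto simp: vspace_def intro!: sum.cong)
qed

lemma lin_eq_lin_ext: "lin f \<Longrightarrow> f = lin_ext (\<lambda>b. f (delta b))"
  by (rule ext, rule lin_eq_on_vspace[of _ _ UNIV]) (auto simp: lin_lin_ext vspace_def)

text \<open>Gives linearity in the second argument of bilinear maps such as \<open>tensor\<close>
  and \<open>mul\<close>, whose definition extends over the first argument on the outside.\<close>

lemma lin_pointwise: "lin (\<lambda>q. lin_ext (\<lambda>a. F a q) p)" if "\<And>a. lin (F a)"
proof (rule linI)
  show "lin_ext (\<lambda>a. F a (q + r)) p = lin_ext (\<lambda>a. F a q) p + lin_ext (\<lambda>a. F a r) p" for q r
    by (simp add: lin_ext_def lin_add[OF that] scale_add_right sum.distrib)
  show "lin_ext (\<lambda>a. F a (scale c q)) p = scale c (lin_ext (\<lambda>a. F a q) p)" for c q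
    by (simp add: lin_ext_def lin_scale[OF that] lin_sum[OF lin_scale_right] mult.commute)
qed

lemma vspace_0: "0 \<in> vspace B"
  by (simp add: vspace_def)

lemma vspace_add: "p \<in> vspace B \<Longrightarrow> q \<in> vspace B \<Longrightarrow> p + q \<in> vspace B"
  using Poly_Mapping.keys_add[of p q] by (auto simp: vspace_def)

lemma vspace_scale: "p \<in> vspace B \<Longrightarrow> scale c p \<in> vspace B"
  by (auto simp: vspace_def in_keys_iff)

lemma vspace_sum: "(\<And>i. i \<in> I \<Longrightarrow> p i \<in> vspace B) \<Longrightarrow> (\<Sum>i\<in>I. p i) \<in> vspace B"
  by (induction I rule: infinite_finite_induct) (auto simp: vspace_0 vspace_add)

lemma vspace_delta [simp]: "delta b \<in> vspace B \<longleftrightarrow> b \<in> B"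
  by (simp add: vspace_def)

lemma lin_vspace:
  assumes "lin f" "\<And>b. b \<in> B \<Longrightarrow> f (delta b) \<in> vspace C" "p \<in> vspace B"
  shows "f p \<in> vspace C"
  using assms(2,3)
  by (subst lin_eq_lin_ext[OF assms(1)]) (auto simp: lin_ext_def vspace_def[of B] intro!: vspace_sum vspace_scale)

lemma is_linearI:
  assumes "lin f" "\<And>b. b \<in> B \<Longrightarrow> f (delta b) \<in> vspace C"
  shows "is_linear B C f"
  using assms lin_vspace[OF assms] by (auto simp: is_linear_def lin_add lin_scale)

lemma tensor_delta [simp]: "tensor (delta a) (delta b) = delta (a, b)"
  by (simp add: tensor_def)

lemma lin_tensor_left: "lin (\<lambda>p. tensor p q)"
  by (simp add: tensor_def lin_lin_ext)

lemma lin_tensor_right: "lin (tensor p)"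
  unfolding tensor_def by (rule lin_pointwise) (rule lin_lin_ext)

lemma lin_tensor_map: "lin (tensor_map f g)"
  by (simp add: tensor_map_def lin_lin_ext)

lemma tensor_map_delta [simp]: "tensor_map f g (delta (a, b)) = tensor (f (delta a)) (g (delta b))"
  by (simp add: tensor_map_def)

lemma lin_reassoc: "lin reassoc"
  by (simp add: reassoc_def lin_lin_ext)

lemma reassoc_delta [simp]: "reassoc (delta ((a, b), c)) = delta (a, b, c)"
  by (simp add: reassoc_def)

text \<open>The counterpart of \<open>lin\<close> for counits: their values are plain rationals,
  which are not of the type of a free vector space.\<close>

definition lfun :: "(('b \<Rightarrow>\<^sub>0 rat) \<Rightarrow> rat) \<Rightarrow> bool" where
  "lfun f \<longleftrightarrow> (\<forall>p q. f (p + q) = f p + f q) \<and> (\<forall>c p. f (scale c p) = c * f p)"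

lemma lfun_ext: "lfun (\<lambda>p. \<Sum>a\<in>Poly_Mapping.keys p. Poly_Mapping.lookup p a * e a)"
proof -
  have sup: "(\<Sum>a\<in>Poly_Mapping.keys p. Poly_Mapping.lookup p a * e a) = (\<Sum>a\<in>B. Poly_Mapping.lookup p a * e a)"
    if "finite B" "Poly_Mapping.keys p \<subseteq> B" for p :: "'a \<Rightarrow>\<^sub>0 rat" and B
    using that by (intro sum.mono_neutral_left) (auto simp: in_keys_iff)
  have "(\<Sum>a\<in>Poly_Mapping.keys (p + q). Poly_Mapping.lookup (p + q) a * e a) =
    (\<Sum>a\<in>Poly_Mapping.keys p. Poly_Mapping.lookup p a * e a) +
    (\<Sum>a\<in>Poly_Mapping.keys q. Poly_Mapping.lookup q a * e a)" for p q :: "'a \<Rightarrow>\<^sub>0 rat"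
    using Poly_Mapping.keys_add[of p q]
    by (subst (1 2 3) sup[of "Poly_Mapping.keys p \<union> Poly_Mapping.keys q"])
      (auto simp: lookup_add algebra_simps sum.distrib)
  moreover have "(\<Sum>a\<in>Poly_Mapping.keys (scale c p). Poly_Mapping.lookup (scale c p) a * e a) =
    c * (\<Sum>a\<in>Poly_Mapping.keys p. Poly_Mapping.lookup p a * e a)" for c and p :: "'a \<Rightarrow>\<^sub>0 rat"
  proof -
    have "Poly_Mapping.keys (scale c p) \<subseteq> Poly_Mapping.keys p"
      by (auto simp: in_keys_iff)
    then show ?thesis
      by (subst sup[of "Poly_Mapping.keys p"]) (auto simp: sum_distrib_left mult.assoc)
  qed
  ultimately show ?thesis
    by (simp add: lfun_def)
qed

lemma lfun_add: "lfun f \<Longrightarrow> f (p + q) = f p + f q"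
  and lfun_scale: "lfun f \<Longrightarrow> f (scale c p) = c * f p"
  by (auto simp: lfun_def)

lemma lfun_sum: "lfun f \<Longrightarrow> f (\<Sum>i\<in>I. p i) = (\<Sum>i\<in>I. f (p i))"
  using lfun_scale[of f 0 0]
  by (induction I rule: infinite_finite_induct) (auto simp: lfun_add)

lemma lfun_lin: "lfun f \<Longrightarrow> lin g \<Longrightarrow> lfun (\<lambda>p. f (g p))"
  by (auto simp: lfun_def lin_def)

lemma lfun_cmult: "lfun f \<Longrightarrow> lfun (\<lambda>p. c * f p)"
  by (auto simp: lfun_def algebra_simps)

lemma lfun_eq_on_vspace:
  assumes "lfun f" "lfun g" "\<And>b. b \<in> B \<Longrightarrow> f (delta b) = g (delta b)" "p \<in> vspace B"
  shows "f p = g p"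
proof -
  have "h p = (\<Sum>b\<in>Poly_Mapping.keys p. Poly_Mapping.lookup p b * h (delta b))"
    if "lfun h" for h :: "('a \<Rightarrow>\<^sub>0 rat) \<Rightarrow> rat"
    by (subst poly_mapping_eq_sum_delta[of p]) (simp add: lfun_sum[OF that] lfun_scale[OF that])
  from this[OF assms(1)] this[OF assms(2)] show ?thesis
    using assms(3,4) by (auto simp: vspace_def intro!: sum.cong)
qed

section \<open>Factorisations of forests\<close>

type_synonym opn = "two list \<times> two"

text \<open>A list of operations is viewed as an arrow from \<open>leaves\<close> to \<open>roots\<close>; then \<open>graft g h\<close> is the composite
  \<open>g \<circ> h\<close>, \<open>corollas w\<close> is the identity of \<open>w\<close>, and \<open>factorisations f\<close> lists the leafward factor first.\<close>

definition forests :: "opn list set" where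
  "forests = {fs. \<forall>f\<in>set fs. fst f \<noteq> []}"

definition leaves :: "opn list \<Rightarrow> two list" where
  "leaves fs = concat (map fst fs)"

definition roots :: "opn list \<Rightarrow> two list" where
  "roots fs = map snd fs"

fun graft :: "opn list \<Rightarrow> opn list \<Rightarrow> opn list" where
  "graft [] hs = []"
| "graft (g # gs) hs = (leaves (take (length (fst g)) hs), snd g) # graft gs (drop (length (fst g)) hs)"

definition corollas :: "two list \<Rightarrow> opn list" where
  "corollas = map (\<lambda>c. ([c], c))"

definition factorisations :: "opn list \<Rightarrow> (opn list \<times> opn list) set" where
  "factorisations f = {(h, g). h \<in> forests \<and> g \<in> forests \<and> roots h = leaves g \<and> graft g h = f}"

lemma forests_simps [simp]:
  "[] \<in> forests" "f # fs \<in> forests \<longleftrightarrow> fst f \<noteq> [] \<and> fs \<in> forests"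
  "xs @ ys \<in> forests \<longleftrightarrow> xs \<in> forests \<and> ys \<in> forests"
  by (auto simp: forests_def)

lemma leaves_simps [simp]:
  "leaves [] = []" "leaves (f # fs) = fst f @ leaves fs" "leaves (xs @ ys) = leaves xs @ leaves ys"
  by (auto simp: leaves_def)

lemma roots_simps [simp]:
  "roots [] = []" "roots (f # fs) = snd f # roots fs" "roots (xs @ ys) = roots xs @ roots ys"
  "roots (take n xs) = take n (roots xs)" "roots (drop n xs) = drop n (roots xs)"
  "length (roots xs) = length xs" "roots xs = [] \<longleftrightarrow> xs = []"
  by (auto simp: roots_def take_map drop_map)

lemma length_roots: "roots h = w \<Longrightarrow> length h = length w"
  by auto

lemma roots_graft [simp]: "roots (graft g h) = roots g"
  by (induction g h rule: graft.induct) auto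

lemma length_graft [simp]: "length (graft g h) = length g"
  by (induction g h rule: graft.induct) auto

lemma leaves_graft: "length h = length (leaves g) \<Longrightarrow> leaves (graft g h) = leaves h"
proof (induction g h rule: graft.induct)
  case (2 g gs hs)
  then show ?case
    by (simp flip: leaves_simps(3))
qed auto

lemma leaves_graft_roots: "roots h = leaves g \<Longrightarrow> leaves (graft g h) = leaves h"
  by (rule leaves_graft) (rule length_roots)

text \<open>Interchange law of composition and juxtaposition: by the length condition the cut of the
  leafward list falls between \<open>h1\<close> and \<open>h2\<close>.\<close>

lemma graft_append: "length h1 = length (leaves g1) \<Longrightarrow> graft (g1 @ g2) (h1 @ h2) = graft g1 h1 @ graft g2 h2"
  by (induction g1 arbitrary: h1) auto

text \<open>The first operation of \<open>k\<close> takes the block \<open>g1\<close> of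
  \<open>g\<close>, which in turn takes the block \<open>h1\<close> of \<open>h\<close>. On both
  sides the first composite has the leaves of \<open>h1\<close> as inputs; the interchange law
  leaves the rest to the induction.\<close>

lemma graft_assoc:
  assumes "roots g = leaves k" "roots h = leaves g"
  shows "graft k (graft g h) = graft (graft k g) h"
  using assms
proof (induction k arbitrary: g h)
  case Nil
  then show ?case
    by simp
next
  case (Cons k ks)
  define n where "n = length (fst k)"
  define g1 g2 where "g1 = take n g" and "g2 = drop n g"
  define m where "m = length (leaves g1)"
  define h1 h2 where "h1 = take m h" and "h2 = drop m h"
  have g: "g = g1 @ g2" and h: "h = h1 @ h2"
    by (auto simp: g1_def g2_def h1_def h2_def)
  have rg: "roots g1 = fst k" "roots g2 = leaves ks"
    using Cons.prems(1) by (auto simp: g1_def g2_def n_def)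
  have rh: "roots h1 = leaves g1" "roots h2 = leaves g2"
    using Cons.prems(2) g by (auto simp: h1_def h2_def m_def)
  have lg: "length g1 = n" and lh: "length h1 = length (leaves g1)"
    using rg(1) rh(1) by (metis n_def roots_simps(6))+
  have lgr: "length (graft g1 h1) = n"
    using lg by simp
  have "leaves (graft g1 h1) = leaves h1"
    using lh by (rule leaves_graft)
  then show ?case
    using Cons.IH[OF rg(2) rh(2)] lg lgr lh
    by (simp add: g h graft_append flip: n_def m_def)
qed

text \<open>Each operation of \<open>g\<close> has an input, hence receives at least one operation
  of \<open>h\<close>, and that one has an input as well.\<close>

lemma graft_forests:
  assumes "g \<in> forests" "h \<in> forests" "roots h = leaves g"
  shows "graft g h \<in> forests"
  using assms
proof (induction g h rule: graft.induct)
  case (2 g gs hs)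
  have "leaves (take (length (fst g)) hs) \<noteq> []"
    using 2(3,4) 2(2) by (cases hs; cases "fst g") auto
  moreover have "drop (length (fst g)) hs \<in> forests"
    using 2(3) by (auto simp: forests_def dest: in_set_dropD)
  ultimately show ?case
    using 2 by auto
qed auto

lemma corollas_simps [simp]: "leaves (corollas w) = w" "roots (corollas w) = w" "corollas w \<in> forests"
  "corollas (v @ w) = corollas v @ corollas w" "length (corollas w) = length w"
  by (auto simp: corollas_def leaves_def roots_def forests_def comp_def)

lemma graft_corollas_right [simp]: "graft g (corollas (leaves g)) = g"
  by (induction g) auto

lemma graft_corollas_left [simp]: "graft (corollas (roots h)) h = h"
  by (induction h) (auto simp: corollas_def)

text \<open>As every operation has an input, both the number of operations and the arity of each of
  them are bounded by the length of \<open>w\<close>. With nullary operations this would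
  fail.\<close>

lemma finite_forests: "finite {h \<in> forests. leaves h = w}"
proof (rule finite_subset)
  let ?A = "{v :: two list. set v \<subseteq> {One, Two} \<and> length v \<le> length w} \<times> {One, Two}"
  have two: "x \<in> {One, Two}" for x
    by (cases x) auto
  have "length h \<le> length (leaves h)" if "h \<in> forests" for h
    using that by (induction h) (auto simp: neq_Nil_conv)
  moreover have "length (fst f) \<le> length (leaves h)" if "f \<in> set h" for f h
    using that by (induction h) auto
  ultimately show "{h \<in> forests. leaves h = w} \<subseteq> {h. set h \<subseteq> ?A \<and> length h \<le> length w}"
    using two by fastforce
  show "finite {h. set h \<subseteq> ?A \<and> length h \<le> length w}"
    by (intro finite_lists_length_le finite_cartesian_product) auto
qed

lemma factorisations_leaves_roots:
  assumes "(h, g) \<in> factorisations f"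
  shows "leaves h = leaves f" "roots g = roots f" "f \<in> forests" "h \<in> forests" "g \<in> forests"
  using assms leaves_graft[of h g] graft_forests[of g h] length_roots[of h]
  by (auto simp: factorisations_def)

text \<open>The leafward factor has the leaves of \<open>f\<close>, which leaves finitely many
  \<open>h\<close>; the root factor has leaves \<open>roots h\<close>, which leaves finitely many
  \<open>g\<close> for each of them.\<close>

lemma finite_factorisations: "finite (factorisations f)"
proof -
  let ?H = "{h \<in> forests. leaves h = leaves f}"
  have "factorisations f \<subseteq> (SIGMA h : ?H. {g \<in> forests. leaves g = roots h})"
    by (auto dest: factorisations_leaves_roots) (auto simp: factorisations_def)
  then show ?thesis
    by (rule finite_subset) (intro finite_SigmaI finite_forests)
qed

lemma factorisations_Nil [simp]: "factorisations [] = {([], [])}"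
proof -
  have "(h, g) = ([], [])" if "(h, g) \<in> factorisations []" for h g
    using that factorisations_leaves_roots(2)[OF that] by (auto simp: factorisations_def)
  moreover have "([], []) \<in> factorisations []"
    by (simp add: factorisations_def)
  ultimately show ?thesis
    by fast
qed

text \<open>The combinatorial form of multiplicativity. The root factor has one operation for each
  entry of the list, so it splits at \<open>length xs\<close>, and the leafward factor then splits
  at the number of leaves of the first part.\<close>

lemma bij_betw_factorisations_append:
  "bij_betw (\<lambda>((h, g), (h', g')). (h @ h', g @ g')) (factorisations xs \<times> factorisations ys) (factorisations (xs @ ys))"
proof -
  let ?F = "\<lambda>((h :: opn list, g :: opn list), (h', g')). (h @ h', g @ g')"
  have len: "length g = length f" "length h = length (leaves g)" if "(h, g) \<in> factorisations f" for h g f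
    using that by (auto simp: factorisations_def dest: length_roots)
  have "inj_on ?F (factorisations xs \<times> factorisations ys)"
  proof (rule inj_onI)
    fix p q
    assume pq: "p \<in> factorisations xs \<times> factorisations ys" "q \<in> factorisations xs \<times> factorisations ys" "?F p = ?F q"
    obtain h g h' g' k l k' l' where p: "p = ((h, g), (h', g'))" and q: "q = ((k, l), (k', l'))"
      by (metis surj_pair)
    have eq: "h @ h' = k @ k'" "g @ g' = l @ l'" and F: "(h, g) \<in> factorisations xs" "(k, l) \<in> factorisations xs"
      using pq by (auto simp: p q)
    have "g = l \<and> g' = l'"
      using eq(2) len(1)[OF F(1)] len(1)[OF F(2)] by simp
    moreover from this have "h = k \<and> h' = k'"
      using eq(1) len(2)[OF F(1)] len(2)[OF F(2)] by simp
    ultimately show "p = q"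
      by (simp add: p q)
  qed
  moreover have "?F ` (factorisations xs \<times> factorisations ys) \<subseteq> factorisations (xs @ ys)"
    by (auto simp: factorisations_def graft_append length_roots)
  moreover have "factorisations (xs @ ys) \<subseteq> ?F ` (factorisations xs \<times> factorisations ys)"
  proof (rule subrelI)
    fix h g
    assume hg: "(h, g) \<in> factorisations (xs @ ys)"
    define g1 g2 where "g1 = take (length xs) g" and "g2 = drop (length xs) g"
    define h1 h2 where "h1 = take (length (leaves g1)) h" and "h2 = drop (length (leaves g1)) h"
    have g: "g = g1 @ g2" and h: "h = h1 @ h2"
      by (auto simp: g1_def g2_def h1_def h2_def)
    have rh: "roots h = leaves g" and gr: "graft g h = xs @ ys" and F: "h \<in> forests" "g \<in> forests"
      using hg by (auto simp: factorisations_def)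
    have rh1: "roots h1 = leaves g1" "roots h2 = leaves g2"
      using rh by (auto simp: h1_def h2_def g)
    then have lh1: "length h1 = length (leaves g1)"
      by (rule_tac length_roots)
    have "length g1 = length xs"
      using len(1)[OF hg] by (simp add: g1_def)
    then have "length (graft g1 h1) = length xs"
      by simp
    then have "graft g1 h1 = xs" "graft g2 h2 = ys"
      using gr graft_append[OF lh1, of g2 h2] by (auto simp: g h)
    then have "(h1, g1) \<in> factorisations xs" "(h2, g2) \<in> factorisations ys"
      using F rh1 by (auto simp: factorisations_def g h)
    then show "(h, g) \<in> ?F ` (factorisations xs \<times> factorisations ys)"
      unfolding g h by (intro image_eqI[where x = "((h1, g1), (h2, g2))"]) auto
  qed
  ultimately show ?thesis
    unfolding bij_betw_def by blast
qed

text \<open>Both index sets are the set of all triples \<open>(h1, h2, g)\<close> with \<open>f = g h2 h1\<close>.\<close>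

lemma sum_factorisations_assoc:
  "(\<Sum>(h, g)\<in>factorisations f. \<Sum>(h1, h2)\<in>factorisations h. F h1 h2 g) =
   (\<Sum>(h1, k)\<in>factorisations f. \<Sum>(h2, g)\<in>factorisations k. F h1 h2 g)"
proof -
  let ?A = "SIGMA p : factorisations f. factorisations (fst p)"
  let ?B = "SIGMA p : factorisations f. factorisations (snd p)"
  have "(\<Sum>(h, g)\<in>factorisations f. \<Sum>(h1, h2)\<in>factorisations h. F h1 h2 g) =
      (\<Sum>((h, g), (h1, h2))\<in>?A. F h1 h2 g)"
    by (subst sum.Sigma[symmetric]) (auto simp: finite_factorisations split_def)
  also have "\<dots> = (\<Sum>((h1, k), (h2, g))\<in>?B. F h1 h2 g)"
    by (rule sum.reindex_bij_witness[where
          i = "\<lambda>((h1, k), (h2, g)). ((graft h2 h1, g), (h1, h2))" and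
          j = "\<lambda>((h, g), (h1, h2)). ((h1, graft g h2), (h2, g))"])
      (auto simp: factorisations_def graft_assoc leaves_graft_roots graft_forests)
  also have "\<dots> = (\<Sum>(h1, k)\<in>factorisations f. \<Sum>(h2, g)\<in>factorisations k. F h1 h2 g)"
    by (subst sum.Sigma[symmetric]) (auto simp: finite_factorisations split_def)
  finally show ?thesis .
qed

section \<open>Identities and the counit\<close>

definition identity_forest :: "opn list \<Rightarrow> bool" where
  "identity_forest fs \<longleftrightarrow> (\<forall>f\<in>set fs. fst f = [snd f])"

lemma identity_forest_simps [simp]: "identity_forest []" "identity_forest (corollas w)"
  "identity_forest (xs @ ys) \<longleftrightarrow> identity_forest xs \<and> identity_forest ys"
  by (auto simp: identity_forest_def corollas_def)

lemma identity_forest_roots: "identity_forest h \<Longrightarrow> h = corollas (roots h)"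
  by (induction h) (auto simp: identity_forest_def corollas_def)

lemma identity_forest_leaves: "identity_forest h \<Longrightarrow> h = corollas (leaves h)"
  by (metis corollas_simps(1) identity_forest_roots)

text \<open>Matching colours determine an identity factor from the other factor, which then equals
  \<open>f\<close>. The form \<open>p = ...\<close> fits \<open>sum_if_unique\<close>, by which the
  counit leaves a single summand of the comultiplication.\<close>

lemma factorisations_identity_left:
  assumes "f \<in> forests"
  shows "p \<in> factorisations f \<and> identity_forest (fst p) \<longleftrightarrow> p = (corollas (leaves f), f)"
proof
  obtain h g where p: "p = (h, g)"
    by (cases p)
  assume hg: "p \<in> factorisations f \<and> identity_forest (fst p)"
  then have h: "h = corollas (leaves g)"
    using identity_forest_roots[of h] by (simp add: p factorisations_def)
  then show "p = (corollas (leaves f), f)"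
    using hg p by (auto simp: factorisations_def)
qed (use assms in \<open>auto simp: factorisations_def\<close>)

lemma factorisations_identity_right:
  assumes "f \<in> forests"
  shows "p \<in> factorisations f \<and> identity_forest (snd p) \<longleftrightarrow> p = (f, corollas (roots f))"
proof
  obtain h g where p: "p = (h, g)"
    by (cases p)
  assume hg: "p \<in> factorisations f \<and> identity_forest (snd p)"
  then have g: "g = corollas (roots h)"
    using identity_forest_leaves[of g] by (simp add: p factorisations_def)
  then show "p = (f, corollas (roots f))"
    using hg p by (auto simp: factorisations_def)
qed (use assms in \<open>auto simp: factorisations_def\<close>)

section \<open>Bialgebras of factorisations\<close>

lemma sum_if_unique:
  assumes "finite S" "\<And>x. x \<in> S \<and> P x \<longleftrightarrow> x = a"
  shows "(\<Sum>x\<in>S. if P x then F x else 0) = F a"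
proof -
  have "(\<Sum>x\<in>S. if P x then F x else 0) = sum F {x \<in> S. P x}"
    using assms(1) by (simp add: sum.inter_filter)
  also have "{x \<in> S. P x} = {a}"
    using assms(2) by auto
  finally show ?thesis
    by simp
qed

text \<open>\<open>\<mu>\<close> sends a list of operations to its basis element, and may forget the
  order. As \<open>times\<close>, \<open>cm\<close> and \<open>cu\<close> are described at every
  list, the assumptions include that these descriptions do not depend on the list chosen for a basis
  element.\<close>

locale factorisation_bialgebra =
  fixes A :: "'b bialg" and \<mu> :: "opn list \<Rightarrow> 'b" and times :: "'b \<Rightarrow> 'b \<Rightarrow> 'b"
    and cm :: "'b \<Rightarrow> ('b \<times> 'b \<Rightarrow>\<^sub>0 rat)" and cu :: "'b \<Rightarrow> rat"
  assumes basis: "basis A = \<mu> ` forests"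
    and mul: "mul A = (\<lambda>p q. lin_ext (\<lambda>a. lin_ext (\<lambda>b. delta (times a b)) q) p)"
    and times: "xs \<in> forests \<Longrightarrow> ys \<in> forests \<Longrightarrow> times (\<mu> xs) (\<mu> ys) = \<mu> (xs @ ys)"
    and unity: "unity A = delta (\<mu> [])"
    and comult: "comult A = lin_ext cm"
    and cm: "f \<in> forests \<Longrightarrow> cm (\<mu> f) = (\<Sum>(h, g)\<in>factorisations f. delta (\<mu> h, \<mu> g))"
    and counit: "counit A = (\<lambda>p. \<Sum>a\<in>Poly_Mapping.keys p. Poly_Mapping.lookup p a * cu a)"
    and cu: "f \<in> forests \<Longrightarrow> cu (\<mu> f) = (if identity_forest f then 1 else 0)"
begin

lemma basis_cases:
  assumes "b \<in> basis A" "\<And>f. f \<in> forests \<Longrightarrow> Q (\<mu> f)"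
  shows "Q b"
  using assms by (auto simp: basis)

lemma lin_mul_left: "lin (\<lambda>p. mul A p q)"
  by (simp add: mul lin_lin_ext)

lemma lin_mul_right: "lin (mul A p)"
  unfolding mul by (rule lin_pointwise) (rule lin_lin_ext)

lemma lin_comult: "lin (comult A)"
  by (simp add: comult lin_lin_ext)

lemma lfun_counit: "lfun (counit A)"
  unfolding counit by (rule lfun_ext)

lemma mul_delta: "xs \<in> forests \<Longrightarrow> ys \<in> forests \<Longrightarrow>
    mul A (delta (\<mu> xs)) (delta (\<mu> ys)) = delta (\<mu> (xs @ ys))"
  by (simp add: mul times)

lemma comult_delta: "f \<in> forests \<Longrightarrow>
    comult A (delta (\<mu> f)) = (\<Sum>(h, g)\<in>factorisations f. delta (\<mu> h, \<mu> g))"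
  by (simp add: comult cm)

lemma counit_delta: "f \<in> forests \<Longrightarrow> counit A (delta (\<mu> f)) = (if identity_forest f then 1 else 0)"
  by (simp add: counit cu lookup_delta)

lemma mul_vspace:
  assumes "p \<in> vspace (basis A)" "q \<in> vspace (basis A)"
  shows "mul A p q \<in> vspace (basis A)"
proof -
  have "mul A (delta a) q \<in> vspace (basis A)" if "a \<in> basis A" for a
    by (rule lin_vspace[OF lin_mul_right _ assms(2)]) (use that in \<open>auto simp: basis mul_delta\<close>)
  then show ?thesis
    by (rule lin_vspace[OF lin_mul_left _ assms(1)])
qed

lemma lin_tensor_times_left: "lin (\<lambda>p. tensor_times A p q)"
  by (simp add: tensor_times_def lin_lin_ext)

lemma lin_tensor_times_right: "lin (tensor_times A p)"
  unfolding tensor_times_def split_def by (rule lin_pointwise) (rule lin_lin_ext)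

lemma tensor_times_delta:
  assumes "a \<in> forests" "b \<in> forests" "c \<in> forests" "d \<in> forests"
  shows "tensor_times A (delta (\<mu> a, \<mu> b)) (delta (\<mu> c, \<mu> d)) = delta (\<mu> (a @ c), \<mu> (b @ d))"
  using assms by (simp add: tensor_times_def mul_delta)

text \<open>The product of the tensor square juxtaposes leafward and root factors separately, so
  both sides run over the same factorisations by
  \<open>bij_betw_factorisations_append\<close>.\<close>

lemma comult_mul_delta:
  assumes "xs \<in> forests" "ys \<in> forests"
  shows "comult A (mul A (delta (\<mu> xs)) (delta (\<mu> ys))) =
    tensor_times A (comult A (delta (\<mu> xs))) (comult A (delta (\<mu> ys)))"
proof -
  have "tensor_times A (comult A (delta (\<mu> xs))) (comult A (delta (\<mu> ys))) =
      (\<Sum>(h, g)\<in>factorisations xs. \<Sum>(h', g')\<in>factorisations ys.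
        tensor_times A (delta (\<mu> h, \<mu> g)) (delta (\<mu> h', \<mu> g')))"
    unfolding comult_delta[OF assms(1)] lin_sum[OF lin_tensor_times_left]
    by (rule sum.cong) (auto simp: comult_delta[OF assms(2)] lin_sum[OF lin_tensor_times_right] split_def)
  also have "\<dots> = (\<Sum>(h, g)\<in>factorisations xs. \<Sum>(h', g')\<in>factorisations ys. delta (\<mu> (h @ h'), \<mu> (g @ g')))"
    unfolding split_def by (intro sum.cong refl) (auto simp: tensor_times_delta factorisations_def)
  also have "\<dots> = (\<Sum>((h, g), (h', g'))\<in>factorisations xs \<times> factorisations ys. delta (\<mu> (h @ h'), \<mu> (g @ g')))"
    by (subst sum.cartesian_product[symmetric]) (simp add: split_def)
  also have "\<dots> = (\<Sum>(h, g)\<in>factorisations (xs @ ys). delta (\<mu> h, \<mu> g))"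
    by (subst sum.reindex_bij_betw[OF bij_betw_factorisations_append, symmetric])
      (simp add: split_def)
  finally show ?thesis
    using assms by (simp add: mul_delta comult_delta)
qed

lemma coassoc_delta:
  assumes "f \<in> forests"
  shows "reassoc (tensor_map (comult A) id (comult A (delta (\<mu> f)))) =
    tensor_map id (comult A) (comult A (delta (\<mu> f)))"
proof -
  have "reassoc (tensor_map (comult A) id (comult A (delta (\<mu> f)))) =
     (\<Sum>(h, g)\<in>factorisations f. \<Sum>(h1, h2)\<in>factorisations h. delta (\<mu> h1, \<mu> h2, \<mu> g))"
    using assms factorisations_leaves_roots(4)
    by (auto simp: comult_delta lin_sum[OF lin_tensor_map] lin_sum[OF lin_reassoc]
        lin_sum[OF lin_tensor_left] split_def intro!: sum.cong)
  also have "\<dots> = (\<Sum>(h1, k)\<in>factorisations f. \<Sum>(h2, g)\<in>factorisations k. delta (\<mu> h1, \<mu> h2, \<mu> g))"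
    by (rule sum_factorisations_assoc)
  also have "\<dots> = tensor_map id (comult A) (comult A (delta (\<mu> f)))"
    using assms factorisations_leaves_roots(5)
    by (auto simp: comult_delta lin_sum[OF lin_tensor_map] lin_sum[OF lin_tensor_right]
        split_def intro!: sum.cong)
  finally show ?thesis .
qed

lemma counit_left_delta:
  assumes "f \<in> forests"
  shows "lin_ext (\<lambda>(a, b). scale (counit A (delta a)) (delta b)) (comult A (delta (\<mu> f))) = delta (\<mu> f)"
proof -
  have "lin_ext (\<lambda>(a, b). scale (counit A (delta a)) (delta b)) (comult A (delta (\<mu> f))) =
      (\<Sum>p\<in>factorisations f. if identity_forest (fst p) then delta (\<mu> (snd p)) else 0)"
    unfolding comult_delta[OF assms] lin_sum[OF lin_lin_ext]
    by (rule sum.cong) (auto simp: counit_delta factorisations_def)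
  also have "\<dots> = delta (\<mu> f)"
    by (simp add: sum_if_unique[OF finite_factorisations factorisations_identity_left[OF assms]])
  finally show ?thesis .
qed

lemma counit_right_delta:
  assumes "f \<in> forests"
  shows "lin_ext (\<lambda>(a, b). scale (counit A (delta b)) (delta a)) (comult A (delta (\<mu> f))) = delta (\<mu> f)"
proof -
  have "lin_ext (\<lambda>(a, b). scale (counit A (delta b)) (delta a)) (comult A (delta (\<mu> f))) =
      (\<Sum>p\<in>factorisations f. if identity_forest (snd p) then delta (\<mu> (fst p)) else 0)"
    unfolding comult_delta[OF assms] lin_sum[OF lin_lin_ext]
    by (rule sum.cong) (auto simp: counit_delta factorisations_def)
  also have "\<dots> = delta (\<mu> f)"
    by (simp add: sum_if_unique[OF finite_factorisations factorisations_identity_right[OF assms]])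
  finally show ?thesis .
qed

theorem is_bialgebra: "is_bialgebra A"
proof -
  let ?V = "vspace (basis A)"
  have "is_linear (basis A) (basis A) (mul A p) \<and> is_linear (basis A) (basis A) (\<lambda>q. mul A q p)" if "p \<in> ?V" for p
    using that by (auto intro!: is_linearI lin_mul_left lin_mul_right mul_vspace)
  moreover have "unity A \<in> ?V"
    by (auto simp: unity basis)
  moreover have "is_linear (basis A) (basis A \<times> basis A) (comult A)"
    by (rule is_linearI[OF lin_comult], erule basis_cases)
      (auto simp: comult_delta basis factorisations_def intro!: vspace_sum)
  moreover have "is_functional (basis A) (counit A)"
    using lfun_counit by (auto simp: is_functional_def lfun_def)
  moreover have "mul A (mul A p q) r = mul A p (mul A q r)" if p: "p \<in> ?V" and q: "q \<in> ?V" and r: "r \<in> ?V" for p q r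
  proof -
    \<comment> \<open>The three arguments are reduced to basis vectors one at a time, from the last
      to the first, because \<open>lin_eq_on_vspace\<close> treats one variable only.\<close>
    have 1: "mul A (mul A (delta (\<mu> f)) (delta (\<mu> g))) r = mul A (delta (\<mu> f)) (mul A (delta (\<mu> g)) r)"
      if "f \<in> forests" "g \<in> forests" for f g
      by (rule lin_eq_on_vspace[OF lin_mul_right lin_comp[OF lin_mul_right lin_mul_right] _ r], erule basis_cases)
        (use that in \<open>simp add: mul_delta\<close>)
    have 2: "mul A (mul A (delta (\<mu> f)) q) r = mul A (delta (\<mu> f)) (mul A q r)"
      if "f \<in> forests" for f
      by (rule lin_eq_on_vspace[OF lin_comp[OF lin_mul_left lin_mul_right] lin_comp[OF lin_mul_right lin_mul_left] _ q],
          erule basis_cases) (use that in \<open>simp add: 1\<close>)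
    show ?thesis
      by (rule lin_eq_on_vspace[OF lin_comp[OF lin_mul_left lin_mul_left] lin_mul_left _ p], erule basis_cases) (rule 2)
  qed
  moreover have "mul A (unity A) p = p \<and> mul A p (unity A) = p" if p: "p \<in> ?V" for p
  proof
    show "mul A (unity A) p = p"
      by (rule lin_eq_on_vspace[OF lin_mul_right lin_id _ p], erule basis_cases) (simp add: unity mul_delta)
    show "mul A p (unity A) = p"
      by (rule lin_eq_on_vspace[OF lin_mul_left lin_id _ p], erule basis_cases) (simp add: unity mul_delta)
  qed
  moreover have "reassoc (tensor_map (comult A) id (comult A p)) = tensor_map id (comult A) (comult A p)"
    if p: "p \<in> ?V" for p
    by (rule lin_eq_on_vspace[OF lin_comp[OF lin_reassoc lin_comp[OF lin_tensor_map lin_comult]]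
          lin_comp[OF lin_tensor_map lin_comult] _ p], erule basis_cases) (rule coassoc_delta)
  moreover have "lin_ext (\<lambda>(a, b). scale (counit A (delta a)) (delta b)) (comult A p) = p"
    if p: "p \<in> ?V" for p
    by (rule lin_eq_on_vspace[OF lin_comp[OF lin_lin_ext lin_comult] lin_id _ p], erule basis_cases)
      (rule counit_left_delta)
  moreover have "lin_ext (\<lambda>(a, b). scale (counit A (delta b)) (delta a)) (comult A p) = p"
    if p: "p \<in> ?V" for p
    by (rule lin_eq_on_vspace[OF lin_comp[OF lin_lin_ext lin_comult] lin_id _ p], erule basis_cases)
      (rule counit_right_delta)
  moreover have "comult A (mul A p q) = tensor_times A (comult A p) (comult A q)"
    if p: "p \<in> ?V" and q: "q \<in> ?V" for p q
  proof -
    have 1: "comult A (mul A (delta (\<mu> f)) q) = tensor_times A (comult A (delta (\<mu> f))) (comult A q)"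
      if "f \<in> forests" for f
      by (rule lin_eq_on_vspace[OF lin_comp[OF lin_comult lin_mul_right]
            lin_comp[OF lin_tensor_times_right lin_comult] _ q], erule basis_cases)
        (rule comult_mul_delta[OF that])
    show ?thesis
      by (rule lin_eq_on_vspace[OF lin_comp[OF lin_comult lin_mul_left]
            lin_comp[OF lin_tensor_times_left lin_comult] _ p], erule basis_cases) (rule 1)
  qed
  moreover have "comult A (unity A) = tensor (unity A) (unity A)"
    by (simp add: unity comult_delta)
  moreover have "counit A (mul A p q) = counit A p * counit A q" if p: "p \<in> ?V" and q: "q \<in> ?V" for p q
  proof -
    have 1: "counit A (mul A (delta (\<mu> f)) q) = counit A (delta (\<mu> f)) * counit A q" if "f \<in> forests" for f
      by (rule lfun_eq_on_vspace[OF lfun_lin[OF lfun_counit lin_mul_right] lfun_cmult[OF lfun_counit] _ q],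
          erule basis_cases) (use that in \<open>simp add: mul_delta counit_delta\<close>)
    have "counit A (mul A p q) = counit A q * counit A p"
      by (rule lfun_eq_on_vspace[OF lfun_lin[OF lfun_counit lin_mul_left] lfun_cmult[OF lfun_counit] _ p],
          erule basis_cases) (simp add: 1)
    then show ?thesis
      by simp
  qed
  moreover have "counit A (unity A) = 1"
    by (simp add: unity counit_delta)
  ultimately show ?thesis
    unfolding is_bialgebra_def Let_def by (intro conjI ballI; simp only:)
qed

end

text \<open>By \<open>ker\<close> the assignment \<open>\<mu> f\<close> to \<open>\<mu>' f\<close>
  is a well-defined bijection of bases, and the structure maps on both sides are given by the same
  formulas in \<open>f\<close>.\<close>

theorem factorisation_bialgebras_isomorphic:
  assumes "factorisation_bialgebra A \<mu> t c u" "factorisation_bialgebra A' \<mu>' t' c' u'"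
    and ker: "\<And>f g. f \<in> forests \<Longrightarrow> g \<in> forests \<Longrightarrow> \<mu> f = \<mu> g \<longleftrightarrow> \<mu>' f = \<mu>' g"
  shows "isomorphic_bialgebras A A'"
proof -
  interpret A: factorisation_bialgebra A \<mu> t c u by fact
  interpret A': factorisation_bialgebra A' \<mu>' t' c' u' by fact
  \<comment> \<open>\<open>inv_into\<close> picks some list for a basis element; \<open>ker\<close>
    makes the result independent of that choice.\<close>
  define \<beta> where "\<beta> b = \<mu>' (inv_into forests \<mu> b)" for b
  define \<gamma> where "\<gamma> b = \<mu> (inv_into forests \<mu>' b)" for b
  define \<phi> where "\<phi> = lin_ext (\<lambda>b. delta (\<beta> b))"
  define \<psi> where "\<psi> = lin_ext (\<lambda>b. delta (\<gamma> b))"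
  have \<beta>: "\<beta> (\<mu> f) = \<mu>' f" if "f \<in> forests" for f
    using ker[of "inv_into forests \<mu> (\<mu> f)" f] that
    by (simp add: \<beta>_def f_inv_into_f inv_into_into)
  have \<gamma>: "\<gamma> (\<mu>' f) = \<mu> f" if "f \<in> forests" for f
    using ker[of "inv_into forests \<mu>' (\<mu>' f)" f] that
    by (simp add: \<gamma>_def f_inv_into_f inv_into_into)
  have lin\<phi>: "lin \<phi>" and lin\<psi>: "lin \<psi>"
    by (auto simp: \<phi>_def \<psi>_def lin_lin_ext)
  have \<phi>: "\<phi> (delta (\<mu> f)) = delta (\<mu>' f)" and \<psi>: "\<psi> (delta (\<mu>' f)) = delta (\<mu> f)" if "f \<in> forests" for f
    using that by (auto simp: \<phi>_def \<psi>_def \<beta> \<gamma>)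
  let ?V = "vspace (basis A)" and ?V' = "vspace (basis A')"
  have \<phi>V: "\<phi> p \<in> ?V'" if "p \<in> ?V" for p
    by (rule lin_vspace[OF lin\<phi> _ that]) (auto simp: A.basis A'.basis \<phi>)
  have \<psi>V: "\<psi> p \<in> ?V" if "p \<in> ?V'" for p
    by (rule lin_vspace[OF lin\<psi> _ that]) (auto simp: A.basis A'.basis \<psi>)
  have "\<psi> (\<phi> p) = p" if "p \<in> ?V" for p
    by (rule lin_eq_on_vspace[OF lin_comp[OF lin\<psi> lin\<phi>] lin_id _ that]) (auto simp: A.basis \<phi> \<psi>)
  moreover have "\<phi> (\<psi> p) = p" if "p \<in> ?V'" for p
    by (rule lin_eq_on_vspace[OF lin_comp[OF lin\<phi> lin\<psi>] lin_id _ that]) (auto simp: A'.basis \<phi> \<psi>)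
  ultimately have bij: "bij_betw \<phi> ?V ?V'"
    using \<phi>V \<psi>V by (intro bij_betw_byWitness[where f' = \<psi>]) auto
  have mul: "\<phi> (mul A p q) = mul A' (\<phi> p) (\<phi> q)" if p: "p \<in> ?V" and q: "q \<in> ?V" for p q
  proof -
    have 1: "\<phi> (mul A (delta (\<mu> f)) q) = mul A' (\<phi> (delta (\<mu> f))) (\<phi> q)" if "f \<in> forests" for f
      by (rule lin_eq_on_vspace[OF lin_comp[OF lin\<phi> A.lin_mul_right] lin_comp[OF A'.lin_mul_right lin\<phi>] _ q],
          erule A.basis_cases) (use that in \<open>simp add: A.mul_delta A'.mul_delta \<phi>\<close>)
    show ?thesis
      by (rule lin_eq_on_vspace[OF lin_comp[OF lin\<phi> A.lin_mul_left] lin_comp[OF A'.lin_mul_left lin\<phi>] _ p],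
          erule A.basis_cases) (rule 1)
  qed
  have comult: "comult A' (\<phi> p) = tensor_map \<phi> \<phi> (comult A p)" if p: "p \<in> ?V" for p
  proof -
    have "comult A' (\<phi> (delta (\<mu> f))) = tensor_map \<phi> \<phi> (comult A (delta (\<mu> f)))" if "f \<in> forests" for f
      unfolding \<phi>[OF that] A.comult_delta[OF that] A'.comult_delta[OF that] lin_sum[OF lin_tensor_map]
      by (rule sum.cong) (auto simp: \<phi> factorisations_def)
    then show ?thesis
      by (intro lin_eq_on_vspace[OF lin_comp[OF A'.lin_comult lin\<phi>] lin_comp[OF lin_tensor_map A.lin_comult] _ p],
          elim A.basis_cases)
  qed
  have counit: "counit A' (\<phi> p) = counit A p" if p: "p \<in> ?V" for p
    by (rule lfun_eq_on_vspace[OF lfun_lin[OF A'.lfun_counit lin\<phi>] A.lfun_counit _ p], erule A.basis_cases)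
      (simp add: \<phi> A.counit_delta A'.counit_delta)
  have "is_linear (basis A) (basis A') \<phi>"
    by (rule is_linearI[OF lin\<phi>]) (auto intro: \<phi>V)
  moreover have "\<phi> (unity A) = unity A'"
    by (simp add: A.unity A'.unity \<phi>)
  ultimately have "is_bialgebra_iso A A' \<phi>"
    using bij mul comult counit by (auto simp: is_bialgebra_iso_def)
  then show ?thesis
    using A.is_bialgebra A'.is_bialgebra by (auto simp: isomorphic_bialgebras_def)
qed

section \<open>The Faa di Bruno bialgebra\<close>

text \<open>Dedekind's independence of characters, by the classical elimination of one character
  from a linear relation.\<close>

lemma dedekind_independence:
  fixes \<chi> :: "'i \<Rightarrow> 'x \<Rightarrow> 'k :: field"
  assumes "finite I"
    and closed: "\<And>x y. x \<in> M \<Longrightarrow> y \<in> M \<Longrightarrow> op x y \<in> M"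
    and hom: "\<And>i x y. i \<in> I \<Longrightarrow> x \<in> M \<Longrightarrow> y \<in> M \<Longrightarrow> \<chi> i (op x y) = \<chi> i x * \<chi> i y"
    and nonzero: "\<And>i. i \<in> I \<Longrightarrow> \<exists>x\<in>M. \<chi> i x \<noteq> 0"
    and distinct: "\<And>i j. i \<in> I \<Longrightarrow> j \<in> I \<Longrightarrow> i \<noteq> j \<Longrightarrow> \<exists>x\<in>M. \<chi> i x \<noteq> \<chi> j x"
    and zero: "\<And>x. x \<in> M \<Longrightarrow> (\<Sum>i\<in>I. c i * \<chi> i x) = 0"
    and "i \<in> I"
  shows "c i = 0"
  using assms(1) hom nonzero distinct zero \<open>i \<in> I\<close>
proof (induction I arbitrary: c i rule: finite_induct)
  case empty
  then show ?case
    by simp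
next
  case (insert j I)
  have I: "c i = 0" if i: "i \<in> I" for i
  proof -
    have "i \<noteq> j"
      using insert.hyps(2) that by auto
    then obtain y where y: "y \<in> M" "\<chi> i y \<noteq> \<chi> j y"
      using insert.prems(3)[of i j] i by auto
    \<comment> \<open>The relation at \<open>op x y\<close> minus \<open>\<chi> j y\<close> times
      the relation at \<open>x\<close> has no term for \<open>j\<close>; its coefficients are
      \<open>c i * (\<chi> i y - \<chi> j y)\<close>.\<close>
    have "c i * (\<chi> i y - \<chi> j y) = 0"
    proof (rule insert.IH[of "\<lambda>i. c i * (\<chi> i y - \<chi> j y)"])
      fix x
      assume x: "x \<in> M"
      have "(\<Sum>i\<in>insert j I. c i * \<chi> i (op x y)) - \<chi> j y * (\<Sum>i\<in>insert j I. c i * \<chi> i x) = 0"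
        using insert.prems(4)[OF closed[OF x y(1)]] insert.prems(4)[OF x] by simp
      moreover have "(\<Sum>i\<in>insert j I. c i * \<chi> i (op x y)) = (\<Sum>i\<in>insert j I. c i * (\<chi> i x * \<chi> i y))"
        using insert.prems(1)[OF _ x y(1)] by simp
      ultimately show "(\<Sum>i\<in>I. c i * (\<chi> i y - \<chi> j y) * \<chi> i x) = 0"
        using insert.hyps by (simp add: sum_distrib_left sum_subtractf[symmetric] algebra_simps)
    qed (use insert.prems that in auto)
    then show ?thesis
      using y(2) by simp
  qed
  obtain x where "x \<in> M" "\<chi> j x \<noteq> 0"
    using insert.prems(2)[of j] by auto
  then have "c j = 0"
    using insert.prems(4)[of x] insert.hyps I by simp
  then show ?case
    using I insert.prems(5) by auto
qed

text \<open>Substitution of \<open>a\<close> into the monomial \<open>m\<close>. The target is kept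
  general, since it is used with rational coordinates for \<open>mono_eval\<close> and with elements
  of the tensor square for the multiplicative extension of \<open>FdB_comult_gen\<close>.\<close>

definition mono_prod :: "('v \<Rightarrow> 'a) \<Rightarrow> ('v \<Rightarrow>\<^sub>0 nat) \<Rightarrow> 'a :: comm_monoid_mult" where
  "mono_prod a m = (\<Prod>v\<in>Poly_Mapping.keys m. a v ^ Poly_Mapping.lookup m v)"

lemma mono_prod_superset:
  assumes "finite B" "Poly_Mapping.keys m \<subseteq> B"
  shows "mono_prod a m = (\<Prod>v\<in>B. a v ^ Poly_Mapping.lookup m v)"
  unfolding mono_prod_def using assms
  by (intro prod.mono_neutral_left) (auto simp: in_keys_iff)

lemma mono_prod_0 [simp]: "mono_prod a 0 = 1"
  by (simp add: mono_prod_def)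

lemma mono_prod_single [simp]: "mono_prod a (Poly_Mapping.single v (Suc 0)) = a v"
  by (simp add: mono_prod_def)

lemma mono_prod_add: "mono_prod a (m + n) = mono_prod a m * mono_prod a n"
  using Poly_Mapping.keys_add[of m n]
  by (subst (1 2 3) mono_prod_superset[of "Poly_Mapping.keys m \<union> Poly_Mapping.keys n"])
    (auto simp: lookup_add power_add prod.distrib)

lemma mono_prod_times: "mono_prod (\<lambda>v. a v * b v) m = mono_prod a m * mono_prod b m"
  by (simp add: mono_prod_def power_mult_distrib prod.distrib)

lemma mono_eval_conv: "mono_eval m F = mono_prod (\<lambda>v. coord v F) m"
  by (simp add: mono_eval_def mono_prod_def)

section \<open>Operations as coordinates, lists of operations as monomials\<close>

fun two_var :: "two \<Rightarrow> var" where
  "two_var One = VX"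
| "two_var Two = VY"

fun var_two :: "var \<Rightarrow> two" where
  "var_two VX = One"
| "var_two VY = Two"

lemma two_var_inverse [simp]: "two_var (var_two v) = v" "var_two (two_var c) = c"
  by (cases v; cases c; simp)+

lemma inj_two_var: "inj two_var"
  by (rule inj_on_inverseI[of _ var_two]) simp

lemma map_two_var_eq [simp]: "map two_var v = map two_var w \<longleftrightarrow> v = w"
  by (simp add: inj_map_eq_map inj_two_var)

text \<open>Colours are variables: the operation with inputs \<open>w\<close> and output
  \<open>i\<close> stands for the coordinate that reads the coefficient of the word \<open>w\<close>
  in the \<open>i\<close>-th series.\<close>

definition gen :: "opn \<Rightarrow> two \<times> var list" where
  "gen f = (snd f, map two_var (fst f))"

definition fmono :: "opn list \<Rightarrow> monomial" where
  "fmono fs = (\<Sum>f\<leftarrow>fs. Poly_Mapping.single (gen f) (Suc 0))"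

lemma fmono_simps [simp]: "fmono [] = 0" "fmono (f # fs) = Poly_Mapping.single (gen f) (Suc 0) + fmono fs"
  "fmono (xs @ ys) = fmono xs + fmono ys"
  by (auto simp: fmono_def)

lemma inj_gen: "gen f = gen g \<longleftrightarrow> f = g"
  by (auto simp: gen_def prod_eq_iff)

lemma lookup_fmono: "Poly_Mapping.lookup (fmono fs) (gen f) = count (mset fs) f"
  by (induction fs) (auto simp: lookup_add lookup_single inj_gen when_def)

lemma gen_surj: "\<exists>f. gen f = v"
  by (rule exI[of _ "(map var_two (snd v), fst v)"]) (simp add: gen_def comp_def)

text \<open>Exponents are multiplicities and \<open>gen\<close> is a bijection, so a monomial is the
  same as a multiset of operations.\<close>

lemma fmono_eq_iff: "fmono xs = fmono ys \<longleftrightarrow> mset xs = mset ys"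
proof
  assume "fmono xs = fmono ys"
  then show "mset xs = mset ys"
    by (intro multiset_eqI) (simp flip: lookup_fmono)
next
  assume "mset xs = mset ys"
  then show "fmono xs = fmono ys"
    using gen_surj by (intro poly_mapping_eqI) (metis lookup_fmono)
qed

lemma monomials_eq: "monomials = fmono ` forests"
proof -
  have "Poly_Mapping.keys (fmono fs) \<subseteq> {(i, w). w \<noteq> []}" if "fs \<in> forests" for fs
    using that
  proof (induction fs)
    case (Cons f fs)
    then show ?case
      using Poly_Mapping.keys_add[of "Poly_Mapping.single (gen f) (Suc 0)" "fmono fs"]
      by (auto simp: gen_def)
  qed auto
  moreover have "m \<in> fmono ` forests" if "m \<in> monomials" for m
  proof -
    have "\<exists>xs \<in> forests. m = fmono xs"
      if "finite K" "Poly_Mapping.keys m \<subseteq> K" "K \<subseteq> {(i, w). w \<noteq> []}" for K and m :: monomial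
      using that
    proof (induction K arbitrary: m rule: finite_induct)
      case empty
      then show ?case
        by (auto intro!: bexI[of _ "[]"])
    next
      case (insert v K)
      obtain f where f: "gen f = v"
        using gen_surj by blast
      have fst: "fst f \<noteq> []"
        using insert.prems(2) f by (auto simp: gen_def)
      \<comment> \<open>The exponent of \<open>v\<close> is reset to 0, so the induction hypothesis
        covers the other variables; the lost power of \<open>v\<close> returns as copies of
        \<open>f\<close>.\<close>
      let ?m = "Poly_Mapping.update v 0 m"
      have "Poly_Mapping.keys ?m \<subseteq> K"
        using insert.prems(1) by (auto simp: in_keys_iff subset_iff lookup_update split: if_splits)
      then obtain xs where xs: "xs \<in> forests" "?m = fmono xs"
        using insert.IH[of ?m] insert.prems(2) by auto
      have rep: "fmono (replicate k f) = Poly_Mapping.single v k" for k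
        by (induction k) (auto simp: f single_add[symmetric])
      have "m = fmono (replicate (Poly_Mapping.lookup m v) f @ xs)"
        by (rule poly_mapping_eqI)
          (auto simp: rep xs(2)[symmetric] lookup_add lookup_single lookup_update when_def)
      moreover have "replicate (Poly_Mapping.lookup m v) f @ xs \<in> forests"
        using xs(1) fst by (auto simp: forests_def)
      ultimately show ?case
        by blast
    qed
    from this[of "Poly_Mapping.keys m" m] show ?thesis
      using \<open>m \<in> monomials\<close> by (auto simp: monomials_def)
  qed
  ultimately show ?thesis
    by (auto simp: monomials_def)
qed

section \<open>Polynomials are determined by their values\<close>

lemma tensor_eval_conv: "tensor_eval q F G =
    (\<Sum>p\<in>Poly_Mapping.keys q. Poly_Mapping.lookup q p * (mono_eval (fst p) F * mono_eval (snd p) G))"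
  by (simp add: tensor_eval_def split_def mult.assoc)

lemma lfun_tensor_eval: "lfun (\<lambda>q. tensor_eval q F G)"
  unfolding tensor_eval_conv by (rule lfun_ext)

lemma tensor_eval_delta: "tensor_eval (delta (m, n)) F G = mono_eval m F * mono_eval n G"
  by (simp add: tensor_eval_conv lookup_delta)

text \<open>Realises arbitrary values of all coordinates by a pair of series, so that polynomials
  may be evaluated at arbitrary points. The constant terms are forced to vanish; monomials do not
  see them.\<close>

definition series_pair :: "(two \<times> var list \<Rightarrow> rat) \<Rightarrow> series \<times> series" where
  "series_pair a = (\<lambda>w. if w = [] then 0 else a (One, w), \<lambda>w. if w = [] then 0 else a (Two, w))"

lemma series_pair_in: "series_pair a \<in> series_pairs"
  by (simp add: series_pair_def series_pairs_def)

lemma coord_series_pair: "snd v \<noteq> [] \<Longrightarrow> coord v (series_pair a) = a v"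
  by (cases v; cases "fst v") (auto simp: series_pair_def)

lemma mono_eval_series_pair: "m \<in> monomials \<Longrightarrow> mono_eval m (series_pair a) = mono_prod a m"
  unfolding mono_eval_conv mono_prod_def
  by (rule prod.cong) (auto simp: monomials_def coord_series_pair)

text \<open>The functions \<open>(F, G) \<mapsto> a\<^sup>m(F) a\<^sup>n(G)\<close> are pairwise distinct characters for the pointwise product.\<close>

lemma tensor_eval_eqD:
  assumes p: "p \<in> vspace (monomials \<times> monomials)" and q: "q \<in> vspace (monomials \<times> monomials)"
    and eq: "\<And>F G. F \<in> series_pairs \<Longrightarrow> G \<in> series_pairs \<Longrightarrow> tensor_eval p F G = tensor_eval q F G"
  shows "p = q"
proof -
  define r where "r = p + scale (-1) q"
  have r: "r \<in> vspace (monomials \<times> monomials)"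
    unfolding r_def using p q by (intro vspace_add vspace_scale)
  define \<chi> :: "monomial \<times> monomial \<Rightarrow> (two \<times> var list \<Rightarrow> rat) \<times> (two \<times> var list \<Rightarrow> rat) \<Rightarrow> rat"
    where "\<chi> = (\<lambda>(m, n) (a, b). mono_prod a m * mono_prod b n)"
  let ?op = "\<lambda>(a :: two \<times> var list \<Rightarrow> rat, b :: two \<times> var list \<Rightarrow> rat) (a', b'). (\<lambda>v. a v * a' v, \<lambda>v. b v * b' v)"
  \<comment> \<open>The point with value 2 at \<open>v\<close> and 1 elsewhere: a monomial takes the
    value 2 to the exponent of \<open>v\<close> there, so these points separate monomials.\<close>
  let ?up = "\<lambda>v :: two \<times> var list. (\<lambda>_. 1 :: rat)(v := 2)"
  have up: "mono_prod (?up v) m = 2 ^ Poly_Mapping.lookup m v" for v m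
    by (subst mono_prod_superset[of "insert v (Poly_Mapping.keys m)"])
      (auto simp: prod.insert_remove intro!: prod.neutral)
  have one: "mono_prod (\<lambda>_. 1) m = (1 :: rat)" for m :: monomial
    by (simp add: mono_prod_def)
  have "Poly_Mapping.lookup r i = 0" if "i \<in> Poly_Mapping.keys r" for i
  proof (rule dedekind_independence[of "Poly_Mapping.keys r" UNIV ?op \<chi>])
    show "\<exists>x\<in>UNIV. \<chi> i x \<noteq> \<chi> j x" if ne: "i \<noteq> j" for i j
    proof -
      obtain m n m' n' where ij: "i = (m, n)" "j = (m', n')"
        by (metis surj_pair)
      consider v where "Poly_Mapping.lookup m v \<noteq> Poly_Mapping.lookup m' v"
        | v where "Poly_Mapping.lookup n v \<noteq> Poly_Mapping.lookup n' v"
        using ne ij poly_mapping_eqI by metis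
      then show ?thesis
      proof cases
        case 1
        then have "\<chi> i (?up v, \<lambda>_. 1) \<noteq> \<chi> j (?up v, \<lambda>_. 1)"
          by (simp add: \<chi>_def ij up one)
        then show ?thesis
          by blast
      next
        case 2
        then have "\<chi> i (\<lambda>_. 1, ?up v) \<noteq> \<chi> j (\<lambda>_. 1, ?up v)"
          by (simp add: \<chi>_def ij up one)
        then show ?thesis
          by blast
      qed
    qed
    show "\<exists>x\<in>UNIV. \<chi> i x \<noteq> 0" for i
      by (rule bexI[of _ "(\<lambda>_. 1, \<lambda>_. 1)"]) (auto simp: \<chi>_def one split_def)
    show "\<chi> i (?op x y) = \<chi> i x * \<chi> i y" for i x y
      by (auto simp: \<chi>_def split_def mono_prod_times)
    show "(\<Sum>i\<in>Poly_Mapping.keys r. Poly_Mapping.lookup r i * \<chi> i x) = 0" for x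
    proof -
      have "(\<Sum>i\<in>Poly_Mapping.keys r. Poly_Mapping.lookup r i * \<chi> i x) =
          tensor_eval r (series_pair (fst x)) (series_pair (snd x))"
        unfolding tensor_eval_conv using r
        by (intro sum.cong) (auto simp: \<chi>_def vspace_def mono_eval_series_pair split_def)
      also have "\<dots> = 0"
        by (simp add: r_def lfun_add[OF lfun_tensor_eval] lfun_scale[OF lfun_tensor_eval] eq series_pair_in)
      finally show ?thesis .
    qed
  qed (use that in auto)
  then have "Poly_Mapping.lookup r i = 0" for i
    by (meson in_keys_iff)
  then show ?thesis
    by (intro poly_mapping_eqI) (simp add: r_def lookup_add)
qed

section \<open>Substitution of series as a sum over forests\<close>

lemma coord_pair_comp: "coord (i, w) (pair_comp G F) = series_subst (\<lambda>u. coord (i, u) G) F w"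
  by (cases i; cases G) (auto simp: pair_comp_def)

lemma word_subst_Cons:
  "word_subst F (v # u) w = (\<Sum>(a, b) \<in> {(a, b). a @ b = w}. coord (var_two v, a) F * word_subst F u b)"
proof -
  have "coord (var_two v, a) F = (case v of VX \<Rightarrow> fst F | VY \<Rightarrow> snd F) a" for a
    by (cases v; cases F) auto
  then show ?thesis
    by (simp add: word_subst_def series_times_def)
qed

lemma finite_splits: "finite {(a, b). a @ b = w}"
proof (rule finite_subset)
  show "{(a, b). a @ b = w} \<subseteq> (\<lambda>n. (take n w, drop n w)) ` {..length w}"
  proof clarify
    fix a b :: "'a list"
    show "(a, b) \<in> (\<lambda>n. (take n (a @ b), drop n (a @ b))) ` {..length (a @ b)}"
      by (rule image_eqI[where x = "length a"]) auto
  qed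
qed simp

lemma coord_Nil: "F \<in> series_pairs \<Longrightarrow> coord (i, []) F = 0"
  by (cases i; cases F) (auto simp: series_pairs_def)

text \<open>The coefficient at \<open>w\<close> of a product of series sums over the ways to cut
  \<open>w\<close> into one piece per factor. A piece together with the letter of its factor is an
  operation, so a cut is a forest from \<open>w\<close> to \<open>r\<close>.\<close>

lemma word_subst_forests:
  assumes F: "F \<in> series_pairs"
  shows "word_subst F (map two_var r) (map two_var w) =
    (\<Sum>h | h \<in> forests \<and> leaves h = w \<and> roots h = r. mono_eval (fmono h) F)"
proof (induction r arbitrary: w)
  case Nil
  have "{h. h \<in> forests \<and> leaves h = w \<and> roots h = []} = (if w = [] then {[]} else {})"
    by auto
  then show ?case
    by (simp add: word_subst_def series_one_def mono_eval_conv)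
next
  case (Cons c r)
  define H where "H r w = {h. h \<in> forests \<and> leaves h = w \<and> roots h = r}" for r w
  have fin: "finite (H r w)" for r w
    by (rule finite_subset[OF _ finite_forests[of w]]) (auto simp: H_def)
  let ?S = "{(a, b). a @ b = w}"
  have "word_subst F (map two_var (c # r)) (map two_var w) =
      (\<Sum>(a, b)\<in>{(a, b). a @ b = map two_var w}. coord (c, a) F * word_subst F (map two_var r) b)"
    by (simp add: word_subst_Cons)
  also have "\<dots> = (\<Sum>(a, b)\<in>?S. coord (c, map two_var a) F * word_subst F (map two_var r) (map two_var b))"
    by (rule sum.reindex_bij_witness[where i = "map_prod (map two_var) (map two_var)" and
          j = "map_prod (map var_two) (map var_two)"]) (auto simp: comp_def simp flip: map_append)
  also have "\<dots> = (\<Sum>(a, b)\<in>?S. \<Sum>h\<in>H r b. coord (c, map two_var a) F * mono_eval (fmono h) F)"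
    by (simp add: Cons.IH sum_distrib_left H_def)
  also have "\<dots> = (\<Sum>((a, b), h)\<in>(SIGMA p : ?S. H r (snd p)). coord (c, map two_var a) F * mono_eval (fmono h) F)"
    using fin finite_splits[of w] by (subst sum.Sigma[symmetric]) (auto simp: split_def)
  \<comment> \<open>Cuts with an empty first piece contribute nothing, as \<open>F\<close> has no
    constant term; the remaining ones are those that give operations with an input.\<close>
  also have "\<dots> = (\<Sum>((a, b), h)\<in>(SIGMA p : {(a, b). a @ b = w \<and> a \<noteq> []}. H r (snd p)).
      coord (c, map two_var a) F * mono_eval (fmono h) F)"
    using fin finite_splits[of w]
    by (intro sum.mono_neutral_right) (auto simp: coord_Nil[OF F])
  also have "\<dots> = (\<Sum>h\<in>H (c # r) w. mono_eval (fmono h) F)"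
    by (rule sum.reindex_bij_witness[where i = "\<lambda>h. ((fst (hd h), leaves (tl h)), tl h)" and
          j = "\<lambda>((a, b), h). (a, c) # h"])
      (auto simp: H_def roots_def mono_eval_conv mono_prod_add gen_def)
  finally show ?case
    by (simp add: H_def)
qed

text \<open>The forests with leaves \<open>w\<close> are grouped by their word of roots. Only the
  finitely many words that occur contribute, which turns \<open>Sum_any\<close> into a finite
  sum.\<close>

lemma series_subst_forests:
  assumes F: "F \<in> series_pairs"
  shows "series_subst g F (map two_var w) =
    (\<Sum>h | h \<in> forests \<and> leaves h = w. g (map two_var (roots h)) * mono_eval (fmono h) F)"
proof -
  let ?H = "{h. h \<in> forests \<and> leaves h = w}"
  let ?r = "\<lambda>h. map two_var (roots h)"
  have fin: "finite ?H"
    using finite_forests[of w] by simp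
  have ws: "word_subst F u (map two_var w) = (\<Sum>h | h \<in> ?H \<and> ?r h = u. mono_eval (fmono h) F)" for u
  proof -
    obtain r where u: "u = map two_var r"
      by (rule that[of "map var_two u"]) (simp add: comp_def)
    have "{h. h \<in> ?H \<and> ?r h = u} = {h. h \<in> forests \<and> leaves h = w \<and> roots h = r}"
      by (auto simp: u)
    then show ?thesis
      using word_subst_forests[OF F, of r w] by (simp only: u)
  qed
  have "series_subst g F (map two_var w) = (\<Sum>u\<in>?r ` ?H. g u * word_subst F u (map two_var w))"
    unfolding series_subst_def
  proof (rule Sum_any.expand_superset)
    show "{u. g u * word_subst F u (map two_var w) \<noteq> 0} \<subseteq> ?r ` ?H"
    proof
      fix u
      assume "u \<in> {u. g u * word_subst F u (map two_var w) \<noteq> 0}"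
      then have "(\<Sum>h | h \<in> ?H \<and> ?r h = u. mono_eval (fmono h) F) \<noteq> 0"
        unfolding ws by auto
      then obtain h where "h \<in> ?H" "?r h = u"
        by (auto elim: sum.not_neutral_contains_not_neutral)
      then show "u \<in> ?r ` ?H"
        by auto
    qed
  qed (use fin in simp)
  also have "\<dots> = (\<Sum>u\<in>?r ` ?H. \<Sum>h | h \<in> ?H \<and> ?r h = u. g (?r h) * mono_eval (fmono h) F)"
    unfolding ws sum_distrib_left by (intro sum.cong) auto
  also have "\<dots> = (\<Sum>h\<in>?H. g (?r h) * mono_eval (fmono h) F)"
    using sum.image_gen[OF fin, of "\<lambda>h. g (?r h) * mono_eval (fmono h) F" ?r] by simp
  finally show ?thesis
    by simp
qed

section \<open>Comultiplication and counit of the Faa di Bruno bialgebra on monomials\<close>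

definition fac_sum :: "opn list \<Rightarrow> (monomial \<times> monomial \<Rightarrow>\<^sub>0 rat)" where
  "fac_sum f = (\<Sum>(h, g)\<in>factorisations f. delta (fmono h, fmono g))"

text \<open>The root factor of a single operation \<open>(w, i)\<close> is the single operation
  \<open>(roots h, i)\<close>, so the factorisations are indexed by the forests \<open>h\<close>
  with leaves \<open>w\<close>. The leafward factor is evaluated at \<open>F\<close>, the series
  that is substituted into \<open>G\<close>.\<close>

lemma tensor_eval_fac_sum:
  assumes F: "F \<in> series_pairs" and f: "fst f \<noteq> []"
  shows "tensor_eval (fac_sum [f]) F G = coord (gen f) (pair_comp G F)"
proof -
  obtain w i where [simp]: "f = (w, i)"
    by (cases f)
  have "tensor_eval (fac_sum [f]) F G =
      (\<Sum>(h, g)\<in>factorisations [f]. mono_eval (fmono h) F * mono_eval (fmono g) G)"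
    by (simp add: fac_sum_def lfun_sum[OF lfun_tensor_eval] tensor_eval_delta split_def)
  also have "\<dots> = (\<Sum>h | h \<in> forests \<and> leaves h = w. coord (gen (roots h, i)) G * mono_eval (fmono h) F)"
  proof (rule sum.reindex_bij_witness[where i = "\<lambda>h. (h, [(roots h, i)])" and j = fst])
    fix p
    assume p: "p \<in> factorisations [f]"
    obtain h g where [simp]: "p = (h, g)"
      by (cases p)
    have "roots g = [i]" "leaves h = w" "h \<in> forests"
      using factorisations_leaves_roots[of h g "[f]"] p by auto
    moreover from this have "g = [(leaves g, i)]"
      by (auto simp: roots_def)
    moreover have "leaves g = roots h"
      using p by (auto simp: factorisations_def)
    ultimately have g: "g = [(roots h, i)]"
      by simp
    then show "(fst p, [(roots (fst p), i)]) = p"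
      by simp
    show "fst p \<in> {h. h \<in> forests \<and> leaves h = w}"
      using \<open>leaves h = w\<close> \<open>h \<in> forests\<close> by simp
    show "coord (gen (roots (fst p), i)) G * mono_eval (fmono (fst p)) F =
        (case p of (h, g) \<Rightarrow> mono_eval (fmono h) F * mono_eval (fmono g) G)"
      by (simp add: g mono_eval_conv)
  next
    fix h
    assume "h \<in> {h. h \<in> forests \<and> leaves h = w}"
    then show "(h, [(roots h, i)]) \<in> factorisations [f]"
      using f by (auto simp: factorisations_def)
  qed simp
  also have "\<dots> = coord (gen f) (pair_comp G F)"
    by (simp add: gen_def coord_pair_comp series_subst_forests[OF F])
  finally show ?thesis .
qed

lemma fac_sum_vspace: "fac_sum f \<in> vspace (monomials \<times> monomials)"
  by (auto simp: fac_sum_def monomials_eq factorisations_def intro!: vspace_sum)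

text \<open>Resolves the definite description: \<open>tensor_eval_fac_sum\<close> provides a
  solution and \<open>tensor_eval_eqD\<close> its uniqueness.\<close>

lemma FdB_comult_gen_eq:
  assumes "fst f \<noteq> []"
  shows "FdB_comult_gen (gen f) = fac_sum [f]"
  unfolding FdB_comult_gen_def
proof (rule the_equality)
  show "fac_sum [f] \<in> vspace (monomials \<times> monomials) \<and>
      (\<forall>F\<in>series_pairs. \<forall>G\<in>series_pairs. tensor_eval (fac_sum [f]) F G = coord (gen f) (pair_comp G F))"
    using assms by (simp add: fac_sum_vspace tensor_eval_fac_sum)
  show "q = fac_sum [f]" if "q \<in> vspace (monomials \<times> monomials) \<and>
      (\<forall>F\<in>series_pairs. \<forall>G\<in>series_pairs. tensor_eval q F G = coord (gen f) (pair_comp G F))" for q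
    using that assms by (intro tensor_eval_eqD) (auto simp: fac_sum_vspace tensor_eval_fac_sum)
qed

lemma delta_times: "delta a * delta b = delta (a + b)"
  by (simp add: delta_def mult_single)

lemma fac_sum_Nil: "fac_sum [] = 1"
  by (simp add: fac_sum_def delta_def zero_prod_def[symmetric])

lemma fac_sum_append: "fac_sum (xs @ ys) = fac_sum xs * fac_sum ys"
  unfolding fac_sum_def
  by (subst sum.reindex_bij_betw[OF bij_betw_factorisations_append, symmetric])
    (simp add: sum_product sum.cartesian_product split_def delta_times)

text \<open>Both sides turn juxtaposition into products. As the left side depends on the monomial
  only, \<open>fac_sum\<close> is invariant under reordering, which is reused for the incidence
  bialgebra.\<close>

lemma mono_prod_mono: "fs \<in> forests \<Longrightarrow> mono_prod FdB_comult_gen (fmono fs) = fac_sum fs"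
proof (induction fs)
  case (Cons f fs)
  then show ?case
    using fac_sum_append[of "[f]" fs] by (simp add: mono_prod_add FdB_comult_gen_eq)
qed (simp add: fac_sum_Nil)

text \<open>The pair of variables is the identity for substitution; its nonzero coordinates belong
  to the operations \<open>([c], c)\<close>, the units of the operad.\<close>

lemma coord_variables: "coord (gen f) (var_series VX, var_series VY) = (if fst f = [snd f] then 1 else 0)"
proof -
  have "map two_var w = [two_var c] \<longleftrightarrow> w = [c]" for w c
    using map_two_var_eq[of w "[c]"] by simp
  from this[of "fst f" "snd f"] show ?thesis
    by (cases "snd f") (auto simp: gen_def var_series_def)
qed

lemma mono_eval_variables:
  "mono_eval (fmono fs) (var_series VX, var_series VY) = (if identity_forest fs then 1 else 0)"
  by (induction fs) (auto simp: mono_eval_conv mono_prod_add coord_variables identity_forest_def)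

text \<open>Brings the convolution product of polynomials into the form that the locale demands, the
  bilinear extension of the addition of exponents.\<close>

lemma times_eq_lin_ext:
  fixes p q :: "'a :: comm_monoid_add \<Rightarrow>\<^sub>0 rat"
  shows "p * q = lin_ext (\<lambda>a. lin_ext (\<lambda>b. delta (a + b)) q) p"
proof -
  have scale: "scale c p = Poly_Mapping.single 0 c * p" for c and p :: "'a \<Rightarrow>\<^sub>0 rat"
    by (simp add: scale_def mult_map_scale_conv_mult)
  have left: "lin (\<lambda>p. p * q)" for q :: "'a \<Rightarrow>\<^sub>0 rat"
    by (rule linI) (auto simp: distrib_right scale mult.assoc)
  have right: "lin (\<lambda>q. p * q)" for p :: "'a \<Rightarrow>\<^sub>0 rat"
    by (rule linI) (auto simp: distrib_left scale mult.left_commute)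
  have "delta a * q = lin_ext (\<lambda>b. delta (a + b)) q" for a
    by (rule lin_eq_on_vspace[OF right lin_lin_ext, of UNIV]) (auto simp: delta_times vspace_def)
  then show ?thesis
    by (rule_tac lin_eq_on_vspace[OF left lin_lin_ext, of UNIV]) (auto simp: vspace_def)
qed

lemma factorisation_bialgebra_FdB2:
  "factorisation_bialgebra FdB2 fmono (+) (mono_prod FdB_comult_gen)
    (\<lambda>m. mono_eval m (var_series VX, var_series VY))"
proof
  show "mul FdB2 = (\<lambda>p q. lin_ext (\<lambda>a. lin_ext (\<lambda>b. delta (a + b)) q) p)"
    by (simp add: FdB2_def times_eq_lin_ext fun_eq_iff)
  show "comult FdB2 = lin_ext (mono_prod FdB_comult_gen)"
    by (simp add: FdB2_def mono_prod_def[abs_def])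
  show "mono_prod FdB_comult_gen (fmono f) = (\<Sum>(h, g)\<in>factorisations f. delta (fmono h, fmono g))"
    if "f \<in> forests" for f
    using that by (simp add: mono_prod_mono fac_sum_def)
qed (auto simp: FdB2_def monomials_eq delta_def mono_eval_variables)

section \<open>The multiplication of the monad of tuples\<close>

text \<open>The position in \<open>concat xss\<close> of entry \<open>j\<close> of block
  \<open>i\<close>; it makes block permutations computable on pairs of indices.\<close>

definition pos :: "'a list list \<Rightarrow> nat \<Rightarrow> nat \<Rightarrow> nat" where
  "pos xss i j = length (concat (take i xss)) + j"

lemma pos_cong: "map length xss = map length yss \<Longrightarrow> pos xss i j = pos yss i j"
  by (simp add: pos_def length_concat flip: take_map)

lemma concat_split:
  "i < length xss \<Longrightarrow> concat xss = concat (take i xss) @ xss ! i @ concat (drop (Suc i) xss)"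
  using id_take_nth_drop[of i xss] by (metis concat.simps(2) concat_append)

lemma nth_concat_pos:
  assumes "i < length xss" "j < length (xss ! i)"
  shows "concat xss ! pos xss i j = xss ! i ! j"
  using assms by (subst concat_split[OF assms(1)]) (simp add: pos_def nth_append)

lemma pos_less:
  assumes "i < length xss" "j < length (xss ! i)"
  shows "pos xss i j < length (concat xss)"
  using assms by (subst concat_split[OF assms(1)]) (simp add: pos_def)

lemma pos_surj:
  assumes "p < length (concat xss)"
  obtains i j where "i < length xss" "j < length (xss ! i)" "p = pos xss i j"
proof -
  have "\<exists>i j. i < length xss \<and> j < length (xss ! i) \<and> p = pos xss i j"
    using assms
  proof (induction xss arbitrary: p)
    case (Cons xs xss)
    show ?case
    proof (cases "p < length xs")
      case True
      then show ?thesis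
        by (intro exI[of _ 0] exI[of _ p]) (simp add: pos_def)
    next
      case False
      have "p < length xs + length (concat xss)"
        using Cons.prems by simp
      then have "p - length xs < length (concat xss)"
        using False by linarith
      then obtain i j where "i < length xss" "j < length (xss ! i)" "p - length xs = pos xss i j"
        using Cons.IH by blast
      then show ?thesis
        using False by (intro exI[of _ "Suc i"] exI[of _ j]) (simp add: pos_def)
    qed
  qed simp
  then show ?thesis
    using that by blast
qed

lemma pos_strict:
  assumes "i < i'" "i' < length xss" "j < length (xss ! i)"
  shows "pos xss i j < pos xss i' j'"
proof -
  have "take i' xss = take (Suc i) xss @ take (i' - Suc i) (drop (Suc i) xss)"
    using take_add[of "Suc i" "i' - Suc i" xss] assms(1) by simp
  then have "length (concat (take (Suc i) xss)) \<le> length (concat (take i' xss))"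
    by simp
  then show ?thesis
    using assms by (simp add: pos_def take_Suc_conv_app_nth)
qed

lemma pos_inj:
  assumes "i < length xss" "j < length (xss ! i)" "i' < length xss" "j' < length (xss ! i')"
    and "pos xss i j = pos xss i' j'"
  shows "i = i'" "j = j'"
proof -
  show "i = i'"
    using pos_strict[of i i' xss j j'] pos_strict[of i' i xss j' j] assms
    by (cases i i' rule: linorder_cases) auto
  then show "j = j'"
    using assms(5) by (simp add: pos_def)
qed

text \<open>The action of the multiplication of \<open>Sr\<close> on the arrow that permutes the blocks \<open>xss\<close> by \<open>\<sigma>\<close>.\<close>

definition shuffle_blocks :: "(nat \<Rightarrow> nat) \<Rightarrow> 'a list list \<Rightarrow> nat \<Rightarrow> nat" where
  "shuffle_blocks \<sigma> xss = block_perm \<sigma> (map (Pair id) (permute_list \<sigma> xss))"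

context
  fixes \<sigma> :: "nat \<Rightarrow> nat" and xss :: "'a list list"
  assumes \<sigma>: "\<sigma> permutes {..<length xss}"
begin

abbreviation (input) "yss \<equiv> permute_list \<sigma> xss"

lemma length_concat_permute: "length (concat yss) = length (concat xss)"
proof -
  have "mset yss = mset xss"
    using \<sigma> by (rule mset_permute_list)
  then have "mset (map length yss) = mset (map length xss)"
    by simp
  then show ?thesis
    unfolding length_concat by (metis sum_mset_sum_list)
qed

text \<open>Isolates the unfolding of \<open>block_perm\<close>: the table \<open>L\<close> has the
  shape of the permuted blocks, and its entries are positions in the original ones.\<close>

lemma shuffle_blocks_code:
  "\<exists>L. map length L = map length yss \<and>
     (\<forall>i < length xss. \<forall>j < length (yss ! i). L ! i ! j = pos xss (\<sigma> i) j) \<and>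
     shuffle_blocks \<sigma> xss = (\<lambda>p. if p < length (concat L) then concat L ! p else p)"
proof -
  define n where "n = length xss"
  define offset where "offset = (\<lambda>l. \<Sum>l' < l. length (snd (map (Pair (id :: nat \<Rightarrow> nat)) yss ! inv \<sigma> l')))"
  define L where "L = map (\<lambda>i. map (\<lambda>j. offset (\<sigma> i) + fst (map (Pair (id :: nat \<Rightarrow> nat)) yss ! i) j)
    [0..<length (snd (map (Pair (id :: nat \<Rightarrow> nat)) yss ! i))]) [0..<n]"
  \<comment> \<open>The offsets of \<open>block_perm\<close> are computed from target blocks read
    through \<open>inv \<sigma>\<close>. These are the source blocks in their own order, so an
    offset is the start of a source block.\<close>
  have inv: "inv \<sigma> l < n" "yss ! inv \<sigma> l = xss ! l" if "l < n" for l
  proof -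
    show "inv \<sigma> l < n"
      using permutes_in_image[OF permutes_inv[OF \<sigma>], of l] that by (simp add: n_def)
    then show "yss ! inv \<sigma> l = xss ! l"
      using \<sigma> by (simp add: permute_list_nth n_def permutes_inverses)
  qed
  have offset: "offset l = length (concat (take l xss))" if "l \<le> n" for l
    using that
  proof (induction l)
    case (Suc l)
    then show ?case
      using inv[of l] by (simp add: offset_def take_Suc_conv_app_nth n_def)
  qed (simp add: offset_def)
  have \<sigma>n: "\<sigma> i < n" if "i < n" for i
    using permutes_in_image[OF \<sigma>, of i] that by (simp add: n_def)
  have "map length L = map length yss"
    by (rule nth_equalityI) (auto simp: L_def n_def)
  moreover have "L ! i ! j = pos xss (\<sigma> i) j" if "i < length xss" "j < length (yss ! i)" for i j
    using that \<sigma>n[of i] by (simp add: L_def n_def offset pos_def)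
  moreover have "shuffle_blocks \<sigma> xss = (\<lambda>p. if p < length (concat L) then concat L ! p else p)"
    by (simp add: shuffle_blocks_def block_perm_def Let_def L_def offset_def n_def cong: if_cong)
  ultimately show ?thesis
    by blast
qed

lemma shuffle_blocks_pos:
  assumes "i < length xss" "j < length (xss ! \<sigma> i)"
  shows "shuffle_blocks \<sigma> xss (pos yss i j) = pos xss (\<sigma> i) j"
proof -
  obtain L where L: "map length L = map length yss"
      "\<And>i j. i < length xss \<Longrightarrow> j < length (yss ! i) \<Longrightarrow> L ! i ! j = pos xss (\<sigma> i) j"
      "shuffle_blocks \<sigma> xss = (\<lambda>p. if p < length (concat L) then concat L ! p else p)"
    using shuffle_blocks_code by blast
  have j: "j < length (yss ! i)"
    using assms \<sigma> by (simp add: permute_list_nth)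
  have "length L = length xss"
    using arg_cong[OF L(1), of length] by simp
  moreover from this have "length (L ! i) = length (yss ! i)"
    using arg_cong[OF L(1), of "\<lambda>l. l ! i"] assms(1) by simp
  ultimately have "pos L i j < length (concat L)" "concat L ! pos L i j = L ! i ! j"
    using assms(1) j by (simp_all add: pos_less nth_concat_pos)
  then show ?thesis
    using L(2)[OF assms(1) j] pos_cong[OF L(1), of i j] by (simp add: L(3))
qed

lemma shuffle_blocks_outside:
  assumes "length (concat xss) \<le> p"
  shows "shuffle_blocks \<sigma> xss p = p"
proof -
  obtain L where L: "map length L = map length yss"
      "shuffle_blocks \<sigma> xss = (\<lambda>p. if p < length (concat L) then concat L ! p else p)"
    using shuffle_blocks_code by blast
  have "length (concat L) = length (concat xss)"
    using L(1) length_concat_permute by (simp add: length_concat)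
  then show ?thesis
    using assms by (simp add: L(2))
qed

lemma pos_permute_surj:
  assumes "p < length (concat xss)"
  obtains i j where "i < length xss" "j < length (xss ! \<sigma> i)" "p = pos yss i j" "yss ! i = xss ! \<sigma> i"
proof -
  have "p < length (concat yss)"
    using assms length_concat_permute by simp
  then show ?thesis
    using that \<sigma> by (elim pos_surj) (auto simp: permute_list_nth)
qed

lemma \<sigma>_less: "i < length xss \<Longrightarrow> \<sigma> i < length xss"
  using permutes_in_image[OF \<sigma>, of i] by simp

lemma shuffle_blocks_permutes: "shuffle_blocks \<sigma> xss permutes {..<length (concat xss)}"
proof (rule bij_imp_permutes)
  let ?N = "{..<length (concat xss)}"
  have "shuffle_blocks \<sigma> xss ` ?N \<subseteq> ?N"
  proof clarify
    fix p
    assume "p < length (concat xss)"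
    then show "shuffle_blocks \<sigma> xss p < length (concat xss)"
      by (rule pos_permute_surj) (simp add: shuffle_blocks_pos pos_less \<sigma>_less)
  qed
  moreover have "inj_on (shuffle_blocks \<sigma> xss) ?N"
  proof (rule inj_onI)
    fix p q
    assume p: "p \<in> ?N" and q: "q \<in> ?N" and eq: "shuffle_blocks \<sigma> xss p = shuffle_blocks \<sigma> xss q"
    from p obtain i j where p: "i < length xss" "j < length (xss ! \<sigma> i)" "p = pos yss i j"
      by (auto elim: pos_permute_surj)
    from q obtain i' j' where q: "i' < length xss" "j' < length (xss ! \<sigma> i')" "q = pos yss i' j'"
      by (auto elim: pos_permute_surj)
    have "pos xss (\<sigma> i) j = pos xss (\<sigma> i') j'"
      using eq p q by (simp add: shuffle_blocks_pos)
    then have "\<sigma> i = \<sigma> i'" "j = j'"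
      using pos_inj[of "\<sigma> i" xss j "\<sigma> i'" j'] p q \<sigma>_less by auto
    then show "p = q"
      using p q permutes_inj[OF \<sigma>] by (auto dest: injD)
  qed
  ultimately show "bij_betw (shuffle_blocks \<sigma> xss) ?N ?N"
    by (simp add: bij_betw_def endo_inj_surj)
qed (simp add: shuffle_blocks_outside)

lemma permute_list_shuffle_blocks: "permute_list (shuffle_blocks \<sigma> xss) (concat xss) = concat yss"
proof (rule nth_equalityI)
  show "length (permute_list (shuffle_blocks \<sigma> xss) (concat xss)) = length (concat yss)"
    by (simp add: length_concat_permute)
  fix p
  assume "p < length (permute_list (shuffle_blocks \<sigma> xss) (concat xss))"
  then have p: "p < length (concat xss)"
    by simp
  then obtain i j where ij: "i < length xss" "j < length (xss ! \<sigma> i)" "p = pos yss i j" "yss ! i = xss ! \<sigma> i"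
    by (rule pos_permute_surj)
  have "permute_list (shuffle_blocks \<sigma> xss) (concat xss) ! p = concat xss ! pos xss (\<sigma> i) j"
    using p ij shuffle_blocks_permutes by (simp add: permute_list_nth shuffle_blocks_pos)
  also have "\<dots> = concat yss ! p"
    using ij \<sigma>_less by (simp add: nth_concat_pos)
  finally show "permute_list (shuffle_blocks \<sigma> xss) (concat xss) ! p = concat yss ! p" .
qed

end

text \<open>Functoriality of the multiplication of \<open>Sr\<close> on permutations of blocks: both
  sides move entry \<open>j\<close> of block \<open>i\<close> to entry \<open>j\<close> of block
  \<open>\<rho> (\<sigma> i)\<close>. The inner shuffle acts on the blocks as already permuted by
  \<open>\<rho>\<close>.\<close>

lemma shuffle_blocks_comp:
  assumes \<rho>: "\<rho> permutes {..<length xss}" and \<sigma>: "\<sigma> permutes {..<length xss}"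
  shows "shuffle_blocks (\<rho> \<circ> \<sigma>) xss = shuffle_blocks \<rho> xss \<circ> shuffle_blocks \<sigma> (permute_list \<rho> xss)"
proof
  fix p
  let ?yss = "permute_list \<rho> xss"
  have \<rho>\<sigma>: "\<rho> \<circ> \<sigma> permutes {..<length xss}"
    using \<sigma> \<rho> by (rule permutes_compose)
  have \<sigma>': "\<sigma> permutes {..<length ?yss}"
    using \<sigma> by simp
  have len: "length (concat ?yss) = length (concat xss)"
    using \<rho> by (rule length_concat_permute)
  have comp: "permute_list \<sigma> ?yss = permute_list (\<rho> \<circ> \<sigma>) xss"
    using \<sigma> by (simp add: permute_list_compose)
  show "shuffle_blocks (\<rho> \<circ> \<sigma>) xss p = (shuffle_blocks \<rho> xss \<circ> shuffle_blocks \<sigma> ?yss) p"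
  proof (cases "p < length (concat xss)")
    case True
    then obtain i j where ij: "i < length xss" "j < length (xss ! (\<rho> \<circ> \<sigma>) i)"
        "p = pos (permute_list (\<rho> \<circ> \<sigma>) xss) i j"
      by (rule pos_permute_surj[OF \<rho>\<sigma>])
    have si: "\<sigma> i < length xss"
      using \<sigma>_less[OF \<sigma>] ij(1) .
    have j: "j < length (?yss ! \<sigma> i)"
      using ij(2) si \<rho> by (simp add: permute_list_nth)
    have "shuffle_blocks \<sigma> ?yss p = pos ?yss (\<sigma> i) j"
      using shuffle_blocks_pos[OF \<sigma>', of i j] ij(1) j by (simp add: ij(3) comp)
    moreover have "shuffle_blocks \<rho> xss (pos ?yss (\<sigma> i) j) = pos xss (\<rho> (\<sigma> i)) j"
      using shuffle_blocks_pos[OF \<rho> si] ij(2) by simp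
    moreover have "shuffle_blocks (\<rho> \<circ> \<sigma>) xss p = pos xss (\<rho> (\<sigma> i)) j"
      using shuffle_blocks_pos[OF \<rho>\<sigma> ij(1,2)] by (simp only: ij(3) comp_def)
    ultimately show ?thesis
      by (simp only: o_apply)
  next
    case False
    then show ?thesis
      using shuffle_blocks_outside[OF \<rho>] shuffle_blocks_outside[OF \<sigma>'] shuffle_blocks_outside[OF \<rho>\<sigma>] len
      by simp
  qed
qed

section \<open>Tuples over discrete groupoids\<close>

text \<open>Weaker than equality with \<open>discrete C\<close>, which would also fix the structure
  maps outside \<open>C\<close>; there constructions such as \<open>relabel\<close> give arbitrary
  values.\<close>

definition discrete_on :: "('o, 'o) gpd \<Rightarrow> 'o set \<Rightarrow> bool" where
  "discrete_on G C \<longleftrightarrow> Obj G = C \<and> Arr G = C \<and>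
     (\<forall>x\<in>C. Dom G x = x \<and> Cod G x = x \<and> Ide G x = x \<and> Cmp G x x = x)"

lemma discrete_on_discrete: "discrete_on (discrete K) K"
  by (simp add: discrete_on_def discrete_def)

lemma discrete_on_gprod: "discrete_on G C \<Longrightarrow> discrete_on H D \<Longrightarrow> discrete_on (gprod G H) (C \<times> D)"
  by (auto simp: discrete_on_def gprod_def)

lemma map2_idem: "(\<And>x. x \<in> set xs \<Longrightarrow> f x x = x) \<Longrightarrow> map2 f xs xs = xs"
  by (induction xs) auto

lemma discrete_on_Mr: "discrete_on G C \<Longrightarrow> discrete_on (Mr G) {xs. xs \<noteq> [] \<and> set xs \<subseteq> C}"
  by (auto simp: discrete_on_def Mr_def subset_iff intro!: map_idI map2_idem)

lemma discrete_on_relabel: "discrete_on G C \<Longrightarrow> inj i \<Longrightarrow> discrete_on (relabel i i G) (i ` C)"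
  by (auto simp: discrete_on_def relabel_def)

lemma discrete_on_pullback:
  assumes "discrete_on G C" "discrete_on H D"
    and "\<And>x. x \<in> C \<Longrightarrow> onA F x = onO F x" "\<And>y. y \<in> D \<Longrightarrow> onA F' y = onO F' y"
  shows "discrete_on (pullback G H F F') {(x, y). x \<in> C \<and> y \<in> D \<and> onO F x = onO F' y}"
  using assms by (auto simp: discrete_on_def pullback_def gprod_def)

text \<open>The arrows from \<open>xs\<close> to \<open>ys\<close> in \<open>Sr\<close> of a
  discrete groupoid.\<close>

definition perms_to :: "'a list \<Rightarrow> 'a list \<Rightarrow> (nat \<Rightarrow> nat) set" where
  "perms_to xs ys = {\<sigma>. \<sigma> permutes {..<length xs} \<and> permute_list \<sigma> xs = ys}"

lemma finite_perms_to: "finite (perms_to xs ys)"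
  by (rule finite_subset[OF _ finite_permutations[of "{..<length xs}"]]) (auto simp: perms_to_def)

lemma perms_to_mset: "\<sigma> \<in> perms_to xs ys \<Longrightarrow> mset xs = mset ys"
  by (auto simp: perms_to_def)

lemma perms_to_length: "\<sigma> \<in> perms_to xs ys \<Longrightarrow> length xs = length ys"
  by (auto simp: perms_to_def)

lemma perms_to_bij: "\<sigma> \<in> perms_to xs ys \<Longrightarrow> bij \<sigma>"
  by (auto simp: perms_to_def permutes_bij)

lemma id_perms_to: "id \<in> perms_to xs xs"
  by (simp add: perms_to_def permutes_id)

lemma perms_to_comp: "\<sigma> \<in> perms_to xs ys \<Longrightarrow> \<tau> \<in> perms_to ys zs \<Longrightarrow> \<sigma> \<circ> \<tau> \<in> perms_to xs zs"
  by (auto simp: perms_to_def permute_list_compose permutes_compose)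

lemma perms_to_inv: "\<sigma> \<in> perms_to xs ys \<Longrightarrow> inv \<sigma> \<in> perms_to ys xs"
  by (auto simp: perms_to_def permutes_inv permutes_inv_o simp flip: permute_list_compose)

lemma perms_to_iff_inv:
  "\<sigma> permutes {..<length ys} \<and> permute_list (inv \<sigma>) ys = xs \<longleftrightarrow> \<sigma> \<in> perms_to xs ys"
proof
  assume "\<sigma> permutes {..<length ys} \<and> permute_list (inv \<sigma>) ys = xs"
  then have "inv \<sigma> \<in> perms_to ys xs" "inv (inv \<sigma>) = \<sigma>"
    by (auto simp: perms_to_def permutes_inv permutes_inv_inv)
  then show "\<sigma> \<in> perms_to xs ys"
    using perms_to_inv by metis
next
  assume "\<sigma> \<in> perms_to xs ys"
  then show "\<sigma> permutes {..<length ys} \<and> permute_list (inv \<sigma>) ys = xs"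
    using perms_to_inv[of \<sigma> xs ys] by (auto simp: perms_to_def)
qed

lemma perms_to_nonempty:
  assumes "mset xs = mset ys"
  shows "perms_to xs ys \<noteq> {}"
  using assms mset_eq_permutation[of ys xs] by (auto simp: perms_to_def)

text \<open>The isomorphisms from \<open>xs\<close> to \<open>ys\<close> form a torsor under the
  automorphisms of \<open>ys\<close>: composition with a fixed one is a bijection. This produces the
  factors that cancel the denominators in \<open>comult_coeff\<close>.\<close>

lemma card_perms_to:
  assumes "mset xs = mset ys"
  shows "card (perms_to xs ys) = card (perms_to ys ys)"
proof -
  obtain \<tau> where \<tau>: "\<tau> \<in> perms_to xs ys"
    using perms_to_nonempty[OF assms] by auto
  have "\<tau> \<circ> (inv \<tau> \<circ> \<rho>) = \<rho>" "inv \<tau> \<circ> (\<tau> \<circ> \<rho>) = \<rho>" for \<rho> :: "nat \<Rightarrow> nat"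
    using perms_to_bij[OF \<tau>] by (auto simp: fun_eq_iff bij_is_surj surj_f_inv_f bij_is_inj)
  then have "bij_betw (\<lambda>\<rho>. \<tau> \<circ> \<rho>) (perms_to ys ys) (perms_to xs ys)"
    using \<tau> perms_to_inv[OF \<tau>] perms_to_comp
    by (intro bij_betw_byWitness[where f' = "\<lambda>\<rho>. inv \<tau> \<circ> \<rho>"]) (auto intro: perms_to_comp)
  then show ?thesis
    by (simp add: bij_betw_same_card)
qed

lemma perms_to_map: "\<sigma> \<in> perms_to xs ys \<Longrightarrow> \<sigma> \<in> perms_to (map f xs) (map f ys)"
  by (auto simp: perms_to_def permute_list_map)

context
  fixes G :: "('o, 'o) gpd" and C :: "'o set"
  assumes G: "discrete_on G C"
begin

lemma Obj_Sr: "Obj (Sr G) = {xs. xs \<noteq> [] \<and> set xs \<subseteq> C}"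
  using G by (simp add: Sr_def discrete_on_def)

lemma Obj_Sr_mset:
  assumes "xs \<in> Obj (Sr G)" "mset ys = mset xs"
  shows "ys \<in> Obj (Sr G)"
  using assms mset_eq_setD[OF assms(2)] by (auto simp: Obj_Sr)

lemma hom_Sr: "g \<in> Arr (Sr G) \<and> Dom (Sr G) g = xs \<and> Cod (Sr G) g = ys \<longleftrightarrow>
    ys \<in> Obj (Sr G) \<and> (\<exists>\<sigma>\<in>perms_to xs ys. g = (\<sigma>, ys))"
proof -
  obtain \<sigma> fs where g: "g = (\<sigma>, fs)"
    by (cases g)
  have "map (Dom G) fs = fs \<and> map (Cod G) fs = fs" if "set fs \<subseteq> C"
    using G that by (auto simp: discrete_on_def intro!: map_idI)
  then show ?thesis
    using G unfolding Obj_Sr g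
    by (auto simp: Sr_def discrete_on_def perms_to_iff_inv[symmetric])
qed

lemma Cmp_Sr:
  assumes "set gs \<subseteq> C" "permute_list \<tau> fs = gs"
  shows "Cmp (Sr G) (\<tau>, gs) (\<sigma>, fs) = (\<sigma> \<circ> \<tau>, gs)"
  using G assms by (auto simp: Sr_def discrete_on_def subset_iff intro!: map2_idem)

lemma Aut_Sr: "xs \<in> Obj (Sr G) \<Longrightarrow> Aut (Sr G) xs = (\<lambda>\<sigma>. (\<sigma>, xs)) ` perms_to xs xs"
  unfolding Aut_def hom_Sr by auto

lemma card_Aut_Sr: "xs \<in> Obj (Sr G) \<Longrightarrow> card (Aut (Sr G) xs) = card (perms_to xs xs)"
  by (simp add: Aut_Sr card_image inj_on_def)

lemma finite_Aut_Sr: "xs \<in> Obj (Sr G) \<Longrightarrow> finite (Aut (Sr G) xs)"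
  by (simp add: Aut_Sr finite_perms_to)

lemma cls_Sr:
  assumes "xs \<in> Obj (Sr G)"
  shows "cls (Sr G) xs = {ys. mset ys = mset xs}"
proof -
  have "(\<exists>g\<in>Arr (Sr G). Dom (Sr G) g = xs \<and> Cod (Sr G) g = ys) \<longleftrightarrow>
      ys \<in> Obj (Sr G) \<and> perms_to xs ys \<noteq> {}" for ys
    using hom_Sr[of _ xs ys] by (metis ex_in_conv)
  moreover have "perms_to xs ys \<noteq> {} \<longleftrightarrow> mset ys = mset xs" for ys
    using perms_to_nonempty[of xs ys] perms_to_mset[of _ xs ys] by auto
  ultimately show ?thesis
    using assms Obj_Sr_mset[OF assms] by (auto simp: cls_def iso_rel_def)
qed

lemma pi0_Sr: "pi0 (Sr G) = cls (Sr G) ` Obj (Sr G)"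
  by (auto simp: pi0_def cls_def quotient_def)

lemma rep_Sr:
  assumes "c \<in> pi0 (Sr G)"
  shows "rep c \<in> Obj (Sr G)" "c = {ys. mset ys = mset (rep c)}"
proof -
  obtain xs where xs: "xs \<in> Obj (Sr G)" "c = {ys. mset ys = mset xs}"
    using assms cls_Sr by (auto simp: pi0_Sr)
  then have m: "mset (rep c) = mset xs"
    unfolding rep_def by (metis (mono_tags, lifting) mem_Collect_eq someI_ex)
  then show "rep c \<in> Obj (Sr G)"
    using Obj_Sr_mset[OF xs(1)] by simp
  show "c = {ys. mset ys = mset (rep c)}"
    using xs(2) m by simp
qed

end

text \<open>With trivial automorphism groups every class has weight 1, so a complete isomorphism
  invariant \<open>N\<close> reduces the cardinality to a count of its values.\<close>

lemma hcard_invariant: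
  assumes iso: "\<And>x y. (x, y) \<in> iso_rel G \<longleftrightarrow> x \<in> Obj G \<and> y \<in> Obj G \<and> N x = N y"
    and Aut: "\<And>x. x \<in> Obj G \<Longrightarrow> card (Aut G x) = 1"
    and fin: "finite (N ` Obj G)"
  shows "hcard G = of_nat (card (N ` Obj G))" "finite_gpd G"
proof -
  define K where "K n = {x \<in> Obj G. N x = n}" for n
  have "iso_rel G `` {x} = K (N x)" if "x \<in> Obj G" for x
    using that iso by (auto simp: K_def)
  then have pi0: "pi0 G = K ` (N ` Obj G)"
    by (auto simp: pi0_def quotient_def)
  have "inj_on K (N ` Obj G)"
    by (auto simp: inj_on_def K_def)
  then have card: "card (pi0 G) = card (N ` Obj G)"
    by (simp add: pi0 card_image)
  have "rep c \<in> Obj G" if "c \<in> pi0 G" for c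
  proof -
    obtain x where "x \<in> Obj G" "c = K (N x)"
      using \<open>c \<in> pi0 G\<close> pi0 by auto
    then have "x \<in> c"
      by (simp add: K_def)
    then have "rep c \<in> c"
      unfolding rep_def by (rule someI)
    then show ?thesis
      using \<open>c = K (N x)\<close> by (simp add: K_def)
  qed
  then show "hcard G = of_nat (card (N ` Obj G))"
    by (simp add: hcard_def Aut card)
  show "finite_gpd G"
    using fin Aut by (auto simp: finite_gpd_def pi0 intro: card_ge_0_finite)
qed

section \<open>Homotopy fibres\<close>

lemma hfib_Obj: "(x, \<phi>) \<in> Obj (hfib G H F b) \<longleftrightarrow>
    x \<in> Obj G \<and> (\<phi> \<in> Arr H \<and> Dom H \<phi> = onO F x \<and> Cod H \<phi> = b)"
  by (simp add: hfib_def)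

text \<open>The conditions on \<open>g\<close> stay together as one hom condition, so that
  \<open>hom_Sr\<close> or \<open>gprod_hom\<close> can rewrite them as a whole.\<close>

lemma hfib_Arr: "(p, g, q) \<in> Arr (hfib G H F b) \<longleftrightarrow>
    p \<in> Obj (hfib G H F b) \<and> q \<in> Obj (hfib G H F b) \<and> (g \<in> Arr G \<and> Dom G g = fst p \<and> Cod G g = fst q) \<and>
    Cmp H (snd q) (onA F g) = snd p"
  by (cases p; cases q) (auto simp: hfib_def Let_def)

lemma hfib_Dom: "Dom (hfib G H F b) g = fst g" and hfib_Cod: "Cod (hfib G H F b) g = snd (snd g)"
  by (auto simp: hfib_def split_def)

lemma hfib_iso_rel: "(p, q) \<in> iso_rel (hfib G H F b) \<longleftrightarrow> (\<exists>g. (p, g, q) \<in> Arr (hfib G H F b))"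
proof
  assume "(p, q) \<in> iso_rel (hfib G H F b)"
  then obtain h where "h \<in> Arr (hfib G H F b)" "fst h = p" "snd (snd h) = q"
    by (auto simp: iso_rel_def hfib_Dom hfib_Cod)
  then show "\<exists>g. (p, g, q) \<in> Arr (hfib G H F b)"
    by (cases h) auto
next
  assume "\<exists>g. (p, g, q) \<in> Arr (hfib G H F b)"
  then obtain g where g: "(p, g, q) \<in> Arr (hfib G H F b)"
    by blast
  then have "p \<in> Obj (hfib G H F b)" "q \<in> Obj (hfib G H F b)"
    by (auto simp: hfib_Arr)
  then show "(p, q) \<in> iso_rel (hfib G H F b)"
    using g by (auto simp: iso_rel_def hfib_Dom hfib_Cod intro!: bexI[of _ "(p, g, q)"])
qed

lemma hfib_Aut: "Aut (hfib G H F b) p = (\<lambda>g. (p, g, p)) ` {g. (p, g, p) \<in> Arr (hfib G H F b)}"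
  by (auto simp: Aut_def hfib_Dom hfib_Cod)

lemma card_hfib_Aut: "card (Aut (hfib G H F b) p) = card {g. (p, g, p) \<in> Arr (hfib G H F b)}"
  by (simp add: hfib_Aut card_image inj_on_def)

lemma gprod_hom: "(g \<in> Arr (gprod G H) \<and> Dom (gprod G H) g = x \<and> Cod (gprod G H) g = y) \<longleftrightarrow>
    (fst g \<in> Arr G \<and> Dom G (fst g) = fst x \<and> Cod G (fst g) = fst y) \<and>
    (snd g \<in> Arr H \<and> Dom H (snd g) = snd x \<and> Cod H (snd g) = snd y)"
  by (cases g; cases x; cases y) (auto simp: gprod_def)

lemma bij_comp_inv: "bij \<sigma> \<Longrightarrow> \<sigma> \<circ> inv \<sigma> = id" "bij \<sigma> \<Longrightarrow> inv \<sigma> \<circ> \<sigma> = id"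
  by (auto simp: bij_is_surj surj_iff[symmetric] bij_is_inj)

lemma comp_right_cancel:
  assumes "bij \<sigma>"
  shows "\<rho> \<circ> \<sigma> = \<tau> \<longleftrightarrow> \<rho> = \<tau> \<circ> inv \<sigma>"
  using bij_comp_inv[OF assms] by (metis comp_assoc comp_id)

lemma comp_left_cancel:
  assumes "bij \<sigma>"
  shows "\<sigma> \<circ> \<rho> = \<tau> \<longleftrightarrow> \<rho> = inv \<sigma> \<circ> \<tau>"
  using bij_comp_inv[OF assms] by (metis comp_assoc id_comp)

context
  fixes G2 :: "('a, 'a) gpd" and C2 :: "'a set" and G1 :: "('b, 'b) gpd" and C1 :: "'b set"
    and d :: "'a \<Rightarrow> 'b" and f :: "'b list"
  assumes G2: "discrete_on G2 C2" and G1: "discrete_on G1 C1" and f: "f \<in> Obj (Sr G1)"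
begin

text \<open>Kept general in \<open>d\<close>, since it serves both for the inner face on 2-simplices
  and for the degeneracy in the counit.\<close>

abbreviation "fib \<equiv> hfib (Sr G2) (Sr G1) (Sr_map \<lparr>onO = d, onA = d\<rparr>) f"

lemma fib_Obj: "p \<in> Obj fib \<longleftrightarrow> (\<exists>T\<in>Obj (Sr G2). \<exists>\<sigma>\<in>perms_to (map d T) f. p = (T, (\<sigma>, f)))"
proof -
  obtain T \<phi> where p: "p = (T, \<phi>)"
    by (cases p)
  show ?thesis
    unfolding p hfib_Obj hom_Sr[OF G1] using f by (auto simp: Sr_map_def)
qed

lemma fib_Arr: "(p, g, q) \<in> Arr fib \<longleftrightarrow> p \<in> Obj fib \<and> q \<in> Obj fib \<and>
    (\<exists>\<rho>\<in>perms_to (fst p) (fst q). g = (\<rho>, fst q) \<and> \<rho> \<circ> fst (snd q) = fst (snd p))"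
proof (cases "p \<in> Obj fib \<and> q \<in> Obj fib")
  case True
  then obtain T1 \<sigma>1 T2 \<sigma>2 where pq: "p = (T1, (\<sigma>1, f))" "q = (T2, (\<sigma>2, f))"
      "T2 \<in> Obj (Sr G2)" "\<sigma>2 \<in> perms_to (map d T2) f"
    unfolding fib_Obj by auto
  have "set f \<subseteq> C1"
    using f by (simp add: Obj_Sr[OF G1])
  then have "Cmp (Sr G1) (\<sigma>2, f) (\<rho>, map d T2) = (\<rho> \<circ> \<sigma>2, f)" for \<rho>
    using Cmp_Sr[OF G1] pq(4) by (simp add: perms_to_def)
  then show ?thesis
    using True pq(3) unfolding hfib_Arr hom_Sr[OF G2] by (auto simp: pq Sr_map_def)
next
  case False
  then show ?thesis
    by (auto simp: hfib_Arr)
qed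

text \<open>Transport of \<open>(T, \<sigma>)\<close> along \<open>\<sigma>\<close> ends in a tuple
  strictly over \<open>f\<close>. The only candidate for an arrow between two objects is
  \<open>\<sigma>1 \<circ> inv \<sigma>2\<close>, so this tuple is a complete invariant and
  automorphisms are trivial: the homotopy fibre is as large as the strict one.\<close>

lemma fib_invariant:
  assumes fin: "finite {T \<in> Obj (Sr G2). map d T = f}"
  shows "hcard fib = of_nat (card {T \<in> Obj (Sr G2). map d T = f})" "finite_gpd fib"
proof -
  define N :: "'a list \<times> (nat \<Rightarrow> nat) \<times> 'b list \<Rightarrow> 'a list"
    where "N = (\<lambda>(T, (\<sigma>, _)). permute_list \<sigma> T)"
  have "(p, q) \<in> iso_rel fib \<longleftrightarrow> p \<in> Obj fib \<and> q \<in> Obj fib \<and> N p = N q" for p q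
  proof (cases "p \<in> Obj fib \<and> q \<in> Obj fib")
    case True
    then obtain T1 \<sigma>1 T2 \<sigma>2 where pq: "p = (T1, (\<sigma>1, f))" "q = (T2, (\<sigma>2, f))"
        "\<sigma>1 \<in> perms_to (map d T1) f" "\<sigma>2 \<in> perms_to (map d T2) f"
      unfolding fib_Obj by auto
    have s: "\<sigma>1 \<in> perms_to T1 (permute_list \<sigma>1 T1)" "\<sigma>2 \<in> perms_to T2 (permute_list \<sigma>2 T2)"
      using pq(3,4) by (auto simp: perms_to_def)
    have "(\<exists>\<rho>\<in>perms_to T1 T2. \<rho> \<circ> \<sigma>2 = \<sigma>1) \<longleftrightarrow> permute_list \<sigma>1 T1 = permute_list \<sigma>2 T2"
    proof
      assume "\<exists>\<rho>\<in>perms_to T1 T2. \<rho> \<circ> \<sigma>2 = \<sigma>1"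
      then show "permute_list \<sigma>1 T1 = permute_list \<sigma>2 T2"
        using s(2) perms_to_comp by (fastforce simp: perms_to_def)
    next
      assume eq: "permute_list \<sigma>1 T1 = permute_list \<sigma>2 T2"
      have "\<sigma>1 \<circ> inv \<sigma>2 \<in> perms_to T1 T2"
        using perms_to_comp s(1) perms_to_inv[OF s(2)] eq by metis
      then show "\<exists>\<rho>\<in>perms_to T1 T2. \<rho> \<circ> \<sigma>2 = \<sigma>1"
        using perms_to_bij[OF s(2)] comp_right_cancel by blast
    qed
    then show ?thesis
      using True unfolding hfib_iso_rel fib_Arr by (auto simp: pq N_def)
  next
    case False
    then show ?thesis
      by (auto simp: hfib_iso_rel fib_Arr)
  qed
  moreover have "card (Aut fib p) = 1" if p: "p \<in> Obj fib" for p
  proof -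
    obtain T \<sigma> where p': "p = (T, (\<sigma>, f))" "\<sigma> \<in> perms_to (map d T) f"
      using p unfolding fib_Obj by auto
    have "\<rho> \<circ> \<sigma> = \<sigma> \<longleftrightarrow> \<rho> = id" for \<rho>
      using perms_to_bij[OF p'(2)] by (simp add: comp_right_cancel bij_comp_inv)
    then have "{g. (p, g, p) \<in> Arr fib} = {(id, T)}"
      using p id_perms_to unfolding fib_Arr by (auto simp: p')
    then show ?thesis
      by (simp add: card_hfib_Aut)
  qed
  moreover have "N ` Obj fib = {T \<in> Obj (Sr G2). map d T = f}"
  proof (intro equalityI subsetI)
    fix T
    assume "T \<in> N ` Obj fib"
    then obtain p where "p \<in> Obj fib" "T = N p"
      by auto
    then obtain T0 \<sigma> where T0: "T0 \<in> Obj (Sr G2)" "\<sigma> \<in> perms_to (map d T0) f" "T = permute_list \<sigma> T0"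
      unfolding fib_Obj by (auto simp: N_def)
    then show "T \<in> {T \<in> Obj (Sr G2). map d T = f}"
      using perms_to_map Obj_Sr_mset[OF G2 T0(1)] by (auto simp: perms_to_def permute_list_map)
  next
    fix T
    assume "T \<in> {T \<in> Obj (Sr G2). map d T = f}"
    then show "T \<in> N ` Obj fib"
      by (intro image_eqI[where x = "(T, (id, f))"]) (auto simp: fib_Obj N_def id_perms_to)
  qed
  ultimately show "hcard fib = of_nat (card {T \<in> Obj (Sr G2). map d T = f})" "finite_gpd fib"
    using hcard_invariant[of fib N] fin by auto
qed

context
  fixes ab :: "'a \<Rightarrow> 'b list" and d0 :: "'a \<Rightarrow> 'b" and a b :: "'b list"
  assumes a: "a \<in> Obj (Sr G1)" and b: "b \<in> Obj (Sr G1)"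
begin

abbreviation "flatten \<equiv> ftor_comp Sr_mult (ftor_comp (Sr_map Mr_Sr) (Sr_map \<lparr>onO = ab, onA = ab\<rparr>))"

abbreviation "dfib \<equiv> hfib fib (gprod (Sr G1) (Sr G1))
  (ftor_comp (ftor_pair flatten (Sr_map \<lparr>onO = d0, onA = d0\<rparr>)) hfib_proj) (a, b)"

lemma dfib_Obj: "p \<in> Obj dfib \<longleftrightarrow>
    (\<exists>T\<in>Obj (Sr G2). \<exists>\<sigma>\<in>perms_to (map d T) f. \<exists>\<alpha>\<in>perms_to (concat (map ab T)) a. \<exists>\<beta>\<in>perms_to (map d0 T) b.
      p = ((T, (\<sigma>, f)), ((\<alpha>, a), (\<beta>, b))))"
proof -
  obtain u \<alpha> \<beta> where p: "p = (u, (\<alpha>, \<beta>))"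
    by (metis surj_pair)
  have "p \<in> Obj dfib \<longleftrightarrow> u \<in> Obj fib \<and>
      (\<exists>\<alpha>'\<in>perms_to (concat (map ab (fst u))) a. \<alpha> = (\<alpha>', a)) \<and> (\<exists>\<beta>'\<in>perms_to (map d0 (fst u)) b. \<beta> = (\<beta>', b))"
    unfolding p hfib_Obj[of u] gprod_hom hom_Sr[OF G1] using a b
    by (auto simp: ftor_comp_def ftor_pair_def hfib_proj_def Sr_mult_def Sr_map_def Mr_Sr_def comp_def)
  then show ?thesis
    unfolding p fib_Obj by auto
qed

text \<open>An arrow is a single permutation \<open>\<rho>\<close> of trees. It acts by itself on
  the components over \<open>f\<close> and \<open>b\<close>, but through a permutation of blocks on
  the component over \<open>a\<close>, because the last face flattens.\<close>

lemma dfib_Arr: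
  assumes p: "p = ((T1, (\<sigma>1, f)), ((\<alpha>1, a), (\<beta>1, b)))" "p \<in> Obj dfib"
    and q: "q = ((T2, (\<sigma>2, f)), ((\<alpha>2, a), (\<beta>2, b)))" "q \<in> Obj dfib"
  shows "(p, g, q) \<in> Arr dfib \<longleftrightarrow>
    (\<exists>\<rho>\<in>perms_to T1 T2. g = (fst p, (\<rho>, T2), fst q) \<and> \<rho> \<circ> \<sigma>2 = \<sigma>1 \<and>
      shuffle_blocks \<rho> (map ab T1) \<circ> \<alpha>2 = \<alpha>1 \<and> \<rho> \<circ> \<beta>2 = \<beta>1)"
proof -
  obtain u h v where g: "g = (u, h, v)"
    by (metis surj_pair)
  have \<alpha>2: "permute_list \<alpha>2 (concat (map ab T2)) = a" and \<beta>2: "permute_list \<beta>2 (map d0 T2) = b"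
    and fp: "fst p \<in> Obj fib" and fq: "fst q \<in> Obj fib"
    using p q unfolding dfib_Obj fib_Obj by (auto simp: perms_to_def)
  have set: "set a \<subseteq> C1" "set b \<subseteq> C1"
    using a b by (auto simp: Obj_Sr[OF G1])
  have cmp: "Cmp (gprod (Sr G1) (Sr G1)) (snd q)
      (onA (ftor_comp (ftor_pair flatten (Sr_map \<lparr>onO = d0, onA = d0\<rparr>)) hfib_proj) (u, (\<rho>, T2), v)) =
      ((shuffle_blocks \<rho> (map ab T1) \<circ> \<alpha>2, a), (\<rho> \<circ> \<beta>2, b))" if "\<rho> \<in> perms_to T1 T2" for \<rho>
  proof -
    have "map ab T2 = permute_list \<rho> (map ab T1)"
      using perms_to_map[OF that, of ab] by (simp add: perms_to_def)
    \<comment> \<open>\<open>Mr_Sr\<close> equips every block with the identity permutation, so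
      flattening yields a pure shuffle of blocks.\<close>
    then have "block_perm \<rho> (map (\<lambda>x. (id, x)) (map ab T2)) = shuffle_blocks \<rho> (map ab T1)"
      by (simp add: shuffle_blocks_def)
    then show ?thesis
      using Cmp_Sr[OF G1 set(1) \<alpha>2] Cmp_Sr[OF G1 set(2) \<beta>2]
      by (simp add: q gprod_def ftor_comp_def ftor_pair_def hfib_proj_def Sr_mult_def Sr_map_def Mr_Sr_def comp_def)
  qed
  have "(p, g, q) \<in> Arr dfib \<longleftrightarrow> (u, h, v) \<in> Arr fib \<and> u = fst p \<and> v = fst q \<and>
      Cmp (gprod (Sr G1) (Sr G1)) (snd q)
      (onA (ftor_comp (ftor_pair flatten (Sr_map \<lparr>onO = d0, onA = d0\<rparr>)) hfib_proj) (u, h, v)) = snd p"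
    unfolding hfib_Arr[of p] g using p(2) q(2) by (auto simp: hfib_Dom hfib_Cod)
  also have "\<dots> \<longleftrightarrow> (\<exists>\<rho>\<in>perms_to T1 T2. g = (fst p, (\<rho>, T2), fst q) \<and> \<rho> \<circ> \<sigma>2 = \<sigma>1 \<and>
      shuffle_blocks \<rho> (map ab T1) \<circ> \<alpha>2 = \<alpha>1 \<and> \<rho> \<circ> \<beta>2 = \<beta>1)"
    unfolding fib_Arr g using fp fq cmp by (auto simp: p(1) q(1))
  finally show ?thesis .
qed

text \<open>The triples are the data of \<open>p\<close> and \<open>q\<close> after transport along
  \<open>\<sigma>1\<close> and \<open>\<sigma>2\<close>, which makes the comparison with
  \<open>f\<close> the identity. Two objects are isomorphic exactly if these normal forms
  agree.\<close>

lemma dfib_iso_rel: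
  assumes p: "p = ((T1, (\<sigma>1, f)), ((\<alpha>1, a), (\<beta>1, b)))" "p \<in> Obj dfib"
    and q: "q = ((T2, (\<sigma>2, f)), ((\<alpha>2, a), (\<beta>2, b)))" "q \<in> Obj dfib"
  shows "(p, q) \<in> iso_rel dfib \<longleftrightarrow>
    (permute_list \<sigma>1 T1, inv (shuffle_blocks \<sigma>1 (map ab T1)) \<circ> \<alpha>1, inv \<sigma>1 \<circ> \<beta>1) =
    (permute_list \<sigma>2 T2, inv (shuffle_blocks \<sigma>2 (map ab T2)) \<circ> \<alpha>2, inv \<sigma>2 \<circ> \<beta>2)"
proof -
  let ?B1 = "shuffle_blocks \<sigma>1 (map ab T1)" and ?B2 = "shuffle_blocks \<sigma>2 (map ab T2)"
  have s: "\<sigma>1 \<in> perms_to T1 (permute_list \<sigma>1 T1)" "\<sigma>2 \<in> perms_to T2 (permute_list \<sigma>2 T2)"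
    using p q unfolding dfib_Obj by (auto simp: perms_to_def)
  have bij: "bij \<sigma>1" "bij \<sigma>2"
    using s by (auto dest: perms_to_bij)
  have perm: "\<sigma>1 permutes {..<length (map ab T1)}" "\<sigma>2 permutes {..<length (map ab T2)}"
    using s by (auto simp: perms_to_def)
  have bijB: "bij ?B1" "bij ?B2"
    using shuffle_blocks_permutes[OF perm(1)] shuffle_blocks_permutes[OF perm(2)]
    by (auto intro: permutes_bij)
  \<comment> \<open>Functoriality of block shuffles enters here: \<open>\<rho>\<close> followed
    through \<open>\<sigma>2\<close> is \<open>\<sigma>1\<close>, so its shuffle is the quotient of
    the two known ones.\<close>
  have B: "shuffle_blocks \<rho> (map ab T1) = ?B1 \<circ> inv ?B2"
    if "\<rho> \<in> perms_to T1 T2" "\<rho> \<circ> \<sigma>2 = \<sigma>1" for \<rho>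
  proof -
    have "\<rho> permutes {..<length (map ab T1)}" "permute_list \<rho> (map ab T1) = map ab T2"
      using perms_to_map[OF that(1), of ab] by (auto simp: perms_to_def)
    moreover have "\<sigma>2 permutes {..<length (map ab T1)}"
      using perm(2) perms_to_length[OF that(1)] by simp
    ultimately show ?thesis
      using shuffle_blocks_comp[of \<rho> "map ab T1" \<sigma>2] that(2)
      by (simp add: comp_assoc bij_comp_inv[OF bijB(2)])
  qed
  have "(p, q) \<in> iso_rel dfib \<longleftrightarrow> (\<exists>\<rho>\<in>perms_to T1 T2. \<rho> \<circ> \<sigma>2 = \<sigma>1 \<and>
      shuffle_blocks \<rho> (map ab T1) \<circ> \<alpha>2 = \<alpha>1 \<and> \<rho> \<circ> \<beta>2 = \<beta>1)"
    unfolding hfib_iso_rel dfib_Arr[OF p q] by blast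
  also have "\<dots> \<longleftrightarrow> \<sigma>1 \<circ> inv \<sigma>2 \<in> perms_to T1 T2 \<and>
      ?B1 \<circ> (inv ?B2 \<circ> \<alpha>2) = \<alpha>1 \<and> \<sigma>1 \<circ> (inv \<sigma>2 \<circ> \<beta>2) = \<beta>1"
  proof -
    let ?\<rho> = "\<sigma>1 \<circ> inv \<sigma>2"
    have R: "\<rho> \<circ> \<sigma>2 = \<sigma>1 \<longleftrightarrow> \<rho> = ?\<rho>" for \<rho>
      by (rule comp_right_cancel[OF bij(2)])
    have "shuffle_blocks ?\<rho> (map ab T1) = ?B1 \<circ> inv ?B2" if "?\<rho> \<in> perms_to T1 T2"
      using B[OF that] R by blast
    then show ?thesis
      unfolding R by (auto simp: comp_assoc)
  qed
  also have "\<sigma>1 \<circ> inv \<sigma>2 \<in> perms_to T1 T2 \<longleftrightarrow> permute_list \<sigma>1 T1 = permute_list \<sigma>2 T2"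
  proof
    assume "\<sigma>1 \<circ> inv \<sigma>2 \<in> perms_to T1 T2"
    then have "(\<sigma>1 \<circ> inv \<sigma>2) \<circ> \<sigma>2 \<in> perms_to T1 (permute_list \<sigma>2 T2)"
      using s(2) by (rule perms_to_comp)
    then have "\<sigma>1 \<in> perms_to T1 (permute_list \<sigma>2 T2)"
      by (simp add: comp_assoc bij_comp_inv[OF bij(2)])
    then show "permute_list \<sigma>1 T1 = permute_list \<sigma>2 T2"
      by (simp add: perms_to_def)
  next
    assume "permute_list \<sigma>1 T1 = permute_list \<sigma>2 T2"
    then show "\<sigma>1 \<circ> inv \<sigma>2 \<in> perms_to T1 T2"
      using s(1) perms_to_inv[OF s(2)] by (auto intro: perms_to_comp)
  qed
  finally show ?thesis
    unfolding comp_left_cancel[OF bijB(1)] comp_left_cancel[OF bij(1)] prod.inject by metis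
qed

lemma card_dfib_Aut:
  assumes p: "p \<in> Obj dfib"
  shows "card (Aut dfib p) = 1"
proof -
  obtain T \<sigma> \<alpha> \<beta> where p': "p = ((T, (\<sigma>, f)), ((\<alpha>, a), (\<beta>, b)))" "\<sigma> \<in> perms_to (map d T) f"
    using p unfolding dfib_Obj by auto
  have "\<rho> \<circ> \<sigma> = \<sigma> \<longleftrightarrow> \<rho> = id" for \<rho>
    using perms_to_bij[OF p'(2)] by (simp add: comp_right_cancel bij_comp_inv)
  \<comment> \<open>Reflexivity supplies an arrow from \<open>p\<close> to itself. Its permutation
    must be the identity, so the conditions for the identity hold without computing the shuffle by
    \<open>id\<close>.\<close>
  moreover have "(p, p) \<in> iso_rel dfib"
    by (simp add: dfib_iso_rel[OF p'(1) p p'(1) p])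
  ultimately have "{g. (p, g, p) \<in> Arr dfib} = {(fst p, (id, T), fst p)}"
    unfolding hfib_iso_rel dfib_Arr[OF p'(1) p p'(1) p] by auto
  then show ?thesis
    by (simp add: card_hfib_Aut)
qed

text \<open>The normal forms are all triples of a strict tuple \<open>T\<close> over
  \<open>f\<close> and arbitrary isomorphisms from its two outer faces to \<open>a\<close> and
  \<open>b\<close>, so the cardinality is a sum of products of hom sets.\<close>

lemma dfib_counting:
  fixes S :: "'a list set"
  defines "S \<equiv> {T \<in> Obj (Sr G2). map d T = f}"
  assumes fin: "finite S"
  shows "hcard dfib = of_nat (\<Sum>T\<in>S. card (perms_to (concat (map ab T)) a) * card (perms_to (map d0 T) b))"
    and "finite_gpd dfib"
    and "Obj dfib \<noteq> {} \<Longrightarrow> \<exists>T\<in>S. mset (concat (map ab T)) = mset a \<and> mset (map d0 T) = mset b"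
proof -
  define N :: "('a list \<times> (nat \<Rightarrow> nat) \<times> 'b list) \<times> ((nat \<Rightarrow> nat) \<times> 'b list) \<times> ((nat \<Rightarrow> nat) \<times> 'b list)
      \<Rightarrow> 'a list \<times> (nat \<Rightarrow> nat) \<times> (nat \<Rightarrow> nat)"
    where "N = (\<lambda>((T, (\<sigma>, _)), ((\<alpha>, _), (\<beta>, _))).
      (permute_list \<sigma> T, inv (shuffle_blocks \<sigma> (map ab T)) \<circ> \<alpha>, inv \<sigma> \<circ> \<beta>))"
  let ?I = "SIGMA T : S. perms_to (concat (map ab T)) a \<times> perms_to (map d0 T) b"
  have iso: "(p, q) \<in> iso_rel dfib \<longleftrightarrow> p \<in> Obj dfib \<and> q \<in> Obj dfib \<and> N p = N q" for p q
  proof (cases "p \<in> Obj dfib \<and> q \<in> Obj dfib")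
    case True
    then obtain T1 \<sigma>1 \<alpha>1 \<beta>1 T2 \<sigma>2 \<alpha>2 \<beta>2 where
        pq: "p = ((T1, (\<sigma>1, f)), ((\<alpha>1, a), (\<beta>1, b)))" "q = ((T2, (\<sigma>2, f)), ((\<alpha>2, a), (\<beta>2, b)))"
      unfolding dfib_Obj by blast
    show ?thesis
      using True dfib_iso_rel[OF pq(1) _ pq(2)] by (simp add: N_def pq)
  next
    case False
    then show ?thesis
      by (auto simp: iso_rel_def)
  qed
  have N_in: "N p \<in> ?I" if "p \<in> Obj dfib" for p
  proof -
    obtain T \<sigma> \<alpha> \<beta> where p: "p = ((T, (\<sigma>, f)), ((\<alpha>, a), (\<beta>, b)))" and T: "T \<in> Obj (Sr G2)"
        and \<sigma>: "\<sigma> \<in> perms_to (map d T) f" and \<alpha>: "\<alpha> \<in> perms_to (concat (map ab T)) a"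
        and \<beta>: "\<beta> \<in> perms_to (map d0 T) b"
      using \<open>p \<in> Obj dfib\<close> unfolding dfib_Obj by blast
    let ?T = "permute_list \<sigma> T"
    have s: "\<sigma> \<in> perms_to T ?T"
      using \<sigma> by (simp add: perms_to_def)
    have "map d ?T = f"
      using perms_to_map[OF s, of d] \<sigma> by (simp add: perms_to_def)
    moreover have "?T \<in> Obj (Sr G2)"
      by (rule Obj_Sr_mset[OF G2 T perms_to_mset[OF s, symmetric]])
    ultimately have "?T \<in> S"
      by (simp add: S_def)
    moreover have "shuffle_blocks \<sigma> (map ab T) \<in> perms_to (concat (map ab T)) (concat (map ab ?T))"
      using shuffle_blocks_permutes[of \<sigma> "map ab T"] permute_list_shuffle_blocks[of \<sigma> "map ab T"]
        perms_to_map[OF s, of ab] by (simp add: perms_to_def)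
    then have "inv (shuffle_blocks \<sigma> (map ab T)) \<circ> \<alpha> \<in> perms_to (concat (map ab ?T)) a"
      using \<alpha> by (auto intro: perms_to_comp perms_to_inv)
    moreover have "inv \<sigma> \<circ> \<beta> \<in> perms_to (map d0 ?T) b"
      using \<beta> perms_to_map[OF s, of d0] by (auto intro: perms_to_comp perms_to_inv)
    ultimately show ?thesis
      by (simp add: N_def p)
  qed
  have "N ` Obj dfib = ?I"
  proof (intro equalityI subsetI)
    fix x
    assume "x \<in> ?I"
    then obtain T \<alpha> \<beta> where x: "x = (T, \<alpha>, \<beta>)" "T \<in> S" "\<alpha> \<in> perms_to (concat (map ab T)) a"
        "\<beta> \<in> perms_to (map d0 T) b"
      by auto
    let ?B = "shuffle_blocks id (map ab T)"
    have perm: "id permutes {..<length (map ab T)}"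
      by (rule permutes_id)
    have "bij ?B"
      using shuffle_blocks_permutes[OF perm] by (rule permutes_bij)
    \<comment> \<open>A bijection that is idempotent is the identity. This gives the shuffle by
      \<open>id\<close>, so every triple is the normal form of the object with
      \<open>\<sigma> = id\<close>.\<close>
    moreover have "?B \<circ> ?B = ?B"
      using shuffle_blocks_comp[OF perm perm] by simp
    ultimately have "?B = id"
      using comp_right_cancel[of ?B ?B ?B] bij_comp_inv(1)[of ?B] by simp
    then have "N ((T, (id, f)), ((\<alpha>, a), (\<beta>, b))) = x"
      by (simp add: N_def x)
    moreover have "((T, (id, f)), ((\<alpha>, a), (\<beta>, b))) \<in> Obj dfib"
      using x id_perms_to unfolding dfib_Obj by (auto simp: S_def)
    ultimately show "x \<in> N ` Obj dfib"
      by (metis image_eqI)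
  qed (use N_in in blast)
  moreover have "finite ?I"
    using fin by (simp add: finite_perms_to)
  moreover have "card ?I = (\<Sum>T\<in>S. card (perms_to (concat (map ab T)) a) * card (perms_to (map d0 T) b))"
    using fin by (simp add: finite_perms_to card_cartesian_product)
  ultimately show "hcard dfib = of_nat (\<Sum>T\<in>S. card (perms_to (concat (map ab T)) a) * card (perms_to (map d0 T) b))"
      "finite_gpd dfib"
    using hcard_invariant[of dfib N] iso card_dfib_Aut by auto
  show "\<exists>T\<in>S. mset (concat (map ab T)) = mset a \<and> mset (map d0 T) = mset b" if ne: "Obj dfib \<noteq> {}"
  proof -
    obtain p where "p \<in> Obj dfib"
      using ne by blast
    from N_in[OF this] show ?thesis
      by (auto dest!: perms_to_mset)
  qed
qed

end

end

section \<open>The bar construction\<close>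

abbreviation "bar_Ass2 \<equiv> bar_Sr Ass2"

abbreviation "lev n \<equiv> Qn Ass2 n"

definition op_levels :: "(two, opn) level set" where
  "op_levels = Op ` {q. fst q \<noteq> []}"

definition tree_levels :: "(two, opn) level set" where
  "tree_levels = {Tree (map Op h) q | h q. h \<in> forests \<and> fst q \<noteq> [] \<and> roots h = fst q}"

lemma discrete_on_operations: "discrete_on (operations Ass2) {q. fst q \<noteq> []}"
proof -
  have "{q :: opn. fst q \<noteq> []} = {xs. xs \<noteq> [] \<and> set xs \<subseteq> UNIV} \<times> (UNIV :: two set)"
    by auto
  moreover have "discrete_on (operations Ass2) ({xs. xs \<noteq> [] \<and> set xs \<subseteq> UNIV} \<times> UNIV)"
    by (simp only: Ass2_def Let_def operad.simps)
      (intro discrete_on_gprod discrete_on_Mr discrete_on_discrete)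
  ultimately show ?thesis
    by (simp only:)
qed

lemma discrete_on_Q0: "discrete_on (lev 0) (range Col)"
  using discrete_on_relabel[OF discrete_on_discrete, of Col UNIV] by (simp add: Ass2_def Let_def inj_def)

lemma discrete_on_Q1: "discrete_on (lev 1) op_levels"
  using discrete_on_relabel[OF discrete_on_operations, of Op] by (simp add: op_levels_def inj_def)

lemma discrete_on_Q2: "discrete_on (lev 2) tree_levels"
proof -
  let ?t = "\<lambda>(ts, q). Tree ts q"
  let ?P = "{(ts, q). ts \<in> {ts. ts \<noteq> [] \<and> set ts \<subseteq> op_levels} \<and> q \<in> {q. fst q \<noteq> []} \<and>
    onO (Mr_map (output_level Ass2)) ts = onO (inputs Ass2) q}"
  have "discrete_on (lev 2) (?t ` ?P)"
    unfolding numeral_2_eq_2 Qn.simps(3)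
    by (intro discrete_on_relabel discrete_on_pullback discrete_on_Mr discrete_on_Q1[unfolded One_nat_def]
        discrete_on_operations) (auto simp: inj_def Mr_map_def output_level_def Ass2_def Let_def)
  moreover have "?t ` ?P = tree_levels"
  proof (intro equalityI subsetI)
    fix x
    assume "x \<in> ?t ` ?P"
    then obtain ts q where x: "x = Tree ts q" "set ts \<subseteq> op_levels" "fst q \<noteq> []" "map (out_col snd) ts = fst q"
      by (auto simp: Mr_map_def output_level_def Ass2_def Let_def)
    define h where "h = map root_op ts"
    have "ts = map Op h"
      using x(2) by (auto simp: h_def op_levels_def comp_def intro!: map_idI[symmetric])
    moreover from this have "h \<in> forests" "roots h = fst q"
      using x by (auto simp: forests_def op_levels_def roots_def comp_def)
    ultimately show "x \<in> tree_levels"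
      using x(1,3) unfolding tree_levels_def mem_Collect_eq
      by (intro exI[of _ h] exI[of _ q]) simp
  next
    fix x
    assume "x \<in> tree_levels"
    then obtain h q where x: "x = Tree (map Op h) q" "h \<in> forests" "fst q \<noteq> []" "roots h = fst q"
      by (auto simp: tree_levels_def)
    moreover from this have "h \<noteq> []"
      by auto
    ultimately show "x \<in> ?t ` ?P"
      by (intro image_eqI[where x = "(map Op h, q)"])
        (auto simp: forests_def op_levels_def roots_def comp_def Mr_map_def output_level_def Ass2_def Let_def)
  qed
  ultimately show ?thesis
    by simp
qed

text \<open>On single trees, \<open>contract\<close>, \<open>root_level\<close> and
  \<open>top_level\<close> underlie the faces 1, 0 and 2 of 2-simplices, and
  \<open>unit_level\<close> underlies the degeneracy of 0-simplices. The object parts suffice, since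
  the arrow parts are the same functions by \<open>Ass2_arrows\<close>.\<close>

definition contract :: "(two, opn) level \<Rightarrow> (two, opn) level" where
  "contract = level_face (onO (inputs Ass2)) (onO (root_colour Ass2)) (onO (compose Ass2)) 2 1"

definition root_level :: "(two, opn) level \<Rightarrow> (two, opn) level" where
  "root_level = level_face (onO (inputs Ass2)) (onO (root_colour Ass2)) (onO (compose Ass2)) 2 0"

definition top_level :: "(two, opn) level \<Rightarrow> (two, opn) level list" where
  "top_level = above (onO (inputs Ass2))"

definition unit_level :: "(two, opn) level \<Rightarrow> (two, opn) level" where
  "unit_level = level_degen (onO (inputs Ass2)) (onO (root_colour Ass2)) (onO (unit_op Ass2)) 0 0"

lemma level_simps [simp]:
  "contract (Tree (map Op h) q) = Op (leaves h, snd q)"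
  "root_level (Tree ts q) = Op q"
  "top_level (Tree ts q) = ts"
  "unit_level (Col c) = Op ([c], c)"
  by (simp_all add: contract_def root_level_def top_level_def unit_level_def Ass2_def Let_def numeral_2_eq_2
      leaves_def comp_def)

lemma Ass2_arrows:
  "onA (inputs Ass2) = onO (inputs Ass2)" "onA (root_colour Ass2) = onO (root_colour Ass2)"
  "onA (compose Ass2) = onO (compose Ass2)" "onA (unit_op Ass2) = onO (unit_op Ass2)"
  by (simp_all add: Ass2_def Let_def)

lemma simplices_bar: "simplices bar_Ass2 n = Sr (lev n)"
  by (simp add: bar_Sr_def)

lemma Phi_eq: "Phi bar_Ass2 f a b = dfib (lev 2) (lev 1) contract f top_level root_level a b"
  by (simp add: Phi_def bar_Sr_def Ass2_arrows contract_def root_level_def top_level_def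
      del: Qn.simps One_nat_def)

lemma counit_fibre_eq: "counit_fibre bar_Ass2 f = fib (lev 0) (lev 1) unit_level f"
  by (simp add: counit_fibre_def bar_Sr_def Ass2_arrows unit_level_def del: Qn.simps One_nat_def)

lemma Obj_bar1: "Obj (Sr (lev 1)) = map Op ` (forests - {[]})"
proof -
  have "x \<in> map Op ` (forests - {[]})" if "x \<noteq> []" "set x \<subseteq> op_levels" for x
  proof (rule image_eqI)
    show "x = map Op (map root_op x)"
      using that(2) by (auto simp: op_levels_def comp_def intro!: map_idI[symmetric])
    show "map root_op x \<in> forests - {[]}"
      using that by (auto simp: op_levels_def forests_def)
  qed
  moreover have "set (map Op h) \<subseteq> op_levels" if "h \<in> forests" for h
    using that by (force simp: op_levels_def forests_def)
  ultimately show ?thesis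
    unfolding Obj_Sr[OF discrete_on_Q1] by fastforce
qed

section \<open>Lists of two-level trees as factorisations\<close>

definition tops :: "(two, opn) level list \<Rightarrow> opn list" where
  "tops T = map root_op (concat (map top_level T))"

definition root_ops :: "(two, opn) level list \<Rightarrow> opn list" where
  "root_ops T = map root_op T"

text \<open>Recovers the trees from their two levels: the arities of the root operations cut
  \<open>h\<close> into the blocks to be placed above them.\<close>

fun build :: "opn list \<Rightarrow> opn list \<Rightarrow> (two, opn) level list" where
  "build h [] = []"
| "build h (q # g) = Tree (map Op (take (length (fst q)) h)) q # build (drop (length (fst q)) h) g"

text \<open>A list of two-level trees is a composable pair of forests, with contraction as
  composition and the outer faces as the two factors.\<close>

lemma trees_tops:
  assumes "set T \<subseteq> tree_levels"
  shows "tops T \<in> forests" "root_ops T \<in> forests" "roots (tops T) = leaves (root_ops T)"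
    and "map contract T = map Op (graft (root_ops T) (tops T))" "build (tops T) (root_ops T) = T"
    and "concat (map top_level T) = map Op (tops T)" "map root_level T = map Op (root_ops T)"
proof -
  have "tops T \<in> forests \<and> root_ops T \<in> forests \<and> roots (tops T) = leaves (root_ops T) \<and>
      map contract T = map Op (graft (root_ops T) (tops T)) \<and> build (tops T) (root_ops T) = T \<and>
      concat (map top_level T) = map Op (tops T) \<and> map root_level T = map Op (root_ops T)"
    using assms
  proof (induction T)
    case (Cons t T)
    then obtain h q where t: "t = Tree (map Op h) q" "h \<in> forests" "fst q \<noteq> []" "roots h = fst q"
      by (auto simp: tree_levels_def)
    have len: "length (fst q) = length h"
      using t(4) by (metis roots_simps(6))
    have "tops (t # T) = h @ tops T" "root_ops (t # T) = q # root_ops T"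
      by (simp_all add: tops_def root_ops_def t comp_def)
    then show ?case
      using Cons t len by (auto simp: comp_def)
  qed (simp add: tops_def root_ops_def)
  then show "tops T \<in> forests" "root_ops T \<in> forests" "roots (tops T) = leaves (root_ops T)"
    and "map contract T = map Op (graft (root_ops T) (tops T))" "build (tops T) (root_ops T) = T"
    and "concat (map top_level T) = map Op (tops T)" "map root_level T = map Op (root_ops T)"
    by auto
qed

lemma build_trees:
  assumes "h \<in> forests" "g \<in> forests" "roots h = leaves g"
  shows "set (build h g) \<subseteq> tree_levels \<and> tops (build h g) = h \<and> root_ops (build h g) = g"
  using assms
proof (induction g arbitrary: h)
  case Nil
  then show ?case
    by (simp add: tops_def root_ops_def)
next
  case (Cons q g)
  define n where "n = length (fst q)"
  have h: "h = take n h @ drop n h"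
    by simp
  have roots: "roots (take n h) = fst q" "roots (drop n h) = leaves g"
    using Cons.prems(3) by (simp_all add: n_def)
  have forests: "take n h \<in> forests" "drop n h \<in> forests"
    using Cons.prems(1) h by (metis forests_simps(3))+
  have "Tree (map Op (take n h)) q \<in> tree_levels"
    using roots(1) forests(1) Cons.prems(2) unfolding tree_levels_def mem_Collect_eq
    by (intro exI[of _ "take n h"] exI[of _ q]) (simp del: roots_simps)
  moreover have "set (build (drop n h) g) \<subseteq> tree_levels \<and> tops (build (drop n h) g) = drop n h \<and>
      root_ops (build (drop n h) g) = g"
    using forests(2) Cons.prems(2) roots(2) by (intro Cons.IH) auto
  ultimately show ?case
    by (simp add: tops_def root_ops_def comp_def flip: n_def)
qed

definition trees_over :: "opn list \<Rightarrow> (two, opn) level list set" where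
  "trees_over fs = {T. set T \<subseteq> tree_levels \<and> map contract T = map Op fs}"

lemma trees_over_eq:
  assumes "fs \<noteq> []"
  shows "{T \<in> Obj (Sr (lev 2)). map contract T = map Op fs} = trees_over fs"
  using assms unfolding Obj_Sr[OF discrete_on_Q2] trees_over_def by auto

lemma inj_map_Op [simp]: "map Op xs = map Op ys \<longleftrightarrow> xs = ys"
  by (simp add: inj_map_eq_map inj_def)

lemma image_mset_Op [simp]: "image_mset Op M = image_mset Op N \<longleftrightarrow> M = N"
proof
  assume "image_mset Op M = image_mset Op N"
  from arg_cong[OF this, of "image_mset root_op"] show "M = N"
    by (simp add: multiset.map_comp comp_def)
qed simp

lemma bij_betw_trees_factorisations:
  "bij_betw (\<lambda>T. (tops T, root_ops T)) (trees_over fs) (factorisations fs)"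
proof (rule bij_betw_byWitness[where f' = "\<lambda>(h, g). build h g"])
  show "\<forall>T\<in>trees_over fs. (case (tops T, root_ops T) of (h, g) \<Rightarrow> build h g) = T"
    by (auto simp: trees_over_def trees_tops)
  show "\<forall>p\<in>factorisations fs. (tops (case p of (h, g) \<Rightarrow> build h g), root_ops (case p of (h, g) \<Rightarrow> build h g)) = p"
    by (auto simp: factorisations_def build_trees)
  show "(\<lambda>T. (tops T, root_ops T)) ` trees_over fs \<subseteq> factorisations fs"
    by (auto simp: trees_over_def factorisations_def trees_tops)
  show "(\<lambda>(h, g). build h g) ` factorisations fs \<subseteq> trees_over fs"
  proof clarify
    fix h g
    assume hg: "(h, g) \<in> factorisations fs"
    then have "set (build h g) \<subseteq> tree_levels \<and> tops (build h g) = h \<and> root_ops (build h g) = g"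
      by (intro build_trees) (auto simp: factorisations_def)
    then show "build h g \<in> trees_over fs"
      using trees_tops(4)[of "build h g"] hg by (auto simp: trees_over_def factorisations_def)
  qed
qed

lemma finite_trees_over: "finite (trees_over fs)"
  using bij_betw_finite[OF bij_betw_trees_factorisations] finite_factorisations by blast

section \<open>Coefficients of the comultiplication\<close>

context
  fixes fs :: "opn list" and a b
  assumes fs: "fs \<in> forests" "fs \<noteq> []" and ab: "a \<in> Obj (Sr (lev 1))" "b \<in> Obj (Sr (lev 1))"
begin

lemma fs_Obj: "map Op fs \<in> Obj (Sr (lev 1))"
  using fs unfolding Obj_bar1 by blast

lemmas counting = dfib_counting[OF discrete_on_Q2 discrete_on_Q1 fs_Obj ab,
    of contract top_level root_level, folded Phi_eq, unfolded trees_over_eq[OF fs(2)], OF finite_trees_over]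

text \<open>A list of trees over \<open>fs\<close> whose outer faces have the classes of
  \<open>a\<close> and \<open>b\<close> contributes the product of the numbers of automorphisms of
  \<open>a\<close> and \<open>b\<close>, by the torsor property; any other contributes 0. The
  denominators cancel and a plain count remains.\<close>

lemma comult_coeff_eq: "comult_coeff bar_Ass2 (map Op fs) a b =
    of_nat (card {(h, g) \<in> factorisations fs. mset (map Op h) = mset a \<and> mset (map Op g) = mset b})"
proof -
  let ?Aa = "card (perms_to a a)" and ?Ab = "card (perms_to b b)"
  let ?P = "\<lambda>T. mset (concat (map top_level T)) = mset a \<and> mset (map root_level T) = mset b"
  have pos: "?Aa > 0" "?Ab > 0"
    using perms_to_nonempty finite_perms_to by (auto simp: card_gt_0_iff)
  have "(\<Sum>T\<in>trees_over fs. card (perms_to (concat (map top_level T)) a) * card (perms_to (map root_level T) b)) =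
      (\<Sum>T\<in>trees_over fs. if ?P T then ?Aa * ?Ab else 0)"
  proof (rule sum.cong)
    fix T
    have "perms_to x y = {}" if "mset x \<noteq> mset y" for x y :: "(two, opn) level list"
      using that perms_to_mset by blast
    then show "card (perms_to (concat (map top_level T)) a) * card (perms_to (map root_level T) b) =
        (if ?P T then ?Aa * ?Ab else 0)"
      using card_perms_to by (metis card.empty mult_is_0)
  qed simp
  also have "\<dots> = card {T \<in> trees_over fs. ?P T} * (?Aa * ?Ab)"
    using finite_trees_over[of fs] by (simp add: sum.inter_filter[symmetric])
  finally have "hcard (Phi bar_Ass2 (map Op fs) a b) = of_nat (card {T \<in> trees_over fs. ?P T} * (?Aa * ?Ab))"
    using counting(1) by simp
  then have "comult_coeff bar_Ass2 (map Op fs) a b = of_nat (card {T \<in> trees_over fs. ?P T})"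
    using pos ab by (simp add: comult_coeff_def simplices_bar card_Aut_Sr[OF discrete_on_Q1] del: Qn.simps One_nat_def)
  also have "card {T \<in> trees_over fs. ?P T} =
      card {(h, g) \<in> factorisations fs. mset (map Op h) = mset a \<and> mset (map Op g) = mset b}"
  proof (rule bij_betw_same_card)
    show "bij_betw (\<lambda>T. (tops T, root_ops T)) {T \<in> trees_over fs. ?P T}
        {(h, g) \<in> factorisations fs. mset (map Op h) = mset a \<and> mset (map Op g) = mset b}"
    proof (rule bij_betw_subset[OF bij_betw_trees_factorisations])
      have "?P T \<longleftrightarrow> mset (map Op (tops T)) = mset a \<and> mset (map Op (root_ops T)) = mset b"
        if "T \<in> trees_over fs" for T
        using that trees_tops(6,7)[of T] by (auto simp: trees_over_def)
      then show "(\<lambda>T. (tops T, root_ops T)) ` {T \<in> trees_over fs. ?P T} =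
          {(h, g) \<in> factorisations fs. mset (map Op h) = mset a \<and> mset (map Op g) = mset b}"
        using bij_betw_imp_surj_on[OF bij_betw_trees_factorisations, of fs] by force
    qed auto
  qed
  finally show ?thesis .
qed

lemma Phi_nonempty:
  assumes "Obj (Phi bar_Ass2 (map Op fs) a b) \<noteq> {}"
  obtains h g where "(h, g) \<in> factorisations fs" "mset (map Op h) = mset a" "mset (map Op g) = mset b"
proof -
  obtain T where T: "T \<in> trees_over fs" "mset (concat (map top_level T)) = mset a"
      "mset (map root_level T) = mset b"
    using counting(3)[OF assms] by auto
  moreover have "(tops T, root_ops T) \<in> factorisations fs"
    using T(1) bij_betw_trees_factorisations bij_betwE by blast
  ultimately show ?thesis
    using that trees_tops(6,7)[of T] by (auto simp: trees_over_def)
qed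

end

text \<open>A list of units is determined by its colours, so the strict fibre of the degeneracy has
  at most one element; this yields the counit.\<close>

lemma unit_levels_eq:
  assumes "fs \<in> forests" "fs \<noteq> []"
  shows "{T \<in> Obj (Sr (lev 0)). map unit_level T = map Op fs} = (if identity_forest fs then {map Col (roots fs)} else {})"
proof -
  have unit: "map unit_level (map Col cs) = map Op (corollas cs)" for cs
    by (simp add: corollas_def comp_def)
  have "T = map Col (roots fs) \<and> identity_forest fs"
    if T: "set T \<subseteq> range Col" "map unit_level T = map Op fs" for T
  proof -
    obtain cs where cs: "T = map Col cs"
      using T(1) by (metis ex_map_conv subset_iff rangeE)
    have "corollas cs = fs"
      using T(2) unfolding cs unit by (simp only: inj_map_Op)
    then show ?thesis
      by (auto simp: cs)
  qed
  moreover have "map unit_level (map Col (roots fs)) = map Op fs" if "identity_forest fs"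
    unfolding unit using identity_forest_roots[OF that] by simp
  ultimately show ?thesis
    using assms(2) unfolding Obj_Sr[OF discrete_on_Q0] by auto
qed

lemma counit_fibre_card:
  assumes "fs \<in> forests" "fs \<noteq> []"
  shows "hcard (counit_fibre bar_Ass2 (map Op fs)) = (if identity_forest fs then 1 else 0)"
    and "finite_gpd (counit_fibre bar_Ass2 (map Op fs))"
proof -
  have "map Op fs \<in> Obj (Sr (lev 1))"
    using assms unfolding Obj_bar1 by blast
  note fib_invariant[OF discrete_on_Q0 discrete_on_Q1 this, of unit_level, folded counit_fibre_eq,
      unfolded unit_levels_eq[OF assms]]
  then show "hcard (counit_fibre bar_Ass2 (map Op fs)) = (if identity_forest fs then 1 else 0)"
    and "finite_gpd (counit_fibre bar_Ass2 (map Op fs))"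
    by auto
qed

text \<open>The empty tuple is not an object of \<open>Sr\<close>; its place is taken by the
  adjoined unit \<open>None\<close>.\<close>

definition fclass :: "opn list \<Rightarrow> (two, opn) level list set option" where
  "fclass fs = (if fs = [] then None else Some (cls (Sr (lev 1)) (map Op fs)))"

lemma fclass_Nil [simp]: "fclass [] = None"
  by (simp add: fclass_def)

lemma fclass_nonempty:
  assumes "fs \<in> forests" "fs \<noteq> []"
  shows "fclass fs = Some {x. mset x = mset (map Op fs)}"
  using assms cls_Sr[OF discrete_on_Q1, of "map Op fs"] unfolding Obj_bar1 fclass_def by auto

text \<open>With \<open>fmono_eq_iff\<close> this says that both presentations identify the same
  lists, which is what the comparison of the two bialgebras needs.\<close>

lemma fclass_eq_iff:
  assumes "fs \<in> forests" "gs \<in> forests"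
  shows "fclass fs = fclass gs \<longleftrightarrow> mset fs = mset gs"
proof (cases "fs = [] \<or> gs = []")
  case True
  then show ?thesis
    by (auto simp: fclass_def)
next
  case False
  then have f: "fclass fs = Some {x. mset x = mset (map Op fs)}" "fclass gs = Some {x. mset x = mset (map Op gs)}"
    using assms fclass_nonempty[of fs] fclass_nonempty[of gs] by blast+
  show ?thesis
  proof
    assume "fclass fs = fclass gs"
    then have "map Op fs \<in> {x :: (two, opn) level list. mset x = mset (map Op gs)}"
      unfolding f option.inject by blast
    then show "mset fs = mset gs"
      by simp
  next
    assume "mset fs = mset gs"
    then show "fclass fs = fclass gs"
      unfolding f by simp
  qed
qed

lemma rep_pi0:
  assumes "c \<in> pi0 (Sr (lev 1))"
  obtains fs where "fs \<in> forests" "fs \<noteq> []" "rep c = map Op fs" "Some c = fclass fs"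
proof -
  obtain fs where fs: "fs \<in> forests" "fs \<noteq> []" "rep c = map Op fs"
    using rep_Sr(1)[OF discrete_on_Q1 assms] unfolding Obj_bar1 by blast
  then show ?thesis
    using that rep_Sr(2)[OF discrete_on_Q1 assms] by (simp add: fclass_nonempty)
qed

lemma fclass_pi0:
  assumes "fs \<in> forests" "fs \<noteq> []"
  obtains c where "c \<in> pi0 (Sr (lev 1))" "fclass fs = Some c"
  using assms that[of "cls (Sr (lev 1)) (map Op fs)"]
  unfolding pi0_Sr[OF discrete_on_Q1] Obj_bar1 by (auto simp: fclass_def)

lemma factorisations_nonempty:
  assumes "(h, g) \<in> factorisations fs" "fs \<noteq> []"
  shows "h \<noteq> []" "g \<noteq> []"
proof -
  show "h \<noteq> []"
    using factorisations_leaves_roots(1,3)[OF assms(1)] assms(2) by (cases fs) auto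
  show "g \<noteq> []"
    using factorisations_leaves_roots(2)[OF assms(1)] assms(2) by (metis roots_simps(1,7))
qed

lemma has_incidence_cardinality_bar: "has_incidence_cardinality bar_Ass2"
  unfolding has_incidence_cardinality_def simplices_bar
proof (intro ballI conjI)
  fix f
  assume f: "f \<in> Obj (Sr (lev 1))"
  then obtain fs where fs: "f = map Op fs" "fs \<in> forests" "fs \<noteq> []"
    unfolding Obj_bar1 by blast
  show "finite (Aut (Sr (lev 1)) f)"
    by (rule finite_Aut_Sr[OF discrete_on_Q1 f])
  show "finite_gpd (counit_fibre bar_Ass2 f)"
    using counit_fibre_card(2) fs by simp
  show "finite_gpd (Phi bar_Ass2 f a b)" if "a \<in> Obj (Sr (lev 1))" "b \<in> Obj (Sr (lev 1))" for a b
    unfolding fs(1) by (rule counting(2)[OF fs(2,3) that])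
  let ?A = "{(a, b) \<in> pi0 (Sr (lev 1)) \<times> pi0 (Sr (lev 1)). Obj (Phi bar_Ass2 f (rep a) (rep b)) \<noteq> {}}"
  \<comment> \<open>A class is recovered from the multiset of its representative, and a nonempty
    fibre realises both multisets by a factorisation of \<open>fs\<close>, of which there are
    finitely many.\<close>
  have "?A \<subseteq> (\<lambda>(h, g). ({x. mset x = mset (map Op h)}, {x. mset x = mset (map Op g)})) ` factorisations fs"
  proof clarify
    fix a b
    assume a: "a \<in> pi0 (Sr (lev 1))" and b: "b \<in> pi0 (Sr (lev 1))" and ne: "Obj (Phi bar_Ass2 f (rep a) (rep b)) \<noteq> {}"
    obtain h g where hg: "(h, g) \<in> factorisations fs" "mset (map Op h) = mset (rep a)" "mset (map Op g) = mset (rep b)"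
      using Phi_nonempty[OF fs(2,3) rep_Sr(1)[OF discrete_on_Q1 a] rep_Sr(1)[OF discrete_on_Q1 b]] ne fs(1)
      by metis
    then have "(a, b) = ({x. mset x = mset (map Op h)}, {x. mset x = mset (map Op g)})"
      using rep_Sr(2)[OF discrete_on_Q1 a] rep_Sr(2)[OF discrete_on_Q1 b] by simp
    then show "(a, b) \<in> (\<lambda>(h, g). ({x. mset x = mset (map Op h)}, {x. mset x = mset (map Op g)})) ` factorisations fs"
      using hg(1) by (intro image_eqI[where x = "(h, g)"]) auto
  qed
  then show "finite ?A"
    by (rule finite_subset) (intro finite_imageI finite_factorisations)
qed

text \<open>Comparison of coefficients. \<open>incidence_comult\<close> evaluates at the chosen
  representative, so the sum is at first over the factorisations of that particular list.\<close>

lemma incidence_comult_rep: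
  assumes c: "c \<in> pi0 (Sr (lev 1))" and fs: "fs \<in> forests" "fs \<noteq> []" "rep c = map Op fs"
  shows "incidence_comult bar_Ass2 (Some c) = (\<Sum>(h, g)\<in>factorisations fs. delta (fclass h, fclass g))"
proof -
  let ?s = "\<Sum>(h, g)\<in>factorisations fs. delta (fclass h, fclass g)"
  have s: "Poly_Mapping.lookup ?s (x, y) = of_nat (card {(h, g) \<in> factorisations fs. fclass h = x \<and> fclass g = y})"
    for x y
  proof -
    have "Poly_Mapping.lookup ?s (x, y) =
        (\<Sum>p\<in>factorisations fs. if fclass (fst p) = x \<and> fclass (snd p) = y then 1 else 0)"
      by (auto simp: lookup_sum split_def lookup_delta intro!: sum.cong)
    also have "\<dots> = of_nat (card {p \<in> factorisations fs. fclass (fst p) = x \<and> fclass (snd p) = y})"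
      by (simp add: sum.inter_filter[symmetric] finite_factorisations)
    finally show ?thesis
      by (simp add: split_def)
  qed
  have "(\<lambda>(a, b). case (a, b) of
       (Some a', Some b') \<Rightarrow>
         if a' \<in> pi0 (simplices bar_Ass2 1) \<and> b' \<in> pi0 (simplices bar_Ass2 1)
         then comult_coeff bar_Ass2 (rep c) (rep a') (rep b') else 0
     | _ \<Rightarrow> 0) (x, y) = Poly_Mapping.lookup ?s (x, y)" for x y
  proof (cases "\<exists>a b. x = Some a \<and> y = Some b \<and> a \<in> pi0 (Sr (lev 1)) \<and> b \<in> pi0 (Sr (lev 1))")
    case True
    then obtain a b where xy: "x = Some a" "y = Some b" and a: "a \<in> pi0 (Sr (lev 1))" and b: "b \<in> pi0 (Sr (lev 1))"
      by blast
    have eq: "fclass h = Some a' \<longleftrightarrow> mset (map Op h) = mset (rep a')"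
      if h: "h \<in> forests" "h \<noteq> []" and a': "a' \<in> pi0 (Sr (lev 1))" for h a'
    proof -
      obtain k where "k \<in> forests" "rep a' = map Op k" "Some a' = fclass k"
        using rep_pi0[OF a'] by blast
      then show ?thesis
        using fclass_eq_iff[OF h(1)] by simp
    qed
    have "{(h, g) \<in> factorisations fs. fclass h = x \<and> fclass g = y} =
        {(h, g) \<in> factorisations fs. mset (map Op h) = mset (rep a) \<and> mset (map Op g) = mset (rep b)}"
    proof (intro Collect_cong, clarify)
      fix h g
      show "((h, g) \<in> factorisations fs \<and> fclass h = x \<and> fclass g = y) =
        ((h, g) \<in> factorisations fs \<and> mset (map Op h) = mset (rep a) \<and> mset (map Op g) = mset (rep b))"
        using eq[OF _ _ a, of h] eq[OF _ _ b, of g] factorisations_leaves_roots(4,5)[of h g fs]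
          factorisations_nonempty[of h g fs] fs(2) by (auto simp: xy)
    qed
    then show ?thesis
      using comult_coeff_eq[OF fs(1,2) rep_Sr(1)[OF discrete_on_Q1 a] rep_Sr(1)[OF discrete_on_Q1 b]] a b
      by (simp add: s xy fs(3) simplices_bar del: Qn.simps One_nat_def)
  next
    case False
    \<comment> \<open>Factors of a nonempty list are nonempty, so the adjoined unit never occurs in
      these sums.\<close>
    have "{(h, g) \<in> factorisations fs. fclass h = x \<and> fclass g = y} = {}"
    proof -
      have "\<not> (fclass h = x \<and> fclass g = y)" if hg: "(h, g) \<in> factorisations fs" for h g
        using False fclass_pi0[of h] fclass_pi0[of g] factorisations_leaves_roots(4,5)[OF hg]
          factorisations_nonempty[OF hg fs(2)] by metis
      then show ?thesis
        by auto
    qed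
    then have "Poly_Mapping.lookup ?s (x, y) = 0"
      unfolding s by (simp only: card.empty of_nat_0)
    then show ?thesis
      using False by (cases x; cases y) (auto simp: simplices_bar simp del: Qn.simps One_nat_def)
  qed
  \<comment> \<open>Being the coefficient function of a finite sum, the given function has finite
    support, as \<open>Abs_poly_mapping\<close> requires.\<close>
  then have "incidence_comult bar_Ass2 (Some c) = Abs_poly_mapping (Poly_Mapping.lookup ?s)"
    by (simp only: incidence_comult.simps) (rule arg_cong[where f = Abs_poly_mapping], auto simp only: fun_eq_iff split_paired_all)
  then show ?thesis
    by (simp only: lookup_inverse)
qed

text \<open>Transporting the sum along \<open>fmono h \<mapsto> fclass h\<close> reduces the claim to the commutativity of the
  multiplication of polynomials.\<close>

lemma sum_factorisations_mset:
  assumes "fs \<in> forests" "gs \<in> forests" "mset fs = mset gs"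
  shows "(\<Sum>(h, g)\<in>factorisations fs. delta (fclass h, fclass g)) =
    (\<Sum>(h, g)\<in>factorisations gs. delta (fclass h, fclass g))"
proof -
  define \<nu> where "\<nu> m = fclass (inv_into forests fmono m)" for m
  have \<nu>: "\<nu> (fmono h) = fclass h" if "h \<in> forests" for h
  proof -
    have "inv_into forests fmono (fmono h) \<in> forests" "fmono (inv_into forests fmono (fmono h)) = fmono h"
      using that by (auto intro: inv_into_into f_inv_into_f)
    then show ?thesis
      using that by (simp add: \<nu>_def fclass_eq_iff fmono_eq_iff)
  qed
  have "(\<Sum>(h, g)\<in>factorisations k. delta (fclass h, fclass g)) =
      lin_ext (\<lambda>(m, n). delta (\<nu> m, \<nu> n)) (fac_sum k)" for k
    unfolding fac_sum_def lin_sum[OF lin_lin_ext]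
    by (rule sum.cong) (auto simp: \<nu> factorisations_def)
  moreover have "fac_sum fs = fac_sum gs"
    using assms mono_prod_mono fmono_eq_iff by metis
  ultimately show ?thesis
    by simp
qed

text \<open>Product, comultiplication and counit are defined through chosen representatives. Each is
  computed at the representative and carried back to the given list, of which the representative is
  a reordering.\<close>

lemma factorisation_bialgebra_incidence:
  "factorisation_bialgebra (incidence_bialgebra bar_Ass2 (@)) fclass (incidence_times bar_Ass2 (@))
    (incidence_comult bar_Ass2) (incidence_counit bar_Ass2)"
proof
  have "fclass ` forests = insert (fclass []) (fclass ` (forests - {[]}))"
    unfolding image_insert[symmetric] by (simp add: insert_absorb)
  moreover have "fclass ` (forests - {[]}) = Some ` pi0 (Sr (lev 1))"
    unfolding pi0_Sr[OF discrete_on_Q1] Obj_bar1 image_image by (auto simp: fclass_def)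
  ultimately show "basis (incidence_bialgebra bar_Ass2 (@)) = fclass ` forests"
    by (simp add: incidence_bialgebra_def simplices_bar fclass_def del: Qn.simps One_nat_def)
next
  fix xs ys
  assume xs: "xs \<in> forests" and ys: "ys \<in> forests"
  show "incidence_times bar_Ass2 (@) (fclass xs) (fclass ys) = fclass (xs @ ys)"
  proof (cases "xs = [] \<or> ys = []")
    case True
    then show ?thesis
      by (cases "fclass xs") auto
  next
    case False
    obtain c where c: "c \<in> pi0 (Sr (lev 1))" "fclass xs = Some c"
      using xs False fclass_pi0 by blast
    obtain e where e: "e \<in> pi0 (Sr (lev 1))" "fclass ys = Some e"
      using ys False fclass_pi0 by blast
    obtain xs' where xs': "xs' \<in> forests" "xs' \<noteq> []" "rep c = map Op xs'" "Some c = fclass xs'"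
      using rep_pi0[OF c(1)] by blast
    obtain ys' where ys': "ys' \<in> forests" "rep e = map Op ys'" "Some e = fclass ys'"
      using rep_pi0[OF e(1)] by blast
    have "incidence_times bar_Ass2 (@) (fclass xs) (fclass ys) = Some (cls (Sr (lev 1)) (map Op (xs' @ ys')))"
      by (simp add: c(2) e(2) xs'(3) ys'(2) simplices_bar del: Qn.simps One_nat_def)
    also have "\<dots> = fclass (xs' @ ys')"
      using xs'(2) by (simp add: fclass_def)
    also have "\<dots> = fclass (xs @ ys)"
      using fclass_eq_iff[OF xs xs'(1)] fclass_eq_iff[OF ys ys'(1)] c e xs' ys' xs ys
      by (subst fclass_eq_iff) auto
    finally show ?thesis .
  qed
next
  fix f
  assume f: "f \<in> forests"
  show "incidence_comult bar_Ass2 (fclass f) = (\<Sum>(h, g)\<in>factorisations f. delta (fclass h, fclass g))"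
  proof (cases "f = []")
    case True
    then show ?thesis
      by (simp add: fclass_def)
  next
    case False
    obtain c where c: "c \<in> pi0 (Sr (lev 1))" "fclass f = Some c"
      using f False fclass_pi0 by blast
    obtain f' where f': "f' \<in> forests" "f' \<noteq> []" "rep c = map Op f'" "Some c = fclass f'"
      using rep_pi0[OF c(1)] by blast
    have "mset f' = mset f"
      using fclass_eq_iff[OF f'(1) f] c f' by simp
    then show ?thesis
      using incidence_comult_rep[OF c(1) f'(1-3)] sum_factorisations_mset[OF f'(1) f] c(2) by simp
  qed
  show "incidence_counit bar_Ass2 (fclass f) = (if identity_forest f then 1 else 0)"
  proof (cases "f = []")
    case True
    then show ?thesis
      by (simp add: fclass_def)
  next
    case False
    obtain c where c: "c \<in> pi0 (Sr (lev 1))" "fclass f = Some c"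
      using f False fclass_pi0 by blast
    obtain f' where f': "f' \<in> forests" "f' \<noteq> []" "rep c = map Op f'" "Some c = fclass f'"
      using rep_pi0[OF c(1)] by blast
    have "mset f' = mset f"
      using fclass_eq_iff[OF f'(1) f] c f' by simp
    then have "identity_forest f' \<longleftrightarrow> identity_forest f"
      using mset_eq_setD by (auto simp: identity_forest_def)
    then show ?thesis
      using counit_fibre_card(1)[OF f'(1,2)] c(2) f'(3) by simp
  qed
qed (simp_all add: incidence_bialgebra_def fclass_def)

theorem theorem5p16:
  shows "has_incidence_cardinality (bar_Sr Ass2) \<and>
    isomorphic_bialgebras FdB2 (incidence_bialgebra (bar_Sr Ass2) (@))"
proof
  show "has_incidence_cardinality (bar_Sr Ass2)"
    by (rule has_incidence_cardinality_bar)
  show "isomorphic_bialgebras FdB2 (incidence_bialgebra (bar_Sr Ass2) (@))"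
    using factorisation_bialgebra_FdB2 factorisation_bialgebra_incidence
    by (rule factorisation_bialgebras_isomorphic) (simp add: fmono_eq_iff fclass_eq_iff)
qed

end
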